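(* Let $G=(V,E,\pi)$ be a locally finite Borel graph and let $(A,B)$ be a Borel bipartition of $G$ that has combinatorial expansion. If $\mathsf{asi}(G)<\infty$ and $\deg_G(y)\le 2$ for all $y\in B$, then $G$ has a Borel matching covering $A$.
   Context: A Borel graph (multigraph) is a triple $G=(V,E,\pi)$ where the vertex set $V$ and the edge set $E$ are standard Borel spaces and $\pi\colon E\to[V]^2$ is a Borel map sending each edge to its pair of endpoints; $[V]^2$ is the set of unordered pairs of distinct elements of $V$. Thus graphs are undirected and loopless, and parallel edges are allowed; $G$ is simple if $\pi$ is injective. The underlying simple graph of $G$ is the simple graph on $V$ in which $\{x,y\}$ is an edge iff $\{x,y\}\in\pi(E)$. $\deg_G(x)$ is the number of edges incident to $x$; $G$ is locally finite if all degrees are finite. $N_G(x)$ is the set of neighbors of $x$, and $N_G(S)=\bigcup_{x\in S}N_G(x)$. A bipartition of $G$ is a partition $V=A\sqcup B$ such that every edge has one endpoint in $A$ and the other in $B$; it is Borel if $A$ and $B$ are Borel sets. It has combinatorial expansion if there is $c>1$ such that $|N_G(S)|\ge c|S|$ for every finite set $S\subseteq A$. Asymptotic separation index: For a simple graph $G$ and $k\in\mathbb{N}$, $G^k$ is the simple graph on the same vertex set in which $\{x,y\}$ is an edge iff $0<\mathrm{dist}_G(x,y)\le k$. A set $X$ of vertices of a graph $H$ is $H$-finite if every connected component of the induced subgraph $H[X]$ is finite. For a simple locally finite Borel graph $G$, $\mathsf{asi}(G)$ is the smallest $s\in\mathbb{N}$ such that for every $k\in\mathbb{N}$ the vertex set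 of $G$ can be covered by $s+1$ Borel $G^k$-finite sets; if no such $s$ exists, $\mathsf{asi}(G)=\infty$. For a multigraph, $\mathsf{asi}(G)$ is that of its underlying simple graph. A matching is a set $M\subseteq E$ of edges whose endpoint sets are pairwise disjoint; it is Borel if it is a Borel subset of $E$. $M$ covers $A$ if every $x\in A$ is an endpoint of some edge in $M$. *)

theory Defs
  imports "HOL-Analysis.Analysis" "HOL-Library.Extended_Nat"
begin

text \<open>
  A measurable space is represented by a value of type \<^typ>\<open>'a measure\<close> of which only the carrier
  \<^term>\<open>space M\<close> and the sigma-algebra \<^term>\<open>sets M\<close> are used; the measure it carries is irrelevant.
\<close>

definition polish_topology :: "'a topology \<Rightarrow> bool" where
  "polish_topology X \<longleftrightarrow> completely_metrizable_space X \<and> separable_space X"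

definition standard_borel :: "'a measure \<Rightarrow> bool" where
  "standard_borel M \<longleftrightarrow>
    (\<exists>X. polish_topology X \<and> topspace X = space M \<and>
         sets M = sigma_sets (topspace X) {U. openin X U})"

definition unordered_pairs :: "'a set \<Rightarrow> 'a set set" where
  "unordered_pairs S = {{x, y} |x y. x \<in> S \<and> y \<in> S \<and> x \<noteq> y}"

text \<open>
  The Borel structure on \<open>[V]\<^sup>2\<close> is the quotient one: a set \<open>S\<close> of unordered pairs is Borel iff the set
  of all ordered pairs \<open>(x, y)\<close> with \<open>{x, y} \<in> S\<close> is Borel in the space of ordered pairs of distinct
  points, which is a subspace of \<open>V \<times> V\<close>.
\<close>

definition ordered_pairs_space :: "'a measure \<Rightarrow> ('a \<times> 'a) measure" where
  "ordered_pairs_space M = restrict_space (M \<Otimes>\<^sub>M M) {(x, y). x \<noteq> y}"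

definition pairs_space :: "'a measure \<Rightarrow> 'a set measure" where
  "pairs_space M = sigma (unordered_pairs (space M))
     {S. S \<subseteq> unordered_pairs (space M) \<and>
         {(x, y). (x, y) \<in> space (ordered_pairs_space M) \<and> {x, y} \<in> S} \<in> sets (ordered_pairs_space M)}"

lemma space_ordered_pairs_space:
  "space (ordered_pairs_space M) = {(x, y). x \<in> space M \<and> y \<in> space M \<and> x \<noteq> y}"
  by (auto simp: ordered_pairs_space_def space_restrict_space space_pair_measure)

lemma space_pairs_space: "space (pairs_space M) = unordered_pairs (space M)"
  by (auto simp: pairs_space_def intro!: space_measure_of)

lemma sets_pairs_space:
  "S \<in> sets (pairs_space M) \<longleftrightarrow>
     S \<subseteq> unordered_pairs (space M) \<and>
     {(x, y). (x, y) \<in> space (ordered_pairs_space M) \<and> {x, y} \<in> S} \<in> sets (ordered_pairs_space M)"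
proof -
  let ?O = "ordered_pairs_space M" and ?U = "unordered_pairs (space M)"
  define pre where "pre S = {(x, y). (x, y) \<in> space ?O \<and> {x, y} \<in> S}" for S
  let ?C = "{S. S \<subseteq> ?U \<and> pre S \<in> sets ?O}"
  have "sigma_algebra ?U ?C"
    unfolding sigma_algebra_iff2
  proof (intro conjI ballI allI impI)
    show "?C \<subseteq> Pow ?U" by auto
    have "pre {} = {}" by (simp add: pre_def)
    then show "{} \<in> ?C" by simp
  next
    fix S assume "S \<in> ?C"
    have "pre (?U - S) = space ?O - pre S"
      unfolding pre_def unordered_pairs_def space_ordered_pairs_space by auto
    with \<open>S \<in> ?C\<close> show "?U - S \<in> ?C" by auto
  next
    fix T :: "nat \<Rightarrow> 'a set set" assume T: "range T \<subseteq> ?C"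
    have "pre (\<Union>i. T i) = (\<Union>i. pre (T i))" by (auto simp: pre_def)
    with T show "(\<Union>i. T i) \<in> ?C" by auto
  qed
  then have "sets (sigma ?U ?C) = ?C" by (rule sigma_algebra.sets_measure_of_eq)
  then show ?thesis unfolding pairs_space_def pre_def by blast
qed

record ('v, 'e) multigraph =
  verts :: "'v measure"
  edges :: "'e measure"
  ends :: "'e \<Rightarrow> 'v set"

definition borel_graph :: "('v, 'e) multigraph \<Rightarrow> bool" where
  "borel_graph G \<longleftrightarrow>
     standard_borel (verts G) \<and> standard_borel (edges G) \<and>
     ends G \<in> measurable (edges G) (pairs_space (verts G))"

definition incident_edges :: "('v, 'e) multigraph \<Rightarrow> 'v \<Rightarrow> 'e set" where
  "incident_edges G x = {e \<in> space (edges G). x \<in> ends G e}"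

definition locally_finite :: "('v, 'e) multigraph \<Rightarrow> bool" where
  "locally_finite G \<longleftrightarrow> (\<forall>x \<in> space (verts G). finite (incident_edges G x))"

text \<open>Meaningful for locally finite graphs only, since \<^const>\<open>card\<close> of an infinite set is 0;
  likewise \<open>combinatorial_expansion\<close> below.\<close>

definition deg :: "('v, 'e) multigraph \<Rightarrow> 'v \<Rightarrow> nat" where
  "deg G x = card (incident_edges G x)"

text \<open>
  A simple graph is represented by its adjacency relation, a symmetric and irreflexive set of ordered
  pairs of vertices.
\<close>

definition underlying_simple_graph :: "('v, 'e) multigraph \<Rightarrow> ('v \<times> 'v) set" where
  "underlying_simple_graph G = {(x, y). \<exists>e \<in> space (edges G). ends G e = {x, y}}"

definition neighbors :: "('v, 'e) multigraph \<Rightarrow> 'v \<Rightarrow> 'v set" where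
  "neighbors G x = {y. (x, y) \<in> underlying_simple_graph G}"

definition bipartition :: "('v, 'e) multigraph \<Rightarrow> 'v set \<Rightarrow> 'v set \<Rightarrow> bool" where
  "bipartition G A B \<longleftrightarrow>
     A \<union> B = space (verts G) \<and> A \<inter> B = {} \<and>
     (\<forall>e \<in> space (edges G). \<exists>a \<in> A. \<exists>b \<in> B. ends G e = {a, b})"

definition borel_bipartition :: "('v, 'e) multigraph \<Rightarrow> 'v set \<Rightarrow> 'v set \<Rightarrow> bool" where
  "borel_bipartition G A B \<longleftrightarrow>
     bipartition G A B \<and> A \<in> sets (verts G) \<and> B \<in> sets (verts G)"

text \<open>Expansion is required of the first side of the bipartition only.\<close>

definition combinatorial_expansion :: "('v, 'e) multigraph \<Rightarrow> 'v set \<Rightarrow> bool" where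
  "combinatorial_expansion G A \<longleftrightarrow>
     (\<exists>c::real. c > 1 \<and>
        (\<forall>S. S \<subseteq> A \<and> finite S \<longrightarrow> real (card (\<Union>x\<in>S. neighbors G x)) \<ge> c * real (card S)))"

text \<open>The distance is \<open>\<infinity>\<close> (the infimum of the empty set) between different components.\<close>

definition graph_dist :: "('v \<times> 'v) set \<Rightarrow> 'v \<Rightarrow> 'v \<Rightarrow> enat" where
  "graph_dist R x y = Inf {enat n |n. (x, y) \<in> R ^^ n}"

definition graph_power :: "('v \<times> 'v) set \<Rightarrow> nat \<Rightarrow> ('v \<times> 'v) set" where
  "graph_power R k = {(x, y). 0 < graph_dist R x y \<and> graph_dist R x y \<le> enat k}"

text \<open>\<open>component_in R X x\<close> is the component of \<open>x \<in> X\<close> in the subgraph of \<open>R\<close> induced by \<open>X\<close>.\<close>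

definition component_in :: "('v \<times> 'v) set \<Rightarrow> 'v set \<Rightarrow> 'v \<Rightarrow> 'v set" where
  "component_in R X x = (R \<inter> X \<times> X)\<^sup>* `` {x}"

definition graph_finite :: "('v \<times> 'v) set \<Rightarrow> 'v set \<Rightarrow> bool" where
  "graph_finite R X \<longleftrightarrow> (\<forall>x \<in> X. finite (component_in R X x))"

text \<open>\<open>asi_at_most V R s\<close>: for every \<open>k\<close>, the \<open>s + 1\<close> sets \<open>X 0, \<dots>, X s\<close> form a cover as required
  in the definition of the asymptotic separation index.\<close>

definition asi_at_most :: "'v measure \<Rightarrow> ('v \<times> 'v) set \<Rightarrow> nat \<Rightarrow> bool" where
  "asi_at_most V R s \<longleftrightarrow>
     (\<forall>k. \<exists>X :: nat \<Rightarrow> 'v set.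
        (\<forall>i \<le> s. X i \<in> sets V \<and> graph_finite (graph_power R k) (X i)) \<and>
        (\<Union>i \<le> s. X i) = space V)"

definition asi_simple :: "'v measure \<Rightarrow> ('v \<times> 'v) set \<Rightarrow> enat" where
  "asi_simple V R = Inf {enat s |s. asi_at_most V R s}"

definition asi :: "('v, 'e) multigraph \<Rightarrow> enat" where
  "asi G = asi_simple (verts G) (underlying_simple_graph G)"

definition matching :: "('v, 'e) multigraph \<Rightarrow> 'e set \<Rightarrow> bool" where
  "matching G M \<longleftrightarrow>
     M \<subseteq> space (edges G) \<and> pairwise (\<lambda>e f. disjnt (ends G e) (ends G f)) M"

definition borel_matching :: "('v, 'e) multigraph \<Rightarrow> 'e set \<Rightarrow> bool" where
  "borel_matching G M \<longleftrightarrow> matching G M \<and> M \<in> sets (edges G)"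

definition covers :: "('v, 'e) multigraph \<Rightarrow> 'e set \<Rightarrow> 'v set \<Rightarrow> bool" where
  "covers G M A \<longleftrightarrow> (\<forall>x \<in> A. \<exists>e \<in> M. x \<in> ends G e)"

end

theory Submission
  imports Defs
begin

text \<open>
  A vertex of \<open>B\<close> with two neighbours is an edge between two vertices of \<open>A\<close>, so \<open>B\<close> is the edge set of a
  multigraph \<open>H\<close> on \<open>A\<close> with loops, and a matching that covers \<open>A\<close> selects for every vertex an edge of \<open>H\<close> at that
  vertex such that no edge is selected twice. Expansion says that a finite set \<open>S\<close> of vertices
  touches at least \<open>c * card S\<close> edges, with \<open>c > 1\<close>.

  A connected set of \<open>m\<close> vertices with at least \<open>m\<close> inner edges can be matched by these alone. Any other connected
  set of \<open>m\<close> vertices has exactly \<open>m - 1\<close> inner edges, hence more than \<open>(c - 1) * m\<close> boundary edges, and it can be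
  matched as soon as it may use a single one of these; connectedness gives Hall's condition for proper
  subsets in both cases. So \<open>A\<close> is partitioned in a Borel way into connected cells of bounded radius which are so large
  that every cell that depends on a boundary edge has at least \<open>2 ^ (s + 2)\<close> of them, where \<open>s\<close> bounds the asymptotic
  separation index (\<open>exists_cells\<close>, \<open>large_cell_or_expanding_internally\<close>,
  \<open>matching_from_owned_boundary\<close>). It remains to give distinct boundary edges to these cells.

  For this the separation index provides \<open>s + 1\<close> Borel sets that cover the cells and have finite components even
  if cells at distance two are joined; here it matters that cells have bounded radius. The sets are
  treated one by one. Treating a set means to match its cells, and with them every other
  cell that would lose too many of its edges to them; each of the remaining cells keeps more than half of the
  number of edges guaranteed to it so far. Since an edge has two ends, Hall's condition
  holds as long as degrees are at least 2 (\<open>matching_of_high_degree_vertices\<close>).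

  All choices are made on finite components. There are countably many Borel sets of edges that cut out
  every subset of every finite set, so each component can take the first of them that solves its
  problem (\<open>finite_component_matching\<close>). The sets formed on the way are Borel
  because finite-to-one Borel maps between standard Borel spaces map Borel sets to Borel sets
  (\<open>finite_to_one_image_measurable\<close>), which is derived from Novikov's separation theorem.
\<close>

section \<open>Novikov separation and finite-to-one continuous images\<close>

definition cylinder :: "(nat \<Rightarrow> nat) \<Rightarrow> nat \<Rightarrow> (nat \<Rightarrow> nat) set" where
  "cylinder x n = {z. \<forall>i<n. z i = x i}"

lemma open_coordinate: "open {z :: nat \<Rightarrow> nat. P (z i)}"
proof -
  have "continuous_on UNIV (\<lambda>z :: nat \<Rightarrow> nat. z i)" by simp
  moreover have "open {n :: nat. P n}" by (simp add: open_discrete)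
  ultimately have "open ((\<lambda>z :: nat \<Rightarrow> nat. z i) -` {n. P n})" by (rule open_vimage[rotated])
  then show ?thesis by (simp add: vimage_def)
qed

lemma closed_coordinate: "closed {z :: nat \<Rightarrow> nat. P (z i)}"
proof -
  have "- {z :: nat \<Rightarrow> nat. P (z i)} = {z. \<not> P (z i)}" by auto
  then show ?thesis using open_coordinate[of "\<lambda>n. \<not> P n"] by (simp add: closed_def)
qed

lemma baire_hausdorff:
  fixes x y :: "nat \<Rightarrow> nat"
  assumes "x \<noteq> y"
  shows "\<exists>U V. open U \<and> open V \<and> x \<in> U \<and> y \<in> V \<and> U \<inter> V = {}"
proof -
  obtain i where "x i \<noteq> y i" using assms by blast
  then show ?thesis
    using open_coordinate[of "\<lambda>n. n = x i" i] open_coordinate[of "\<lambda>n. n = y i" i]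
    by (intro exI[of _ "{z. z i = x i}"] exI[of _ "{z. z i = y i}"]) auto
qed

lemma measurable_coordinate:
  "(\<lambda>z :: nat \<Rightarrow> nat. z i) \<in> measurable borel (count_space UNIV)"
proof -
  have "(\<lambda>z :: nat \<Rightarrow> nat. z i) -` S \<inter> space borel \<in> sets borel" for S
    using open_coordinate[of "\<lambda>n. n \<in> S" i] by (simp add: vimage_def)
  then show ?thesis by (simp add: measurable_def)
qed

lemma measurable_into_baire_space:
  assumes "\<And>i. (\<lambda>w. f w i) \<in> measurable M (count_space UNIV)"
  shows "f \<in> measurable M (borel :: (nat \<Rightarrow> nat) measure)"
proof (rule measurable_coordinatewise_then_product)
  have "measurable M (borel :: nat measure) = measurable M (count_space UNIV)"
    by (rule measurable_cong_sets) (simp_all add: sets_borel_eq_count_space)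
  then show "(\<lambda>w. f w i) \<in> borel_measurable M" for i using assms by simp
qed

lemma open_contains_cylinder:
  assumes "open S" and "x \<in> S"
  shows "\<exists>n. cylinder x n \<subseteq> S"
proof -
  obtain U where U: "finite {i. U i \<noteq> (UNIV :: nat set)}" "x \<in> Pi\<^sub>E UNIV U" "Pi\<^sub>E UNIV U \<subseteq> S"
    using product_topology_open_contains_basis[of "\<lambda>_. euclidean" UNIV S x] assms
    unfolding open_fun_def by auto
  obtain n where n: "\<forall>i \<in> {i. U i \<noteq> UNIV}. i < n"
    using U(1) unfolding finite_nat_set_iff_bounded by blast
  have "z \<in> Pi\<^sub>E UNIV U" if z: "\<forall>i<n. z i = x i" for z
  proof -
    have "z i \<in> U i" for i
    proof (cases "U i = UNIV")
      case False
      then have "i < n" using n by auto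
      then show ?thesis using z U(2) by (auto simp: PiE_iff)
    qed auto
    then show ?thesis by (auto simp: PiE_iff)
  qed
  then have "cylinder x n \<subseteq> S" using U(3) unfolding cylinder_def by blast
  then show ?thesis by blast
qed

lemma mem_closed_if_cylinders_meet:
  assumes "closed K" and "\<And>n. K \<inter> cylinder x n \<noteq> {}"
  shows "x \<in> K"
  using open_contains_cylinder[of "- K" x] assms by (auto simp: closed_def)

lemma continuous_cylinder_into_open:
  assumes "continuous_on UNIV f" and "open U" and "f x \<in> U"
  shows "\<exists>n. f ` cylinder x n \<subseteq> U"
proof -
  have "open (f -` U)" using assms by (intro open_vimage) auto
  from open_contains_cylinder[OF this, of x] assms show ?thesis by auto
qed

text \<open>
  Call a sequence of sets separable if it has Borel supersets with empty intersection. Cutting one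
  member of a sequence into countably many pieces preserves inseparability for one of the pieces:
  otherwise take the union of the witnesses at that member and their intersection at all others.
  Starting from an inseparable sequence of images, step \<open>t = prod_encode (n, k)\<close> decides the value of
  coordinate \<open>k\<close> in the \<open>n\<close>-th set, so in the limit there is one point \<open>x n \<in> K n\<close> for each \<open>n\<close>.
  The values \<open>f (x n)\<close> are not all equal, and disjoint open neighbourhoods of two different values
  separate the sequence at a late stage.
\<close>

lemma novikov_separation:
  fixes f :: "(nat \<Rightarrow> nat) \<Rightarrow> (nat \<Rightarrow> nat)"
  assumes f: "continuous_on UNIV f"
    and K: "\<And>n :: nat. closed (K n)"
    and empty: "(\<Inter>n. f ` K n) = {}"
  shows "\<exists>C. (\<forall>n. C n \<in> sets borel \<and> f ` K n \<subseteq> C n) \<and> (\<Inter>n :: nat. C n) = {}"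
proof (rule ccontr)
  define sep where "sep A \<longleftrightarrow>
    (\<exists>C. (\<forall>n. C n \<in> sets borel \<and> A n \<subseteq> C n) \<and> (\<Inter>n :: nat. C n) = {})"
    for A :: "nat \<Rightarrow> (nat \<Rightarrow> nat) set"
  assume "\<not> ?thesis"
  then have nosep: "\<not> sep (\<lambda>n. f ` K n)" unfolding sep_def by blast
  have split: "sep A" if P: "\<And>j :: nat. sep (A(k := P j))" "A k \<subseteq> (\<Union>j. P j)" for A k P
  proof -
    have "\<forall>j. \<exists>C. (\<forall>n. C n \<in> sets borel \<and> (A(k := P j)) n \<subseteq> C n) \<and> (\<Inter>n :: nat. C n) = {}"
      using P unfolding sep_def by blast
    then obtain C where C: "\<And>j n. C j n \<in> sets borel" "\<And>j n. (A(k := P j)) n \<subseteq> C j n"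
      "\<And>j. (\<Inter>n. C j n) = {}"
      by metis
    define D where "D n = (if n = k then (\<Union>j. C j k) else (\<Inter>j. C j n))" for n
    have "D n \<in> sets borel" for n using C(1) by (auto simp: D_def)
    moreover have "A n \<subseteq> D n" for n
    proof (cases "n = k")
      case True
      have "P j \<subseteq> C j k" for j using C(2)[of j k] by simp
      then have "(\<Union>j. P j) \<subseteq> (\<Union>j. C j k)" by blast
      then show ?thesis using P(2) True by (simp add: D_def)
    next
      case False
      then have "A n \<subseteq> C j n" for j using C(2)[of j n] by simp
      then show ?thesis using False by (auto simp: D_def)
    qed
    moreover have "(\<Inter>n. D n) = {}"
    proof (rule ccontr)
      assume "(\<Inter>n. D n) \<noteq> {}"
      then obtain y where y: "\<And>n. y \<in> D n" by blast
      from y[of k] obtain j where j: "y \<in> C j k" by (auto simp: D_def)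
      have "y \<in> C j n" for n
        using y[of n] j by (cases "n = k") (auto simp: D_def)
      then show False using C(3)[of j] by blast
    qed
    ultimately show ?thesis unfolding sep_def by blast
  qed
  define piece where "piece y t n = {z \<in> K n. \<forall>k. prod_encode (n, k) < t \<longrightarrow> z k = y (prod_encode (n, k))}"
    for y :: "nat \<Rightarrow> nat" and t n
  have piece_cong: "piece y t = piece y' t" if "\<And>i. i < t \<Longrightarrow> y i = y' i" for y y' t
    using that by (auto simp: piece_def fun_eq_iff)
  have step: "\<exists>j. \<not> sep (\<lambda>n. f ` piece (y(t := j)) (Suc t) n)" if no: "\<not> sep (\<lambda>n. f ` piece y t n)" for y t
  proof (rule ccontr)
    assume "\<not> ?thesis"
    then have s: "sep (\<lambda>n. f ` piece (y(t := j)) (Suc t) n)" for j by blast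
    obtain m k where mk: "t = prod_encode (m, k)" by (metis prod_decode_inverse surj_pair)
    have eq: "(\<lambda>n. f ` piece (y(t := j)) (Suc t) n)
        = (\<lambda>n. f ` piece y t n)(m := f ` (piece y t m \<inter> {z. z k = j}))" for j
    proof
      fix n
      have "piece (y(t := j)) (Suc t) n = (if n = m then piece y t m \<inter> {z. z k = j} else piece y t n)"
      proof (cases "n = m")
        case True
        have "prod_encode (m, k') < Suc t \<longleftrightarrow> prod_encode (m, k') < t \<or> k' = k" for k'
          using mk by (auto simp: less_Suc_eq prod_encode_eq)
        then show ?thesis using True mk by (auto simp: piece_def prod_encode_eq)
      next
        case False
        have "prod_encode (n, k') < Suc t \<longleftrightarrow> prod_encode (n, k') < t" for k'
          using mk False by (auto simp: less_Suc_eq prod_encode_eq)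
        then show ?thesis using False by (auto simp: piece_def)
      qed
      then show "f ` piece (y(t := j)) (Suc t) n
          = ((\<lambda>n. f ` piece y t n)(m := f ` (piece y t m \<inter> {z. z k = j}))) n"
        by simp
    qed
    have "sep (\<lambda>n. f ` piece y t n)"
      by (rule split[of _ m "\<lambda>j. f ` (piece y t m \<inter> {z. z k = j})"]) (use s eq in auto)
    with no show False by blast
  qed
  have "\<exists>Y. \<forall>t. \<not> sep (\<lambda>n. f ` piece (Y t) t n) \<and> (\<exists>j. Y (Suc t) = (Y t)(t := j))"
  proof (rule dependent_nat_choice)
    show "\<exists>y. \<not> sep (\<lambda>n. f ` piece y 0 n)" using nosep by (auto simp: piece_def)
  qed (use step in blast)
  then obtain Y where Y: "\<And>t. \<not> sep (\<lambda>n. f ` piece (Y t) t n)"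
    "\<And>t. \<exists>j. Y (Suc t) = (Y t)(t := j)"
    by blast
  define y where "y i = Y (Suc i) i" for i
  have stable: "Y (Suc i + k) i = y i" for i k
  proof (induction k)
    case (Suc k)
    obtain j where "Y (Suc (Suc i + k)) = (Y (Suc i + k))(Suc i + k := j)" using Y(2) by blast
    then show ?case using Suc by simp
  qed (simp add: y_def)
  have "piece (Y t) t = piece y t" for t
  proof (rule piece_cong)
    fix i assume "i < t"
    then obtain k where "t = Suc i + k" using less_iff_Suc_add by auto
    then show "Y t i = y i" using stable by simp
  qed
  then have ns: "\<not> sep (\<lambda>n. f ` piece y t n)" for t using Y(1)[of t] by simp
  define x where "x n k = y (prod_encode (n, k))" for n k
  have into: "\<exists>T. \<forall>t\<ge>T. piece y t n \<subseteq> K n \<inter> cylinder (x n) m" for n m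
  proof -
    define T where "T = Suc (\<Sum>k<m. prod_encode (n, k))"
    have "prod_encode (n, k) < T" if "k < m" for k
      using member_le_sum[of k "{..<m}" "\<lambda>k. prod_encode (n, k)"] that by (simp add: T_def)
    then have "piece y t n \<subseteq> K n \<inter> cylinder (x n) m" if "t \<ge> T" for t
      using that by (fastforce simp: piece_def cylinder_def x_def)
    then show ?thesis by blast
  qed
  have nonempty: "piece y t n \<noteq> {}" for t n
  proof
    assume "piece y t n = {}"
    then have "sep (\<lambda>n. f ` piece y t n)"
      unfolding sep_def by (intro exI[of _ "\<lambda>k. if k = n then {} else UNIV"]) auto
    with ns show False by blast
  qed
  have xK: "x n \<in> K n" for n
  proof (rule mem_closed_if_cylinders_meet[OF K])
    fix m show "K n \<inter> cylinder (x n) m \<noteq> {}" using into[of n m] nonempty by blast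
  qed
  have "\<exists>n. f (x n) \<noteq> f (x 0)"
  proof (rule ccontr)
    assume "\<not> ?thesis"
    then have "f (x 0) \<in> (\<Inter>n. f ` K n)" using xK by (metis INT_I image_eqI)
    with empty show False by blast
  qed
  then obtain n where n: "f (x n) \<noteq> f (x 0)" by blast
  then obtain U V where UV: "open U" "open V" "f (x n) \<in> U" "f (x 0) \<in> V" "U \<inter> V = {}"
    using baire_hausdorff by metis
  obtain a b where ab: "f ` cylinder (x n) a \<subseteq> U" "f ` cylinder (x 0) b \<subseteq> V"
    using continuous_cylinder_into_open[OF f] UV by metis
  obtain T1 T2 where "\<And>t. t \<ge> T1 \<Longrightarrow> piece y t n \<subseteq> cylinder (x n) a"
    "\<And>t. t \<ge> T2 \<Longrightarrow> piece y t 0 \<subseteq> cylinder (x 0) b"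
    using into[of n a] into[of 0 b] by blast
  then have t: "f ` piece y (max T1 T2) n \<subseteq> U" "f ` piece y (max T1 T2) 0 \<subseteq> V"
    using ab by (meson image_mono max.cobounded1 max.cobounded2 order_trans)+
  have "n \<noteq> 0" using n by metis
  then have "sep (\<lambda>n. f ` piece y (max T1 T2) n)"
    unfolding sep_def
    by (intro exI[of _ "\<lambda>k. if k = n then U else if k = 0 then V else UNIV"])
      (use t UV in \<open>auto split: if_splits\<close>)
  with ns show False by blast
qed

text \<open>
  Let \<open>A u\<close> be the image of the points of \<open>K\<close> that extend the finite sequence \<open>u\<close>. As fibres are finite,
  a point lies in \<open>A (u @ [i])\<close> for finitely many \<open>i\<close> only, and Novikov separation provides Borel
  supersets for which this remains true. A point of the image therefore corresponds to an infinite,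
  finitely branching tree of sequences \<open>u\<close>. Koenig's lemma yields a branch of that tree, and the
  closures in the definition of \<open>B\<close> force the branch to be a point of \<open>K\<close> in the fibre.
\<close>

lemma finite_to_one_continuous_image_borel:
  fixes f :: "(nat \<Rightarrow> nat) \<Rightarrow> (nat \<Rightarrow> nat)"
  assumes f: "continuous_on UNIV f" and K: "closed K"
    and fin: "\<And>y. finite {x \<in> K. f x = y}"
  shows "f ` K \<in> sets borel"
proof -
  define pre where "pre u = {z :: nat \<Rightarrow> nat. \<forall>i<length u. z i = u ! i}" for u
  define A where "A u = f ` (K \<inter> pre u)" for u
  have cpre: "closed (pre u)" for u
  proof -
    have "pre u = (\<Inter>i\<in>{..<length u}. {z. z i = u ! i})" by (auto simp: pre_def)
    then show ?thesis by (auto intro!: closed_INT closed_coordinate[of "\<lambda>n. n = _"])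
  qed
  have "\<exists>C. (\<forall>i. C i \<in> sets borel \<and> f ` (K \<inter> pre u \<inter> {z. z (length u) \<ge> i}) \<subseteq> C i)
      \<and> (\<Inter>i :: nat. C i) = {}" for u
  proof (rule novikov_separation[OF f])
    show "closed (K \<inter> pre u \<inter> {z. z (length u) \<ge> i})" for i
      using K cpre closed_coordinate[of "\<lambda>n. n \<ge> i"] by auto
    show "(\<Inter>i. f ` (K \<inter> pre u \<inter> {z. i \<le> z (length u)})) = {}"
    proof (rule ccontr)
      assume "\<not> ?thesis"
      then obtain y where y: "\<And>i. y \<in> f ` (K \<inter> pre u \<inter> {z. i \<le> z (length u)})" by blast
      define I where "I = (\<lambda>z. z (length u)) ` {x \<in> K. f x = y}"
      have "finite I" using fin by (simp add: I_def)
      then obtain n where n: "\<forall>i\<in>I. i < n" unfolding finite_nat_set_iff_bounded by blast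
      from y[of n] obtain z where "z \<in> K" "f z = y" "n \<le> z (length u)" by auto
      then have "z (length u) \<in> I" "\<not> z (length u) < n" by (auto simp: I_def)
      then show False using n by blast
    qed
  qed
  then obtain C where C: "\<And>u i. C u i \<in> sets borel"
      "\<And>u i. f ` (K \<inter> pre u \<inter> {z. z (length u) \<ge> i}) \<subseteq> C u i"
      "\<And>u. (\<Inter>i :: nat. C u i) = {}"
    by metis
  \<comment> \<open>\<open>C u i\<close> covers the images of the successors from \<open>i\<close> on; the intersection makes the sets decreasing.\<close>
  define C' where "C' u i = (\<Inter>j\<in>{..i}. C u j)" for u i
  have C'b: "C' u i \<in> sets borel" for u i using C(1) by (auto simp: C'_def)
  have C'sub: "f ` (K \<inter> pre u \<inter> {z. z (length u) = i}) \<subseteq> C' u i" for u i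
    using C(2)[of u] by (fastforce simp: C'_def)
  have C'fin: "finite {i. y \<in> C' u i}" for u y
  proof -
    obtain j where j: "y \<notin> C u j" using C(3)[of u] by blast
    have "{i. y \<in> C' u i} \<subseteq> {..<j}" using j by (auto simp: C'_def not_le[symmetric])
    then show ?thesis using finite_subset by blast
  qed
  define B where "B u = {y. \<forall>k<length u. y \<in> C' (take k u) (u ! k) \<and> y \<in> closure (A (take (Suc k) u))}" for u
  have Bb: "B u \<in> sets borel" for u
  proof -
    have "B u = (\<Inter>k\<in>{..<length u}. C' (take k u) (u ! k) \<inter> closure (A (take (Suc k) u)))"
      by (auto simp: B_def)
    also have "\<dots> \<in> sets borel"
      using C'b by (intro sets.countable_INT'') auto
    finally show ?thesis .
  qed
  have "f ` K = (\<Inter>n. \<Union>u\<in>{u. length u = n}. B u)" (is "_ = ?R")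
  proof
    show "f ` K \<subseteq> ?R"
    proof safe
      fix x n assume x: "x \<in> K"
      let ?u = "map x [0..<n]"
      have "f x \<in> C' (take k ?u) (?u ! k) \<and> f x \<in> closure (A (take (Suc k) ?u))" if k: "k < n" for k
      proof
        have tk: "take k ?u = map x [0..<k]" "take (Suc k) ?u = map x [0..<Suc k]" "?u ! k = x k"
          using k by (simp_all add: take_map take_upt)
        show "f x \<in> C' (take k ?u) (?u ! k)" unfolding tk
          by (rule subsetD[OF C'sub]) (use x in \<open>auto simp: pre_def\<close>)
        have "f x \<in> A (take (Suc k) ?u)" unfolding tk A_def
          using x by (auto simp: pre_def simp del: upt_Suc)
        then show "f x \<in> closure (A (take (Suc k) ?u))" using closure_subset by blast
      qed
      then have "f x \<in> B ?u" by (simp add: B_def)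
      then show "f x \<in> (\<Union>u\<in>{u. length u = n}. B u)" by force
    qed
  next
    show "?R \<subseteq> f ` K"
    proof
      fix y assume "y \<in> ?R"
      then have lvl: "\<exists>u. length u = n \<and> y \<in> B u" for n by blast
      have Btake: "y \<in> B (take n u)" if "y \<in> B u" for u n
        using that by (auto simp: B_def min_def)
      \<comment> \<open>Koenig's lemma: follow the sequences that have extensions of every length.\<close>
      define big where "big u \<longleftrightarrow> (\<forall>n. \<exists>v. length v = n \<and> y \<in> B (u @ v))" for u
      have grow: "\<exists>i. big (u @ [i])" if "big u" for u
      proof (rule ccontr)
        assume "\<not> ?thesis"
        then have "\<forall>i. \<exists>n. \<forall>v. length v = n \<longrightarrow> y \<notin> B ((u @ [i]) @ v)" unfolding big_def by blast
        then obtain n where n: "\<And>i v. length v = n i \<Longrightarrow> y \<notin> B ((u @ [i]) @ v)" by metis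
        define I where "I = {i. y \<in> C' u i}"
        have "finite I" using C'fin by (simp add: I_def)
        obtain v where v: "length v = Suc (\<Sum>i\<in>I. n i)" "y \<in> B (u @ v)" using \<open>big u\<close> unfolding big_def by blast
        then obtain i w where w: "v = i # w" by (cases v) auto
        have "length u < length (u @ v)" using v(1) by simp
        then have "y \<in> C' (take (length u) (u @ v)) ((u @ v) ! length u)" using v(2) unfolding B_def by blast
        then have "i \<in> I" using w by (simp add: I_def)
        then have "n i \<le> length w" using v(1) w member_le_sum[of i I n] \<open>finite I\<close> by simp
        then have "take (length u + Suc (n i)) (u @ v) = (u @ [i]) @ take (n i) w" using w by simp
        then have "y \<in> B ((u @ [i]) @ take (n i) w)" using Btake[OF v(2), of "length u + Suc (n i)"] by simp
        then show False using n[of "take (n i) w" i] \<open>n i \<le> length w\<close> by simp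
      qed
      have "\<exists>U. \<forall>n. (big (U n) \<and> length (U n) = n) \<and> (\<exists>i. U (Suc n) = U n @ [i])"
      proof (rule dependent_nat_choice)
        have "big []" unfolding big_def using lvl by simp
        then show "\<exists>u. big u \<and> length u = 0" by auto
        fix u n assume u: "big u \<and> length u = n"
        then obtain i where "big (u @ [i])" using grow by blast
        then show "\<exists>v. (big v \<and> length v = Suc n) \<and> (\<exists>i. v = u @ [i])"
          using u by (intro exI[of _ "u @ [i]"]) simp
      qed
      then obtain U where U: "\<And>n. big (U n)" "\<And>n. length (U n) = n" "\<And>n. \<exists>i. U (Suc n) = U n @ [i]"
        by blast
      define x where "x n = U (Suc n) ! n" for n
      have Ux: "U n = map x [0..<n]" for n
      proof (induction n)
        case 0 then show ?case using U(2)[of 0] by simp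
      next
        case (Suc n)
        obtain i where "U (Suc n) = U n @ [i]" using U(3) by blast
        then show ?case using Suc U(2)[of n] by (simp add: x_def nth_append)
      qed
      have prex: "pre (U n) = cylinder x n" for n
        by (auto simp: pre_def cylinder_def Ux)
      have cl: "y \<in> closure (A (U n))" if "n > 0" for n
      proof -
        have "y \<in> B (U n)" using U(1)[of n] unfolding big_def by (metis append.right_neutral length_0_conv)
        then show ?thesis using that U(2)[of n] unfolding B_def
          by (auto dest!: spec[of _ "n - 1"])
      qed
      have "x \<in> K"
      proof (rule mem_closed_if_cylinders_meet[OF K])
        fix n
        have "A (U (Suc n)) \<noteq> {}" using cl[of "Suc n"] by auto
        then show "K \<inter> cylinder x n \<noteq> {}" unfolding A_def prex by (auto simp: cylinder_def)
      qed
      moreover have "f x = y"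
      proof (rule ccontr)
        assume "f x \<noteq> y"
        then obtain V W where VW: "open V" "open W" "f x \<in> V" "y \<in> W" "V \<inter> W = {}" using baire_hausdorff by metis
        obtain n where n: "f ` cylinder x n \<subseteq> V" using continuous_cylinder_into_open[OF f] VW by metis
        have "A (U (Suc n)) \<subseteq> V" using n unfolding A_def prex by (auto simp: cylinder_def)
        then have "A (U (Suc n)) \<inter> W = {}" using VW by blast
        then have "W \<inter> closure (A (U (Suc n))) = {}"
          unfolding open_Int_closure_eq_empty[OF VW(2)] by blast
        then show False using cl[of "Suc n"] VW(4) by blast
      qed
      ultimately show "y \<in> f ` K" by blast
    qed
  qed
  then show ?thesis using Bb by (auto intro!: sets.countable_INT'' sets.countable_UN')
qed

section \<open>Finite-to-one images in standard Borel spaces\<close>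

text \<open>
  Every Borel set is a projection of a closed set. Uniqueness of the lifts matters because a
  finite-to-one map on the Borel set has to stay finite-to-one on the closed set.
\<close>

definition lifts_uniquely :: "((nat \<Rightarrow> nat) \<times> 'y::topological_space) set \<Rightarrow> 'y set \<Rightarrow> bool" where
  "lifts_uniquely K S \<longleftrightarrow>
     closed K \<and> (\<forall>y\<in>S. \<exists>!x. (x, y) \<in> K) \<and> (\<forall>x y. (x, y) \<in> K \<longrightarrow> y \<in> S)"

definition unique_projection :: "'y::topological_space set \<Rightarrow> bool" where
  "unique_projection S \<longleftrightarrow> (\<exists>K. lifts_uniquely K S)"

lemma lifts_uniquelyD:
  assumes "lifts_uniquely K S"
  shows "closed K" and "y \<in> S \<Longrightarrow> \<exists>!x. (x, y) \<in> K" and "(x, y) \<in> K \<Longrightarrow> y \<in> S"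
  using assms by (auto simp: lifts_uniquely_def)

lemma unique_projectionI:
  assumes "closed (K :: ((nat \<Rightarrow> nat) \<times> 'y::topological_space) set)" and "\<And>y. y \<in> S \<Longrightarrow> \<exists>!x. (x, y) \<in> K" and "\<And>x y. (x, y) \<in> K \<Longrightarrow> y \<in> S"
  shows "unique_projection S"
proof -
  have "lifts_uniquely K S" unfolding lifts_uniquely_def using assms by metis
  then show ?thesis unfolding unique_projection_def by blast
qed

lemma continuous_on_reindex: "continuous_on UNIV (\<lambda>w :: (nat \<Rightarrow> nat) \<times> 'y::topological_space. (\<lambda>m. fst w (r m), snd w))"
  by (intro continuous_intros continuous_on_coordinatewise_then_product
      continuous_on_compose2[OF continuous_on_product_coordinates continuous_on_fst]) auto

lemma unique_projection_closed:
  assumes "closed S" shows "unique_projection S"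
proof (rule unique_projectionI)
  have "{\<lambda>_. 0} = (\<Inter>i. {z :: nat \<Rightarrow> nat. z i = 0})" by auto
  also have "closed \<dots>" by (intro closed_INT ballI closed_coordinate)
  finally show "closed ({\<lambda>_ :: nat. 0 :: nat} \<times> S)" using assms by (rule closed_Times)
qed auto

text \<open>
  One sequence stores the lifts for all the sets as its rows.
\<close>

lemma unique_projection_INT:
  assumes "\<And>n :: nat. unique_projection (S n)"
  shows "unique_projection (\<Inter>n. S n)"
proof -
  have "\<exists>K. \<forall>n. lifts_uniquely (K n) (S n)"
    using assms unfolding unique_projection_def by (intro choice) blast
  then obtain K where "\<And>n. lifts_uniquely (K n) (S n)" by blast
  note K = lifts_uniquelyD[OF this]
  define row where "row n w = (\<lambda>m. fst w (prod_encode (n, m)), snd w)" for n and w :: "(nat \<Rightarrow> nat) \<times> 'a"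
  let ?K = "\<Inter>n. row n -` K n"
  have "continuous_on UNIV (row n)" for n
    unfolding row_def by (rule continuous_on_reindex)
  then have cl: "closed ?K" using K(1) by (auto intro!: closed_INT closed_vimage)
  have ex: "\<exists>!x. (x, y) \<in> ?K" if y: "y \<in> (\<Inter>n. S n)" for y
  proof -
    obtain X where X: "\<And>n. (X n, y) \<in> K n" using K(2) y by (metis INT_E UNIV_I)
    show ?thesis
    proof
      let ?x = "\<lambda>m. case prod_decode m of (n, k) \<Rightarrow> X n k"
      show "(?x, y) \<in> ?K" using X by (auto simp: row_def)
      fix x assume x: "(x, y) \<in> ?K"
      have "(\<lambda>m. x (prod_encode (n, m))) = X n" for n
        using x X[of n] K(2)[of y n] y by (auto simp: row_def)
      then have "x (prod_encode (n, m)) = X n m" for n m by metis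
      then have "x m = ?x m" for m by (metis (no_types, lifting) case_prod_beta prod.collapse prod_decode_inverse)
      then show "x = ?x" by blast
    qed
  qed
  have "y \<in> (\<Inter>n. S n)" if "(x, y) \<in> ?K" for x y
    using that K(3) by (auto simp: row_def)
  with cl ex show ?thesis by (rule unique_projectionI)
qed

text \<open>
  The first entry of a lift names the member of the family; disjointness makes it unique.
\<close>

lemma unique_projection_disjoint_UN:
  assumes "\<And>n :: nat. unique_projection (S n)" and "disjoint_family S"
  shows "unique_projection (\<Union>n. S n)"
proof -
  have "\<exists>K. \<forall>n. lifts_uniquely (K n) (S n)"
    using assms(1) unfolding unique_projection_def by (intro choice) blast
  then obtain K where "\<And>n. lifts_uniquely (K n) (S n)" by blast
  note K = lifts_uniquelyD[OF this]
  define tail where "tail w = (\<lambda>m. fst w (Suc m), snd w)" for w :: "(nat \<Rightarrow> nat) \<times> 'a"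
  let ?K = "\<Inter>n. {w. fst w 0 \<noteq> n} \<union> tail -` K n"
  have "continuous_on UNIV tail"
    unfolding tail_def by (rule continuous_on_reindex)
  moreover have "closed {w :: (nat \<Rightarrow> nat) \<times> 'a. fst w 0 \<noteq> n}" for n
  proof -
    have "{w :: (nat \<Rightarrow> nat) \<times> 'a. fst w 0 \<noteq> n} = {z. z 0 \<noteq> n} \<times> UNIV" by auto
    then show ?thesis using closed_coordinate[of "\<lambda>k. k \<noteq> n" 0] by (auto intro: closed_Times)
  qed
  ultimately have cl: "closed ?K" using K(1) by (auto intro!: closed_INT closed_Un closed_vimage)
  have K': "(x, y) \<in> ?K \<longleftrightarrow> ((\<lambda>m. x (Suc m)), y) \<in> K (x 0)" for x y
    by (auto simp: tail_def)
  have ex: "\<exists>!x. (x, y) \<in> ?K" if y: "y \<in> (\<Union>n. S n)" for y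
  proof -
    obtain n where n: "y \<in> S n" using y by blast
    obtain z where z: "(z, y) \<in> K n" using K(2)[OF n] by blast
    show ?thesis
    proof
      show "(case_nat n z, y) \<in> ?K" unfolding K' using z by simp
      fix x assume "(x, y) \<in> ?K"
      then have x: "((\<lambda>m. x (Suc m)), y) \<in> K (x 0)" unfolding K' .
      then have "y \<in> S (x 0)" using K(3) by blast
      then have x0: "x 0 = n" using n assms(2) by (auto simp: disjoint_family_on_def)
      then have "(\<lambda>m. x (Suc m)) = z" using x z K(2)[OF n] by auto
      then have "x m = case_nat n z m" for m using x0 by (cases m) auto
      then show "x = case_nat n z" by blast
    qed
  qed
  have "y \<in> (\<Union>n. S n)" if "(x, y) \<in> ?K" for x y
    using that K(3) unfolding K' by blast
  with cl ex show ?thesis by (rule unique_projectionI)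
qed

text \<open>
  Closure under complements is built in, because it cannot be derived for projections directly.
\<close>

definition bi_projection :: "'y::topological_space set \<Rightarrow> bool" where
  "bi_projection S \<longleftrightarrow> unique_projection S \<and> unique_projection (- S)"

lemma sigma_algebra_bi_projection: "sigma_algebra UNIV {S :: 'y::topological_space set. bi_projection S}"
proof -
  have "bi_projection (\<Union>n. S n)" if S: "\<And>n. bi_projection (S n)" for S :: "nat \<Rightarrow> 'y set"
  proof -
    \<comment> \<open>The differences written as countable intersections, to which \<open>unique_projection_INT\<close> applies.\<close>
    let ?D = "\<lambda>n. \<Inter>m. if m < n then - S m else S n"
    have "unique_projection (?D n)" for n
      using S by (intro unique_projection_INT) (auto simp: bi_projection_def)
    moreover have D: "?D n = S n - (\<Union>m<n. S m)" for n by (auto split: if_splits)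
    moreover have "disjoint_family (\<lambda>n. S n - (\<Union>m<n. S m))"
      unfolding disjoint_family_on_def by (auto, metis lessThan_iff linorder_neqE_nat)
    ultimately have "unique_projection (\<Union>n. S n - (\<Union>m<n. S m))"
      by (intro unique_projection_disjoint_UN) auto
    moreover have "(\<Union>n. S n - (\<Union>m<n. S m)) = (\<Union>n. S n)"
    proof -
      have "\<exists>n. y \<in> S n \<and> (\<forall>m<n. y \<notin> S m)" if "y \<in> S k" for y k
        using exists_least_iff[of "\<lambda>n. y \<in> S n"] that by auto
      then show ?thesis by fastforce
    qed
    moreover have "unique_projection (- (\<Union>n. S n))"
      using unique_projection_INT[of "\<lambda>n. - S n"] S by (simp add: bi_projection_def)
    ultimately show ?thesis by (simp add: bi_projection_def)
  qed
  moreover have "bi_projection ({} :: 'y set)"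
    by (simp add: bi_projection_def unique_projection_closed)
  moreover have "bi_projection (- S)" if "bi_projection S" for S :: "'y set"
    using that by (simp add: bi_projection_def)
  ultimately show ?thesis
    unfolding sigma_algebra_iff2 by (auto simp: Compl_eq_Diff_UNIV[symmetric] image_subset_iff)
qed

lemma unique_projection_graph:
  fixes F :: "(nat \<Rightarrow> nat) \<Rightarrow> (nat \<Rightarrow> nat)"
  assumes P: "P \<in> sets borel" and F: "F \<in> borel_measurable borel"
  shows "unique_projection {w. fst w \<in> P \<and> F (fst w) = snd w}"
proof -
  define M where "M = sigma (UNIV :: ((nat \<Rightarrow> nat) \<times> (nat \<Rightarrow> nat)) set) {S. bi_projection S}"
  have sM: "S \<in> sets M \<longleftrightarrow> bi_projection S" for S
    unfolding M_def sigma_algebra.sets_measure_of_eq[OF sigma_algebra_bi_projection] by simp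
  have [simp]: "space M = UNIV" by (simp add: M_def)
  have coord: "c \<in> borel_measurable M" if c: "\<And>i A. closed {w. c w i \<in> A}"
    for c :: "(nat \<Rightarrow> nat) \<times> (nat \<Rightarrow> nat) \<Rightarrow> (nat \<Rightarrow> nat)"
  proof (rule measurable_into_baire_space)
    fix i
    have "{w. c w i \<in> A} \<in> sets M" for A
    proof -
      have "- {w. c w i \<in> A} = {w. c w i \<in> - A}" by auto
      then show ?thesis unfolding sM bi_projection_def using c[of i A] c[of i "- A"] by (metis unique_projection_closed)
    qed
    then show "(\<lambda>w. c w i) \<in> measurable M (count_space UNIV)"
      by (auto simp: measurable_def vimage_def)
  qed
  define p q where "p = (fst :: (nat \<Rightarrow> nat) \<times> (nat \<Rightarrow> nat) \<Rightarrow> _)"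
    and "q = (snd :: (nat \<Rightarrow> nat) \<times> (nat \<Rightarrow> nat) \<Rightarrow> _)"
  have [measurable]: "p \<in> borel_measurable M" "q \<in> borel_measurable M"
  proof -
    have "{w. p w i \<in> A} = {z. z i \<in> A} \<times> UNIV" "{w. q w i \<in> A} = UNIV \<times> {z. z i \<in> A}" for i A
      by (auto simp: p_def q_def)
    then show "p \<in> borel_measurable M" "q \<in> borel_measurable M"
      using closed_coordinate[of "\<lambda>k. k \<in> _"] by (auto intro!: coord closed_Times)
  qed
  note [measurable] = P F
  have "(\<lambda>w. F (p w)) \<in> borel_measurable M" by measurable
  define a b where "a i w = F (p w) i" and "b i w = q w i" for i w
  have [measurable]: "a i \<in> measurable M (count_space UNIV)" "b i \<in> measurable M (count_space UNIV)" for i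
    unfolding a_def b_def
    by (intro measurable_compose[OF _ measurable_coordinate]
        \<open>q \<in> borel_measurable M\<close> \<open>(\<lambda>w. F (p w)) \<in> borel_measurable M\<close>)+
  have "{w \<in> space M. p w \<in> P \<and> (\<forall>i. \<exists>n. a i w = n \<and> b i w = n)} \<in> sets M" by measurable
  moreover have "{w \<in> space M. p w \<in> P \<and> (\<forall>i. \<exists>n. a i w = n \<and> b i w = n)} = {w. fst w \<in> P \<and> F (fst w) = snd w}"
    by (auto simp: fun_eq_iff p_def q_def a_def b_def)
  ultimately show ?thesis using sM by (simp add: bi_projection_def)
qed

text \<open>
  The image is the projection of the graph of \<open>F\<close> over \<open>P\<close>, hence of a closed set of triples
  \<open>(x, p, y)\<close> in which \<open>x\<close> is determined by \<open>p\<close> and \<open>y\<close>. Coding triples as sequences, by residues modulo 3,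
  turns the projection into a continuous finite-to-one map on a closed set.
\<close>

lemma finite_to_one_image_borel:
  fixes F :: "(nat \<Rightarrow> nat) \<Rightarrow> (nat \<Rightarrow> nat)"
  assumes P: "P \<in> sets borel" and F: "F \<in> borel_measurable borel"
    and fin: "\<And>y. finite {x \<in> P. F x = y}"
  shows "F ` P \<in> sets borel"
proof -
  obtain K where "lifts_uniquely K {w. fst w \<in> P \<and> F (fst w) = snd w}"
    using unique_projection_graph[OF P F] unfolding unique_projection_def by blast
  note lift = lifts_uniquelyD[OF this]
  have K: "\<exists>!x. (x, (p, y)) \<in> K" if "p \<in> P" "F p = y" for p y
    by (rule lift(2)) (use that in simp)
  have K': "p \<in> P \<and> F p = y" if "(x, (p, y)) \<in> K" for x p y
    using lift(3)[OF that] by simp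
  define c where "c i z = (\<lambda>n. z (3 * n + i))" for i and z :: "nat \<Rightarrow> nat"
  define e where "e x p y = (\<lambda>m. (if m mod 3 = 0 then x else if m mod 3 = 1 then p else y) (m div 3))"
    for x p y :: "nat \<Rightarrow> nat"
  have ce: "c 0 (e x p y) = x" "c (Suc 0) (e x p y) = p" "c 2 (e x p y) = y" for x p y
  proof -
    have "(3 * n + 2) mod 3 = 2" "(3 * n + 2) div 3 = n" "(3 * n + 1) mod 3 = 1" "(3 * n + 1) div 3 = n"
      for n :: nat by presburger+
    then show "c 0 (e x p y) = x" "c (Suc 0) (e x p y) = p" "c 2 (e x p y) = y"
      by (auto simp: c_def e_def fun_eq_iff)
  qed
  have ec: "z = z'" if eq: "c 0 z = c 0 z'" "c 1 z = c 1 z'" "c 2 z = c 2 z'" for z z'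
  proof
    fix m :: nat
    have "m mod 3 = 0 \<or> m mod 3 = 1 \<or> m mod 3 = 2" by linarith
    moreover have "z (3 * (m div 3) + i) = z' (3 * (m div 3) + i)" if "i \<in> {0, 1, 2}" for i
      using eq that unfolding c_def by (metis insertE singletonD)
    ultimately show "z m = z' m" by (metis insertCI mult_div_mod_eq)
  qed
  let ?d = "\<lambda>z. (c 0 z, (c 1 z, c 2 z))"
  have cc: "continuous_on UNIV (c i)" for i
    unfolding c_def by (intro continuous_on_coordinatewise_then_product) simp
  define L where "L = ?d -` K"
  have "closed L"
    unfolding L_def using lift(1) by (intro closed_vimage continuous_intros cc) auto
  have LD: "c 1 z \<in> P \<and> F (c 1 z) = c 2 z" if "z \<in> L" for z
    using that K' by (auto simp: L_def)
  have "finite {z \<in> L. c 2 z = y}" for y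
  proof (rule finite_imageD)
    show "finite (c 1 ` {z \<in> L. c 2 z = y})"
      by (rule finite_subset[OF _ fin[of y]]) (use LD in auto)
    show "inj_on (c 1) {z \<in> L. c 2 z = y}"
    proof (rule inj_onI)
      fix z z' assume z: "z \<in> {z \<in> L. c 2 z = y}" "z' \<in> {z \<in> L. c 2 z = y}" "c 1 z = c 1 z'"
      then have "\<exists>!x. (x, (c 1 z, y)) \<in> K" using K LD by auto
      moreover have "(c 0 z, (c 1 z, y)) \<in> K" "(c 0 z', (c 1 z, y)) \<in> K"
        using z by (auto simp: L_def)
      ultimately have "c 0 z = c 0 z'" by blast
      then show "z = z'" using ec z by auto
    qed
  qed
  from finite_to_one_continuous_image_borel[OF cc \<open>closed L\<close> this]
  have "c 2 ` L \<in> sets borel" .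
  moreover have "c 2 ` L = F ` P"
  proof
    show "c 2 ` L \<subseteq> F ` P" using LD by (metis image_eqI image_subsetI)
    show "F ` P \<subseteq> c 2 ` L"
    proof
      fix y assume "y \<in> F ` P"
      then obtain p where p: "p \<in> P" "F p = y" by blast
      then obtain x where "(x, (p, y)) \<in> K" using K by blast
      then have "e x p y \<in> L" using ce by (simp add: L_def)
      then show "y \<in> c 2 ` L" using ce(3) by (metis image_eqI)
    qed
  qed
  ultimately show ?thesis by simp
qed

text \<open>
  Fix a dense sequence in a complete metric space. The code \<open>\<eta> e\<close> records for each \<open>k\<close> the first member
  of the sequence at distance less than \<open>2 ^ - k\<close> from \<open>e\<close>, and \<open>\<psi>\<close> takes limits. The range of \<open>\<eta>\<close> is then
  the set of fixed points of \<open>\<eta> \<circ> \<psi>\<close>, so it is Borel without further work.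
\<close>

lemma standard_borel_retract_of_baire_space:
  assumes "standard_borel M" and "space M \<noteq> {}"
  shows "\<exists>\<eta> \<in> borel_measurable M. \<exists>\<psi> \<in> measurable borel M. \<forall>e \<in> space M. \<psi> (\<eta> e :: nat \<Rightarrow> nat) = e"
proof -
  obtain X where X: "polish_topology X" "topspace X = space M"
      "sets M = sigma_sets (topspace X) {U. openin X U}"
    using assms(1) unfolding standard_borel_def by blast
  obtain S d where Sd: "Metric_space S d" "Metric_space.mcomplete S d" "X = Metric_space.mtopology S d"
    using X(1) unfolding polish_topology_def completely_metrizable_space_def by blast
  interpret Metric_space S d by fact
  have S: "space M = S" using X(2) Sd(3) by simp
  have openM: "U \<in> sets M" if "openin mtopology U" for U
    unfolding X(3) using that Sd(3) by auto
  obtain C where C: "countable C" "C \<subseteq> S" "mtopology closure_of C = S"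
    using X(1) Sd(3) unfolding polish_topology_def separable_space_def by auto
  have "C \<noteq> {}" using C(3) assms(2) S by auto
  then obtain x :: "nat \<Rightarrow> _" where x: "range x = C" using C(1) uncountable_def by blast
  have xS: "x n \<in> S" for n using x C(2) by blast
  have dense: "\<exists>n. d (x n) e < r" if "e \<in> S" "r > 0" for e r
    using that C(3) x by (force simp: metric_closure_of commute)
  define r where "r k = (1/2 :: real) ^ k" for k
  have r: "r k > 0" for k by (simp add: r_def)
  have rsmall: "\<exists>k. c * r k < \<epsilon>" if "\<epsilon> > 0" "c > 0" for \<epsilon> c
  proof -
    have "\<epsilon> / c > 0" using that by simp
    from real_arch_pow_inv[OF this, of "1/2"] obtain k where "(1/2 :: real) ^ k < \<epsilon> / c" by auto
    then show ?thesis using that by (auto simp: r_def field_simps intro!: exI[of _ k])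
  qed
  define \<eta> where "\<eta> e = (\<lambda>k. LEAST n. d (x n) e < r k)" for e
  define lim where "lim s e \<longleftrightarrow> e \<in> S \<and> (\<forall>k. d (x (s k)) e \<le> r k)" for s :: "nat \<Rightarrow> nat" and e
  have lim_\<eta>: "lim (\<eta> e) e" if "e \<in> S" for e
  proof -
    have "d (x (\<eta> e k)) e < r k" for k
      unfolding \<eta>_def using dense[OF that r[of k]] by (rule LeastI_ex)
    then show ?thesis using that by (auto simp: lim_def intro: less_imp_le)
  qed
  have lim_unique: "e = e'" if "lim s e" "lim s e'" for s e e'
  proof (rule ccontr)
    assume "e \<noteq> e'"
    then have "d e e' > 0" using that by (auto simp: lim_def)
    then obtain k where k: "2 * r k < d e e'" using rsmall[of "d e e'" 2] by auto
    have "d e e' \<le> d (x (s k)) e + d (x (s k)) e'"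
      using triangle''[of e "x (s k)" e'] that xS by (auto simp: lim_def commute)
    also have "\<dots> \<le> 2 * r k" using that by (auto simp: lim_def intro: add_mono[of _ "r k" _ "r k", simplified])
    finally show False using k by simp
  qed
  define T where "T = {s. \<forall>k l. d (x (s k)) (x (s l)) \<le> r k + r l}"
  have T: "s \<in> T \<longleftrightarrow> (\<exists>e. lim s e)" for s
  proof
    assume "\<exists>e. lim s e"
    then obtain e where e: "lim s e" by blast
    have "d (x (s k)) (x (s l)) \<le> r k + r l" for k l
    proof -
      have "d (x (s k)) (x (s l)) \<le> d (x (s k)) e + d (x (s l)) e"
        using triangle''[of "x (s k)" e "x (s l)"] e xS by (auto simp: lim_def commute)
      also have "\<dots> \<le> r k + r l" using e by (intro add_mono) (auto simp: lim_def)
      finally show ?thesis .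
    qed
    then show "s \<in> T" by (simp add: T_def)
  next
    assume s: "s \<in> T"
    have "MCauchy (\<lambda>k. x (s k))"
      unfolding MCauchy_def
    proof (intro conjI allI impI)
      fix \<epsilon> :: real assume "\<epsilon> > 0"
      then obtain N where N: "2 * r N < \<epsilon>" using rsmall[of \<epsilon> 2] by auto
      have "d (x (s n)) (x (s n')) < \<epsilon>" if "N \<le> n" "N \<le> n'" for n n'
      proof -
        have "r n \<le> r N" "r n' \<le> r N" using that by (auto simp: r_def power_decreasing)
        then show ?thesis using s N unfolding T_def by (smt (verit) mem_Collect_eq)
      qed
      then show "\<exists>N. \<forall>n n'. N \<le> n \<longrightarrow> N \<le> n' \<longrightarrow> d (x (s n)) (x (s n')) < \<epsilon>" by blast
    qed (use xS in auto)
    then obtain e where e: "limitin mtopology (\<lambda>k. x (s k)) e sequentially"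
      using Sd(2) unfolding mcomplete_def by blast
    then have eS: "e \<in> S" using limitin_topspace by force
    have "d (x (s k)) e \<le> r k" for k
    proof (rule field_le_epsilon)
      fix \<epsilon> :: real assume \<epsilon>: "\<epsilon> > 0"
      obtain N where N: "\<And>n. n \<ge> N \<Longrightarrow> d (x (s n)) e < \<epsilon> / 2"
        using e \<epsilon> unfolding limitin_metric eventually_sequentially by (metis half_gt_zero)
      obtain N' where N': "1 * r N' < \<epsilon> / 2" using rsmall[of "\<epsilon> / 2" 1] \<epsilon> by auto
      let ?n = "max N N'"
      have "r ?n \<le> r N'" by (auto simp: r_def power_decreasing)
      moreover have "d (x (s k)) e \<le> d (x (s k)) (x (s ?n)) + d (x (s ?n)) e"
        using triangle[of "x (s k)" "x (s ?n)" e] eS xS by auto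
      moreover have "d (x (s k)) (x (s ?n)) \<le> r k + r ?n" using s unfolding T_def by blast
      ultimately show "d (x (s k)) e \<le> r k + \<epsilon>" using N[of ?n] N' by auto
    qed
    then show "\<exists>e. lim s e" using eS by (auto simp: lim_def)
  qed
  obtain e0 where e0: "e0 \<in> S" using assms(2) S by blast
  define \<psi> where "\<psi> s = (if s \<in> T then THE e. lim s e else e0)" for s
  have \<psi>: "lim s (\<psi> s)" if "s \<in> T" for s
    using that T[of s] lim_unique[of s] unfolding \<psi>_def by (auto intro: theI)
  note [measurable] = measurable_coordinate
  have "{s \<in> space borel. \<forall>k l. d (x (s k)) (x (s l)) \<le> r k + r l} \<in> sets borel"
    by measurable
  then have Tb[measurable]: "T \<in> sets borel" by (simp add: T_def)
  have "\<eta> \<in> borel_measurable M"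
  proof (rule measurable_into_baire_space)
    fix k
    have "(\<lambda>e. LEAST n. d (x n) e < r k) \<in> measurable M (count_space UNIV)"
    proof (rule measurable_Least)
      fix n
      have "{e \<in> space M. d (x n) e < r k} = mball (x n) (r k)" unfolding S using xS by auto
      then have "{e \<in> space M. d (x n) e < r k} \<in> sets M" using openM by auto
      then show "(\<lambda>e. d (x n) e < r k) \<in> measurable M (count_space UNIV)"
        by (simp add: pred_def)
    qed
    then show "(\<lambda>e. \<eta> e k) \<in> measurable M (count_space UNIV)"
      by (simp add: \<eta>_def)
  qed
  moreover have "\<psi> \<in> measurable borel M"
  proof (rule measurable_sigma_sets)
    show "sets M = sigma_sets S {U. openin X U}" using X(3) Sd(3) by simp
    show "{U. openin X U} \<subseteq> Pow S" using Sd(3) openin_subset by fastforce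
    show "\<psi> \<in> space borel \<rightarrow> S" using \<psi> e0 by (auto simp: \<psi>_def lim_def)
  next
    fix U assume "U \<in> {U. openin X U}"
    then have U: "openin mtopology U" using Sd(3) by simp
    define I where "I = {(n, m). mball (x m) (2 * r n) \<subseteq> U}"
    have "\<psi> s \<in> U \<longleftrightarrow> (\<exists>n. (n, s n) \<in> I)" if s: "s \<in> T" for s
    proof
      assume "\<exists>n. (n, s n) \<in> I"
      then obtain n where n: "mball (x (s n)) (2 * r n) \<subseteq> U" by (auto simp: I_def)
      have "\<psi> s \<in> mball (x (s n)) (2 * r n)" using \<psi>[OF s] xS r[of n]
        by (auto simp: lim_def) (smt (verit))
      then show "\<psi> s \<in> U" using n by blast
    next
      assume "\<psi> s \<in> U"
      then obtain \<epsilon> where \<epsilon>: "\<epsilon> > 0" "mball (\<psi> s) \<epsilon> \<subseteq> U" using U unfolding openin_mtopology by blast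
      obtain n where n: "3 * r n < \<epsilon>" using rsmall[of \<epsilon> 3] \<epsilon> by auto
      have "mball (x (s n)) (2 * r n) \<subseteq> mball (\<psi> s) \<epsilon>"
      proof
        fix y assume y: "y \<in> mball (x (s n)) (2 * r n)"
        have "d (\<psi> s) y \<le> d (x (s n)) (\<psi> s) + d (x (s n)) y"
          using triangle''[of "\<psi> s" "x (s n)" y] y \<psi>[OF s] xS by (auto simp: lim_def commute)
        also have "\<dots> < r n + 2 * r n" using y \<psi>[OF s] by (intro add_le_less_mono) (auto simp: lim_def)
        finally show "y \<in> mball (\<psi> s) \<epsilon>" using n y \<psi>[OF s] by (auto simp: lim_def)
      qed
      then show "\<exists>n. (n, s n) \<in> I" using \<epsilon> by (auto simp: I_def)
    qed
    then have "\<psi> -` U \<inter> space borel = {s \<in> space borel. if s \<in> T then \<exists>n. (n, s n) \<in> I else e0 \<in> U}"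
      by (auto simp: \<psi>_def)
    also have "\<dots> \<in> sets borel" by measurable
    finally show "\<psi> -` U \<inter> space borel \<in> sets borel" .
  qed
  moreover have "\<psi> (\<eta> e) = e" if "e \<in> space M" for e
    using lim_\<eta>[of e] that S T \<psi> lim_unique by metis
  ultimately show ?thesis by blast
qed

text \<open>
  A weak form of the Lusin-Novikov theorem. The codes \<open>\<eta>\<close> and \<open>\<theta>\<close> transport the map to the Baire space,
  where the codes of the points of \<open>U\<close> form a Borel set.
\<close>

proposition finite_to_one_image_measurable:
  assumes "standard_borel M" and "standard_borel N" and f: "f \<in> measurable M N"
    and fin: "\<And>y. finite {x \<in> space M. f x = y}" and U: "U \<in> sets M"
  shows "f ` U \<in> sets N"
proof (cases "space M = {}")
  case True
  then show ?thesis using U sets.sets_into_space by fastforce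
next
  case False
  then have False': "space N \<noteq> {}" using measurable_space[OF f] by blast
  obtain \<eta> \<psi> where M: "\<eta> \<in> borel_measurable M" "\<psi> \<in> measurable borel M"
      "\<And>e. e \<in> space M \<Longrightarrow> \<psi> (\<eta> e :: nat \<Rightarrow> nat) = e"
    using standard_borel_retract_of_baire_space[OF assms(1) False] by blast
  obtain \<theta> \<zeta> where N: "\<theta> \<in> borel_measurable N" "\<zeta> \<in> measurable borel N"
      "\<And>e. e \<in> space N \<Longrightarrow> \<zeta> (\<theta> e :: nat \<Rightarrow> nat) = e"
    using standard_borel_retract_of_baire_space[OF assms(2) False'] by blast
  note [measurable] = M(1,2) N(1,2) f U
  note [measurable] = measurable_coordinate
  let ?P = "{s \<in> space borel. \<psi> s \<in> U \<and> (\<forall>i. \<eta> (\<psi> s) i = s i)}"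
  have UM: "U \<subseteq> space M" using U sets.sets_into_space by blast
  have ms: "(\<lambda>s. \<eta> (\<psi> s) i) \<in> measurable borel (count_space UNIV)" for i by measurable
  note [measurable] = ms
  have Pb: "?P \<in> sets borel" by measurable
  have P: "?P = \<eta> ` U" using M(3) UM by (auto simp: fun_eq_iff[symmetric]) (metis image_eqI)
  let ?F = "\<lambda>s. \<theta> (f (\<psi> s))"
  have Fb: "?F \<in> borel_measurable borel" by measurable
  have fs: "f x \<in> space N" if "x \<in> space M" for x using measurable_space[OF f that] .
  have "?F ` ?P \<in> sets borel"
  proof (rule finite_to_one_image_borel[OF Pb Fb])
    fix y
    have "{x \<in> ?P. ?F x = y} \<subseteq> \<eta> ` {x \<in> space M. f x = \<zeta> y}"
      unfolding P using M(3) N(3) fs UM by force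
    then show "finite {x \<in> ?P. ?F x = y}" using finite_subset fin by blast
  qed
  moreover have "?F ` ?P = \<theta> ` (f ` U)" unfolding P using M(3) UM by force
  ultimately have "\<theta> ` f ` U \<in> sets borel" by simp
  then have "\<theta> -` (\<theta> ` f ` U) \<inter> space N \<in> sets N" by measurable
  moreover have "\<theta> -` (\<theta> ` f ` U) \<inter> space N = f ` U"
    using N(3) fs UM by auto (metis (no_types, lifting) image_eqI subsetD)
  ultimately show ?thesis by simp
qed

section \<open>Borel matchings in graphs with finite components\<close>

text \<open>
  The induction of Halmos and Vaughan: if some proper nonempty \<open>J\<close> has no surplus, match \<open>J\<close> first and
  then the rest outside the neighbours of \<open>J\<close>, where Hall's condition is inherited; if every such \<open>J\<close>
  has surplus, any first choice leaves the condition intact.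
\<close>

lemma hall_finite:
  assumes "finite I" and "\<And>i. i \<in> I \<Longrightarrow> finite (N i)"
    and "\<And>J. J \<subseteq> I \<Longrightarrow> card J \<le> card (\<Union>(N ` J))"
  shows "\<exists>f. inj_on f I \<and> (\<forall>i\<in>I. f i \<in> N i)"
  using assms
proof (induction "card I" arbitrary: I N rule: less_induct)
  case less
  note fin = less.prems(1,2) and hall = less.prems(3)
  have finU: "finite (\<Union>(N ` J))" if "J \<subseteq> I" for J
    using that fin finite_subset[OF that fin(1)] by auto
  show ?case
  proof (cases "\<exists>J. J \<subseteq> I \<and> J \<noteq> {} \<and> J \<noteq> I \<and> card (\<Union>(N ` J)) = card J")
    case True
    then obtain J where J: "J \<subseteq> I" "J \<noteq> {}" "J \<noteq> I" "card (\<Union>(N ` J)) = card J" by blast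
    let ?U = "\<Union>(N ` J)"
    have fJ: "finite J" using J(1) fin(1) finite_subset by blast
    have fU: "finite ?U" using finU[OF J(1)] .
    have "card J < card I" using J fin(1) by (simp add: psubset_card_mono psubset_eq)
    then have "\<exists>f. inj_on f J \<and> (\<forall>i\<in>J. f i \<in> N i)"
      by (rule less.hyps) (use J(1) fJ fin(2) hall in auto)
    then obtain f where f: "inj_on f J" "\<forall>i\<in>J. f i \<in> N i" by blast
    have "card (I - J) < card I"
      using J(1,2) fin(1) by (intro psubset_card_mono) auto
    then have "\<exists>g. inj_on g (I - J) \<and> (\<forall>i\<in>I - J. g i \<in> N i - ?U)"
    proof (rule less.hyps)
      fix H assume H: "H \<subseteq> I - J"
      have fH: "finite H" using H fin(1) finite_subset by blast
      have "card H + card J = card (H \<union> J)" using H fH fJ by (subst card_Un_disjoint) auto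
      also have "\<dots> \<le> card (\<Union>(N ` (H \<union> J)))" using H J(1) by (intro hall) auto
      also have "\<Union>(N ` (H \<union> J)) = \<Union>((\<lambda>i. N i - ?U) ` H) \<union> ?U" by auto
      also have "card \<dots> \<le> card (\<Union>((\<lambda>i. N i - ?U) ` H)) + card ?U" by (rule card_Un_le)
      finally show "card H \<le> card (\<Union>((\<lambda>i. N i - ?U) ` H))" using J(4) by simp
    qed (use fin in auto)
    then obtain g where g: "inj_on g (I - J)" "\<forall>i\<in>I - J. g i \<in> N i - ?U" by blast
    let ?h = "\<lambda>i. if i \<in> J then f i else g i"
    have "inj_on ?h I"
    proof (rule inj_onI)
      fix i j assume ij: "i \<in> I" "j \<in> I" "?h i = ?h j"
      consider "i \<in> J" "j \<in> J" | "i \<notin> J" "j \<notin> J" | "i \<in> J" "j \<notin> J" | "i \<notin> J" "j \<in> J" by blast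
      then show "i = j"
      proof cases
        case 1 then show ?thesis using ij f(1) by (auto dest: inj_onD)
      next
        case 2 then show ?thesis using ij g(1) by (auto dest: inj_onD)
      next
        case 3
        then have "f i \<in> ?U" "g j \<notin> ?U" using f(2) g(2) ij by blast+
        moreover have "f i = g j" using ij 3 by simp
        ultimately show ?thesis by simp
      next
        case 4
        then have "f j \<in> ?U" "g i \<notin> ?U" using f(2) g(2) ij by blast+
        moreover have "g i = f j" using ij 4 by simp
        ultimately show ?thesis by simp
      qed
    qed
    then show ?thesis using f(2) g(2) by (intro exI[of _ ?h]) auto
  next
    case False
    show ?thesis
    proof (cases "I = {}")
      case False': False
      then obtain i where i: "i \<in> I" by blast
      have "card {i} \<le> card (\<Union>(N ` {i}))" using i by (intro hall) auto
      then have "N i \<noteq> {}" by auto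
      then obtain b where b: "b \<in> N i" by blast
      have "card (I - {i}) < card I" using i fin(1) by (intro psubset_card_mono) auto
      then have "\<exists>g. inj_on g (I - {i}) \<and> (\<forall>j\<in>I - {i}. g j \<in> N j - {b})"
      proof (rule less.hyps)
        fix H assume H: "H \<subseteq> I - {i}"
        show "card H \<le> card (\<Union>((\<lambda>j. N j - {b}) ` H))"
        proof (cases "H = {}")
          case False'': False
          have "card H < card (\<Union>(N ` H))"
            using False H False'' i hall[of H] by (metis Diff_insert_absorb Diff_subset le_neq_implies_less mk_disjoint_insert subset_insert_iff subset_trans insert_subset)
          moreover have "\<Union>((\<lambda>j. N j - {b}) ` H) = \<Union>(N ` H) - {b}" by auto
          moreover have "finite (\<Union>(N ` H))" using H by (intro finU) auto
          ultimately show ?thesis by (auto simp: card_Diff_singleton_if)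
        qed simp
      qed (use fin in auto)
      then obtain g where g: "inj_on g (I - {i})" "\<forall>j\<in>I - {i}. g j \<in> N j - {b}" by blast
      have "inj_on (g(i := b)) I"
      proof (rule inj_onI)
        fix j k assume "j \<in> I" "k \<in> I" "(g(i := b)) j = (g(i := b)) k"
        then show "j = k" using g by (auto simp: inj_on_def split: if_splits)
      qed
      then show ?thesis using g(2) b by (intro exI[of _ "g(i := b)"]) auto
    qed simp
  qed
qed

text \<open>
  Vertices are seen through the edges only: a set of vertices counts as Borel if the set of edges
  attached to it is. Closure of this notion under images is all that is ever required of an endpoint
  map, and it makes sense for the composition of an endpoint map with a contraction of the vertices,
  whose codomain carries no sigma-algebra.
\<close>

definition borel_saturations :: "'e measure \<Rightarrow> ('e \<Rightarrow> 'a) \<Rightarrow> bool" where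
  "borel_saturations M f \<longleftrightarrow> (\<forall>y. finite {e \<in> space M. f e = y}) \<and>
     (\<forall>U\<in>sets M. {e \<in> space M. f e \<in> f ` U} \<in> sets M)"

lemma borel_saturationsD:
  assumes "borel_saturations M f"
  shows "finite {e \<in> space M. f e = y}" and "U \<in> sets M \<Longrightarrow> {e \<in> space M. f e \<in> f ` U} \<in> sets M"
  using assms by (auto simp: borel_saturations_def)

definition edge_adjacency :: "('e \<Rightarrow> 'a) \<Rightarrow> ('e \<Rightarrow> 'b) \<Rightarrow> 'e set \<Rightarrow> ('e \<times> 'e) set" where
  "edge_adjacency \<alpha> \<beta> F = {(e, e'). e \<in> F \<and> e' \<in> F \<and> (\<alpha> e = \<alpha> e' \<or> \<beta> e = \<beta> e')}"

lemma sym_edge_adjacency: "sym (edge_adjacency \<alpha> \<beta> F)"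
  by (auto simp: sym_def edge_adjacency_def)

text \<open>
  The sets \<open>L n\<close> replace measurable selection. Any choice made on a finite set of edges is the trace of
  some \<open>L n\<close>, so a solvable problem on a finite component has one of countably many Borel candidates
  as a solution, and the first one that works can be taken.
\<close>

locale finite_cuts =
  fixes M :: "'e measure" and L :: "nat \<Rightarrow> 'e set"
  assumes cut_sets: "L n \<in> sets M"
    and cut_finite: "\<lbrakk>finite C; C \<subseteq> space M; D \<subseteq> C\<rbrakk> \<Longrightarrow> \<exists>n. L n \<inter> C = D"
begin

text \<open>
  Two edges are different iff some \<open>L m\<close> contains the first but not the second.
\<close>

lemma repeated_value_sets:
  assumes f: "borel_saturations M f" and W: "W \<in> sets M"
  shows "{e \<in> W. \<exists>e'\<in>W. e' \<noteq> e \<and> f e' = f e} \<in> sets M"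
proof -
  have WM: "W \<subseteq> space M" using W sets.sets_into_space by blast
  have "{e \<in> W. \<exists>e'\<in>W. e' \<noteq> e \<and> f e' = f e} = (\<Union>m. (W \<inter> L m) \<inter> {e \<in> space M. f e \<in> f ` (W - L m)})"
  proof (intro equalityI subsetI)
    fix e assume "e \<in> {e \<in> W. \<exists>e'\<in>W. e' \<noteq> e \<and> f e' = f e}"
    then obtain e' where e: "e \<in> W" "e' \<in> W" "e' \<noteq> e" "f e' = f e" by blast
    obtain m where "L m \<inter> {e, e'} = {e}" using cut_finite[of "{e, e'}" "{e}"] e WM by auto
    then show "e \<in> (\<Union>m. (W \<inter> L m) \<inter> {e \<in> space M. f e \<in> f ` (W - L m)})"
      using e WM by (auto intro!: exI[of _ m] rev_image_eqI[of e'])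
  next
    fix e assume "e \<in> (\<Union>m. (W \<inter> L m) \<inter> {e \<in> space M. f e \<in> f ` (W - L m)})"
    then show "e \<in> {e \<in> W. \<exists>e'\<in>W. e' \<noteq> e \<and> f e' = f e}" by fastforce
  qed
  also have "\<dots> \<in> sets M"
    by (intro sets.countable_UN'' countableI_type sets.Int sets.Diff W cut_sets borel_saturationsD(2)[OF f])
  finally show ?thesis .
qed

text \<open>
  There are \<open>m + 1\<close> values of \<open>\<beta>\<close> on a fibre of \<open>\<alpha>\<close> iff the \<open>\<beta>\<close>-saturation of some \<open>L n\<close> meets the fibre
  and leaves at least \<open>m\<close> values outside it.
\<close>

lemma at_least_sets:
  assumes \<alpha>: "borel_saturations M \<alpha>" and \<beta>: "borel_saturations M \<beta>" and B: "B \<in> sets M"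
  shows "{e \<in> space M. m \<le> card (\<beta> ` {e'\<in>B. \<alpha> e' = \<alpha> e})} \<in> sets M"
  using B
proof (induction m arbitrary: B)
  case (Suc m)
  define V where "V n = {e \<in> space M. \<beta> e \<in> \<beta> ` L n}" for n
  have V: "V n \<in> sets M" for n
    unfolding V_def by (rule borel_saturationsD(2)[OF \<beta> cut_sets])
  have BM: "B \<subseteq> space M" using Suc.prems sets.sets_into_space by blast
  have fin: "finite {e' \<in> B. \<alpha> e' = a}" for a
    by (rule finite_subset[OF _ borel_saturationsD(1)[OF \<alpha>, of a]]) (use BM in auto)
  have "Suc m \<le> card (\<beta> ` {e'\<in>B. \<alpha> e' = a}) \<longleftrightarrow>
      (\<exists>n. a \<in> \<alpha> ` (B \<inter> V n) \<and> m \<le> card (\<beta> ` {e'\<in>B - V n. \<alpha> e' = a}))" for a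
  proof
    assume m: "Suc m \<le> card (\<beta> ` {e'\<in>B. \<alpha> e' = a})"
    then obtain e where e: "e \<in> B" "\<alpha> e = a" by (metis (mono_tags, lifting) card.empty empty_Collect_eq image_is_empty not_less_eq_eq zero_le)
    let ?C = "{e'\<in>space M. \<beta> e' \<in> \<beta> ` {e'\<in>B. \<alpha> e' = a}}"
    have "?C = (\<Union>b \<in> \<beta> ` {e'\<in>B. \<alpha> e' = a}. {e'\<in>space M. \<beta> e' = b})" by auto
    then have "finite ?C" using fin borel_saturationsD(1)[OF \<beta>] by auto
    then obtain n where n: "L n \<inter> ?C = {e'\<in>?C. \<beta> e' = \<beta> e}"
      using cut_finite[of ?C "{e'\<in>?C. \<beta> e' = \<beta> e}"] by auto
    have LM: "L n \<subseteq> space M" using cut_sets sets.sets_into_space by blast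
    have Vn: "e' \<in> V n \<longleftrightarrow> \<beta> e' = \<beta> e" if e': "e' \<in> B" "\<alpha> e' = a" for e'
    proof
      assume "e' \<in> V n"
      then obtain e'' where "e'' \<in> L n" "\<beta> e'' = \<beta> e'" by (auto simp: V_def)
      then have "e'' \<in> L n \<inter> ?C" using e' LM by auto
      then show "\<beta> e' = \<beta> e" using n \<open>\<beta> e'' = \<beta> e'\<close> by auto
    next
      assume "\<beta> e' = \<beta> e"
      moreover have "e' \<in> ?C" using e' BM by auto
      ultimately have "e' \<in> L n" using n by blast
      then show "e' \<in> V n" using e' BM by (auto simp: V_def)
    qed
    have "\<beta> ` {e'\<in>B - V n. \<alpha> e' = a} = \<beta> ` {e'\<in>B. \<alpha> e' = a} - {\<beta> e}"
      using Vn by auto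
    then have "m \<le> card (\<beta> ` {e'\<in>B - V n. \<alpha> e' = a})"
      using m fin e by (simp add: card_Diff_singleton_if)
    then show "\<exists>n. a \<in> \<alpha> ` (B \<inter> V n) \<and> m \<le> card (\<beta> ` {e'\<in>B - V n. \<alpha> e' = a})"
      using e Vn by blast
  next
    assume "\<exists>n. a \<in> \<alpha> ` (B \<inter> V n) \<and> m \<le> card (\<beta> ` {e'\<in>B - V n. \<alpha> e' = a})"
    then obtain n e where e: "e \<in> B" "e \<in> V n" "\<alpha> e = a" and m: "m \<le> card (\<beta> ` {e'\<in>B - V n. \<alpha> e' = a})"
      by blast
    have "\<beta> e \<notin> \<beta> ` {e'\<in>B - V n. \<alpha> e' = a}"
    proof
      assume "\<beta> e \<in> \<beta> ` {e'\<in>B - V n. \<alpha> e' = a}"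
      then obtain e' where "e' \<in> B - V n" "\<beta> e = \<beta> e'" by blast
      then show False using e BM by (auto simp: V_def)
    qed
    moreover have fin': "finite {e'\<in>B - V n. \<alpha> e' = a}" by (rule finite_subset[OF _ fin[of a]]) auto
    ultimately have "Suc m \<le> card (insert (\<beta> e) (\<beta> ` {e'\<in>B - V n. \<alpha> e' = a}))" using m by simp
    also have "\<dots> \<le> card (\<beta> ` {e'\<in>B. \<alpha> e' = a})"
      using fin e by (intro card_mono) auto
    finally show "Suc m \<le> card (\<beta> ` {e'\<in>B. \<alpha> e' = a})" .
  qed
  then have "{e \<in> space M. Suc m \<le> card (\<beta> ` {e'\<in>B. \<alpha> e' = \<alpha> e})} =
      (\<Union>n. {e \<in> space M. \<alpha> e \<in> \<alpha> ` (B \<inter> V n)} \<inter> {e \<in> space M. m \<le> card (\<beta> ` {e'\<in>B - V n. \<alpha> e' = \<alpha> e})})"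
    by auto
  also have "\<dots> \<in> sets M"
    by (intro sets.countable_UN'' countableI_type sets.Int sets.Diff borel_saturationsD(2)[OF \<alpha>] Suc.IH Suc.prems V)
  finally show ?case .
qed simp

text \<open>
  By Hall's theorem every component has a matching, and this matching is cut out by some \<open>L n\<close>. The
  edges in components on which \<open>L n\<close> fails form a Borel set \<open>bad n\<close>: failure is detected locally by
  saturations and then spread over the component by countably many of them. Each component uses the
  first \<open>L n\<close> that does not fail.
\<close>

theorem finite_component_matching:
  assumes \<alpha>: "borel_saturations M \<alpha>" and \<beta>: "borel_saturations M \<beta>" and F: "F \<in> sets M"
    and fin: "\<And>e. e \<in> F \<Longrightarrow> finite ((edge_adjacency \<alpha> \<beta> F)\<^sup>* `` {e})"
    and hall: "\<And>S. \<lbrakk>finite S; S \<subseteq> \<alpha> ` F\<rbrakk> \<Longrightarrow> card S \<le> card (\<beta> ` {e \<in> F. \<alpha> e \<in> S})"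
  shows "\<exists>N \<in> sets M. N \<subseteq> F \<and> \<alpha> ` N = \<alpha> ` F \<and> inj_on \<alpha> N \<and> inj_on \<beta> N"
proof -
  define R where "R = edge_adjacency \<alpha> \<beta> F"
  have R: "(e, e') \<in> R \<longleftrightarrow> e \<in> F \<and> e' \<in> F \<and> (\<alpha> e = \<alpha> e' \<or> \<beta> e = \<beta> e')" for e e'
    by (simp add: R_def edge_adjacency_def)
  have symR: "sym (R\<^sup>*)" unfolding R_def by (intro sym_rtrancl sym_edge_adjacency)
  have FM: "F \<subseteq> space M" using F sets.sets_into_space by blast
  have RF: "e' \<in> F" if "(e, e') \<in> R\<^sup>*" "e \<in> F" for e e'
    using that by (induction) (auto simp: R)
  have R1: "R `` T \<in> sets M" if T: "T \<in> sets M" for T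
  proof -
    have "R `` T = F \<inter> ({e \<in> space M. \<alpha> e \<in> \<alpha> ` (T \<inter> F)} \<union> {e \<in> space M. \<beta> e \<in> \<beta> ` (T \<inter> F)})"
    proof (intro equalityI subsetI)
      fix e assume "e \<in> R `` T"
      then obtain e' where "e' \<in> T" "(e', e) \<in> R" by blast
      then have "e' \<in> T \<inter> F" "e \<in> F" "\<alpha> e = \<alpha> e' \<or> \<beta> e = \<beta> e'" by (auto simp: R)
      then show "e \<in> F \<inter> ({e \<in> space M. \<alpha> e \<in> \<alpha> ` (T \<inter> F)} \<union> {e \<in> space M. \<beta> e \<in> \<beta> ` (T \<inter> F)})"
        using FM by blast
    next
      fix e assume "e \<in> F \<inter> ({e \<in> space M. \<alpha> e \<in> \<alpha> ` (T \<inter> F)} \<union> {e \<in> space M. \<beta> e \<in> \<beta> ` (T \<inter> F)})"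
      then obtain e' where "e' \<in> T" "e' \<in> F" "e \<in> F" "\<alpha> e' = \<alpha> e \<or> \<beta> e' = \<beta> e" by fastforce
      then show "e \<in> R `` T" by (auto simp: R)
    qed
    also have "\<dots> \<in> sets M"
      using T F by (intro sets.Int sets.Un borel_saturationsD(2)[OF \<alpha>] borel_saturationsD(2)[OF \<beta>]) auto
    finally show ?thesis .
  qed
  have Rn: "(R ^^ k) `` T \<in> sets M" if "T \<in> sets M" for T k
    using that by (induction k) (auto simp: relcomp_Image R1)
  have Rstar: "R\<^sup>* `` T \<in> sets M" if "T \<in> sets M" for T
  proof -
    have "R\<^sup>* `` T = (\<Union>k. (R ^^ k) `` T)" by (auto simp: rtrancl_is_UN_relpow)
    then show ?thesis using Rn[OF that] by auto
  qed
  \<comment> \<open>Edges at an uncovered \<open>\<alpha>\<close>-vertex, and chosen edges that collide with another chosen edge.\<close>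
  define bad0 where "bad0 n = {e \<in> F. \<alpha> e \<notin> \<alpha> ` (L n \<inter> F)}
     \<union> ({e \<in> L n \<inter> F. \<exists>e'\<in>L n \<inter> F. e' \<noteq> e \<and> \<alpha> e' = \<alpha> e}
     \<union> {e \<in> L n \<inter> F. \<exists>e'\<in>L n \<inter> F. e' \<noteq> e \<and> \<beta> e' = \<beta> e})" for n
  have LF: "L n \<inter> F \<in> sets M" for n using cut_sets F by blast
  have bad0: "bad0 n \<in> sets M" for n
  proof -
    have "{e \<in> F. \<alpha> e \<notin> \<alpha> ` (L n \<inter> F)} = F - {e \<in> space M. \<alpha> e \<in> \<alpha> ` (L n \<inter> F)}"
      using FM by auto
    then have "{e \<in> F. \<alpha> e \<notin> \<alpha> ` (L n \<inter> F)} \<in> sets M"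
      using F borel_saturationsD(2)[OF \<alpha> LF] by auto
    then show ?thesis unfolding bad0_def
      using repeated_value_sets[OF \<alpha> LF] repeated_value_sets[OF \<beta> LF] by auto
  qed
  define bad where "bad n = R\<^sup>* `` bad0 n" for n
  have bad_sets: "bad n \<in> sets M" for n unfolding bad_def using Rstar bad0 by blast
  have bad_cong: "e \<in> bad n \<longleftrightarrow> e' \<in> bad n" if "(e, e') \<in> R\<^sup>*" for e e' n
    using that symR unfolding bad_def by (meson Image_iff rtrancl_trans symD)
  have good: "\<exists>n. e \<notin> bad n" if e: "e \<in> F" for e
  proof -
    define C where "C = R\<^sup>* `` {e}"
    have fC: "finite C" using fin[OF e] by (simp add: C_def R_def)
    have CF: "C \<subseteq> F" using RF e by (auto simp: C_def)
    have Cclosed: "e'' \<in> C" if "e' \<in> C" "e'' \<in> F" "\<alpha> e' = \<alpha> e'' \<or> \<beta> e' = \<beta> e''" for e' e''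
    proof -
      have "(e', e'') \<in> R" using that CF by (auto simp: R)
      then show ?thesis using that(1) unfolding C_def by (auto intro: rtrancl.rtrancl_into_rtrancl)
    qed
    have "\<exists>g. inj_on g (\<alpha> ` C) \<and> (\<forall>a\<in>\<alpha> ` C. g a \<in> \<beta> ` {e'\<in>C. \<alpha> e' = a})"
    proof (rule hall_finite)
      fix J assume J: "J \<subseteq> \<alpha> ` C"
      have "card J \<le> card (\<beta> ` {e' \<in> F. \<alpha> e' \<in> J})"
        using J CF fC by (intro hall) (auto intro: finite_subset)
      also have "{e' \<in> F. \<alpha> e' \<in> J} = {e' \<in> C. \<alpha> e' \<in> J}"
      proof (intro equalityI subsetI)
        fix e' assume e': "e' \<in> {e' \<in> F. \<alpha> e' \<in> J}"
        then obtain e'' where "e'' \<in> C" "\<alpha> e'' = \<alpha> e'" using J by force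
        then show "e' \<in> {e' \<in> C. \<alpha> e' \<in> J}" using Cclosed e' by auto
      qed (use CF in auto)
      also have "\<beta> ` {e' \<in> C. \<alpha> e' \<in> J} = (\<Union>a\<in>J. \<beta> ` {e'\<in>C. \<alpha> e' = a})" by auto
      finally show "card J \<le> card (\<Union>a\<in>J. \<beta> ` {e'\<in>C. \<alpha> e' = a})" .
    qed (use fC in auto)
    then obtain g where g: "inj_on g (\<alpha> ` C)" "\<And>a. a \<in> \<alpha> ` C \<Longrightarrow> g a \<in> \<beta> ` {e'\<in>C. \<alpha> e' = a}" by blast
    have "\<forall>a\<in>\<alpha> ` C. \<exists>e'. e' \<in> C \<and> \<alpha> e' = a \<and> \<beta> e' = g a" using g(2) by force
    then obtain h where h: "\<And>a. a \<in> \<alpha> ` C \<Longrightarrow> h a \<in> C \<and> \<alpha> (h a) = a \<and> \<beta> (h a) = g a" by metis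
    obtain n where n: "L n \<inter> C = h ` \<alpha> ` C"
      using cut_finite[OF fC, of "h ` \<alpha> ` C"] CF FM h by (meson image_subsetI subset_trans)
    have "e \<notin> bad n"
    proof
      assume "e \<in> bad n"
      then obtain e1 where e1: "e1 \<in> bad0 n" "(e1, e) \<in> R\<^sup>*" by (auto simp: bad_def)
      then have e1C: "e1 \<in> C" using symR by (auto simp: C_def dest: symD)
      have uniq: "e2 = e3" if u: "e2 \<in> L n \<inter> C" "e3 \<in> L n \<inter> C" "\<alpha> e2 = \<alpha> e3 \<or> \<beta> e2 = \<beta> e3" for e2 e3
      proof -
        obtain a2 a3 where a: "a2 \<in> \<alpha> ` C" "e2 = h a2" "a3 \<in> \<alpha> ` C" "e3 = h a3"
          using u(1,2) unfolding n by blast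
        then have "a2 = a3" using u(3) h g(1) by (metis inj_onD)
        then show ?thesis using a by simp
      qed
      consider "\<alpha> e1 \<notin> \<alpha> ` (L n \<inter> F)"
        | e2 where "e1 \<in> L n" "e2 \<in> L n \<inter> F" "e2 \<noteq> e1" "\<alpha> e2 = \<alpha> e1 \<or> \<beta> e2 = \<beta> e1"
        using e1(1) unfolding bad0_def by blast
      then show False
      proof cases
        case 1
        have "h (\<alpha> e1) \<in> L n \<inter> C" "\<alpha> (h (\<alpha> e1)) = \<alpha> e1" using n e1C h by auto
        then show False using 1 CF by (metis IntD1 IntD2 IntI image_eqI subsetD)
      next
        case 2
        then have "e2 \<in> C" using Cclosed[OF e1C, of e2] by auto
        then show False using uniq[of e1 e2] 2 e1C by auto
      qed
    qed
    then show ?thesis by blast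
  qed
  define k where "k e = (LEAST n. e \<notin> bad n)" for e
  have k: "e \<notin> bad (k e)" if "e \<in> F" for e using good[OF that] unfolding k_def by (rule LeastI_ex)
  have k_cong: "k e = k e'" if "(e, e') \<in> R\<^sup>*" for e e'
    unfolding k_def using bad_cong[OF that] by simp
  define N where "N = {e \<in> F. e \<in> L (k e)}"
  have "N = (\<Union>n. (L n \<inter> F) \<inter> (F - bad n) \<inter> (F - (\<Union>m\<in>{..<n}. F - bad m)))"
  proof (intro equalityI subsetI)
    fix e assume e: "e \<in> N"
    then have "e \<in> bad m" if "m < k e" for m using that not_less_Least unfolding k_def by blast
    then show "e \<in> (\<Union>n. (L n \<inter> F) \<inter> (F - bad n) \<inter> (F - (\<Union>m\<in>{..<n}. F - bad m)))"
      using e k by (auto simp: N_def intro!: exI[of _ "k e"])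
  next
    fix e assume "e \<in> (\<Union>n. (L n \<inter> F) \<inter> (F - bad n) \<inter> (F - (\<Union>m\<in>{..<n}. F - bad m)))"
    then obtain n where n: "e \<in> L n" "e \<in> F" "e \<notin> bad n" "\<And>m. m < n \<Longrightarrow> e \<in> bad m" by auto
    then have "k e = n" unfolding k_def by (intro Least_equality) (auto simp: not_less[symmetric])
    then show "e \<in> N" using n by (simp add: N_def)
  qed
  also have "\<dots> \<in> sets M"
    by (intro sets.countable_UN'' countableI_type sets.finite_UN sets.Int sets.Diff LF F bad_sets finite_lessThan)
  finally have NM: "N \<in> sets M" .
  have b0: "e \<notin> bad0 (k e)" if "e \<in> F" for e
    using k[OF that] unfolding bad_def by blast
  have RF1: "(e, e') \<in> R\<^sup>*" if "e \<in> F" "e' \<in> F" "\<alpha> e = \<alpha> e' \<or> \<beta> e = \<beta> e'" for e e'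
    using that by (auto simp: R)
  have "\<alpha> ` F \<subseteq> \<alpha> ` N"
  proof
    fix a assume "a \<in> \<alpha> ` F"
    then obtain e where e: "e \<in> F" "\<alpha> e = a" by blast
    then have "\<alpha> e \<in> \<alpha> ` (L (k e) \<inter> F)" using b0[OF e(1)] by (auto simp: bad0_def)
    then obtain e' where e': "e' \<in> L (k e)" "e' \<in> F" "\<alpha> e' = a" using e by auto
    then have "k e' = k e" using e by (intro k_cong RF1) auto
    then show "a \<in> \<alpha> ` N" using e' by (auto simp: N_def)
  qed
  moreover have inj: "e = e'" if "e \<in> N" "e' \<in> N" "\<alpha> e = \<alpha> e' \<or> \<beta> e = \<beta> e'" for e e'
  proof -
    have "k e' = k e" using that by (intro k_cong RF1) (auto simp: N_def)
    then show ?thesis using that b0[of e] by (auto simp: N_def bad0_def)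
  qed
  ultimately show ?thesis using NM
    by (intro bexI[of _ N]) (auto simp: N_def inj_on_def)
qed

end

section \<open>Matching vertices of high degree in finitely many rounds\<close>

text \<open>
  Double counting of the pairs \<open>(a, b)\<close> with \<open>b \<in> N a\<close>.
\<close>

lemma card_le_card_UN_if_multiplicity_le:
  assumes S: "finite S" and N: "\<And>a. a \<in> S \<Longrightarrow> finite (N a)" "\<And>a. a \<in> S \<Longrightarrow> d \<le> card (N a)"
    and mult: "\<And>b. card {a \<in> S. b \<in> N a} \<le> d" and d: "d > 0"
  shows "card S \<le> card (\<Union>a\<in>S. N a)"
proof -
  let ?U = "\<Union>a\<in>S. N a"
  have fU: "finite ?U" using S N(1) by blast
  have "d * card S = (\<Sum>a\<in>S. d)" by simp
  also have "\<dots> \<le> (\<Sum>a\<in>S. card (N a))" using N(2) by (rule sum_mono)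
  also have "\<dots> = (\<Sum>a\<in>S. card {b \<in> ?U. b \<in> N a})"
    by (intro sum.cong arg_cong[of _ _ card]) auto
  also have "\<dots> = (\<Sum>b\<in>?U. card {a \<in> S. b \<in> N a})"
    using S fU by (rule sum_multicount_gen) simp_all
  also have "\<dots> \<le> (\<Sum>b\<in>?U. d)" using mult by (intro sum_mono) auto
  also have "\<dots> = d * card ?U" by simp
  finally show ?thesis using d by simp
qed

text \<open>
  Two vertices are related if they have a common neighbour, where \<open>\<beta>\<close>-vertices are read as edges
  between \<open>\<alpha>\<close>-vertices. If components of a set \<open>Z\<close> are taken with respect to this relation,
  all neighbours in \<open>Z\<close> of a given vertex belong to the same component.
\<close>

definition two_step :: "'e set \<Rightarrow> ('e \<Rightarrow> 'a) \<Rightarrow> ('e \<Rightarrow> 'b) \<Rightarrow> ('a \<times> 'a) set" where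
  "two_step E \<alpha> \<beta> = {(z, z'). \<exists>e1\<in>E. \<exists>e2\<in>E. \<exists>e3\<in>E. \<exists>e4\<in>E.
     \<alpha> e1 = z \<and> \<beta> e1 = \<beta> e2 \<and> \<alpha> e2 = \<alpha> e3 \<and> \<beta> e3 = \<beta> e4 \<and> \<alpha> e4 = z'}"

lemma two_stepI:
  "\<lbrakk>e1 \<in> E; e2 \<in> E; e3 \<in> E; e4 \<in> E; \<beta> e1 = \<beta> e2; \<alpha> e2 = \<alpha> e3; \<beta> e3 = \<beta> e4\<rbrakk>
    \<Longrightarrow> (\<alpha> e1, \<alpha> e4) \<in> two_step E \<alpha> \<beta>"
  unfolding two_step_def by blast

text \<open>
  Walking along a component of \<open>F\<close>, each edge shares its \<open>\<beta>\<close>-endpoint with some vertex of \<open>Z\<close>. The vertices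
  of \<open>Z\<close> met in consecutive steps are two steps apart, so they all stay in one finite component.
\<close>

lemma finite_edge_components_near:
  fixes \<alpha> :: "'e \<Rightarrow> 'a" and \<beta> :: "'e \<Rightarrow> 'b"
  assumes fin: "\<And>a. finite {e \<in> E. \<alpha> e = a}" "\<And>b. finite {e \<in> E. \<beta> e = b}"
    and comp: "\<And>z. z \<in> Z \<Longrightarrow> finite ((two_step E \<alpha> \<beta> \<inter> Z \<times> Z)\<^sup>* `` {z})"
    and near: "\<And>e. e \<in> F \<Longrightarrow> \<exists>e0\<in>E. \<alpha> e0 \<in> Z \<and> \<beta> e0 = \<beta> e"
    and FE: "F \<subseteq> E" and e: "e \<in> F"
  shows "finite ((edge_adjacency \<alpha> \<beta> F)\<^sup>* `` {e})"
proof -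
  let ?T = "(two_step E \<alpha> \<beta> \<inter> Z \<times> Z)\<^sup>*"
  obtain e0 where e0: "e0 \<in> E" "\<alpha> e0 \<in> Z" "\<beta> e0 = \<beta> e" using near[OF e] by blast
  define C where "C = ?T `` {\<alpha> e0}"
  have fC: "finite C" using comp[OF e0(2)] by (simp add: C_def)
  have CZ: "C \<subseteq> Z"
  proof -
    have "z \<in> Z" if "(\<alpha> e0, z) \<in> ?T" for z using that by (induction) (use e0 in auto)
    then show ?thesis by (auto simp: C_def)
  qed
  define Q where "Q = {e'\<in>E. \<exists>e1\<in>E. \<alpha> e1 \<in> C \<and> \<beta> e1 = \<beta> e'}"
  have "Q \<subseteq> (\<Union>b\<in>\<beta> ` (\<Union>z\<in>C. {e1\<in>E. \<alpha> e1 = z}). {e'\<in>E. \<beta> e' = b})"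
    unfolding Q_def by force
  then have fQ: "finite Q" by (rule finite_subset) (use fin fC in auto)
  have "e' \<in> Q" if "(e, e') \<in> (edge_adjacency \<alpha> \<beta> F)\<^sup>*" for e'
    using that
  proof (induction)
    case base
    then show ?case using e0 e FE by (auto simp: Q_def C_def)
  next
    case (step e1 e2)
    then have e12: "e1 \<in> F" "e2 \<in> F" "\<alpha> e1 = \<alpha> e2 \<or> \<beta> e1 = \<beta> e2" by (auto simp: edge_adjacency_def)
    obtain e3 where e3: "e3 \<in> E" "\<alpha> e3 \<in> C" "\<beta> e3 = \<beta> e1" using step.IH by (auto simp: Q_def)
    show ?case
    proof (cases "\<beta> e1 = \<beta> e2")
      case True
      then show ?thesis using e12 e3 FE by (auto simp: Q_def)
    next
      case False
      then have a12: "\<alpha> e1 = \<alpha> e2" using e12 by simp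
      obtain e4 where e4: "e4 \<in> E" "\<alpha> e4 \<in> Z" "\<beta> e4 = \<beta> e2" using near[OF e12(2)] by blast
      have "(\<alpha> e3, \<alpha> e4) \<in> two_step E \<alpha> \<beta>"
        using e3 e4 e12 a12 FE by (intro two_stepI[of _ _ e1 e2]) auto
      then have "(\<alpha> e3, \<alpha> e4) \<in> two_step E \<alpha> \<beta> \<inter> Z \<times> Z" using e3 e4 CZ by auto
      then have "\<alpha> e4 \<in> C" using e3(2) unfolding C_def by (auto intro: rtrancl.rtrancl_into_rtrancl)
      then show ?thesis using e4 e12 FE by (auto simp: Q_def)
    qed
  qed
  then show ?thesis by (intro finite_subset[OF _ fQ]) auto
qed

context finite_cuts
begin

text \<open>
  The sets \<open>X i\<close> are treated one after the other, and each treatment costs the vertices not yet matched at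
  most half of their free \<open>\<beta>\<close>-neighbours. For \<open>X n\<close>, let \<open>B\<close> be the set of edges whose \<open>\<beta>\<close>-endpoint is adjacent
  to \<open>Y \<inter> X n\<close>, and let \<open>W\<close> consist of the vertices that have at least \<open>2 ^ Suc n\<close> neighbours in \<open>B\<close>; it
  contains \<open>Y \<inter> X n\<close>. Inside \<open>B\<close> components are finite, and Hall's condition holds for \<open>W\<close> since degrees
  are at least 2 while each \<open>\<beta>\<close>-vertex has at most 2 neighbours. The vertices outside \<open>W\<close> keep more than
  \<open>2 ^ Suc n\<close> neighbours outside \<open>B\<close>, which is what the induction hypothesis asks for.
\<close>

theorem matching_of_high_degree_vertices:
  fixes \<alpha> :: "'e \<Rightarrow> 'a" and \<beta> :: "'e \<Rightarrow> 'b"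
  assumes \<alpha>: "borel_saturations M \<alpha>" and \<beta>: "borel_saturations M \<beta>"
    and two: "\<And>b. card {e \<in> space M. \<beta> e = b} \<le> 2"
    and X: "\<And>i. i < n \<Longrightarrow> {e \<in> space M. \<alpha> e \<in> X i} \<in> sets M"
    and X_fin: "\<And>i z. \<lbrakk>i < n; z \<in> X i\<rbrakk> \<Longrightarrow> finite ((two_step (space M) \<alpha> \<beta> \<inter> X i \<times> X i)\<^sup>* `` {z})"
    and F: "F \<in> sets M" and Y: "{e \<in> space M. \<alpha> e \<in> Y} \<in> sets M"
    and deg: "\<And>y. y \<in> Y \<Longrightarrow> 2 ^ Suc n \<le> card (\<beta> ` {e \<in> F. \<alpha> e = y})"
    and cover: "Y \<subseteq> (\<Union>i<n. X i)"
  shows "\<exists>N \<in> sets M. N \<subseteq> F \<and> \<alpha> ` N = Y \<and> inj_on \<alpha> N \<and> inj_on \<beta> N"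
  using X X_fin F Y deg cover
proof (induction n arbitrary: F Y)
  case 0
  then show ?case by (intro bexI[of _ "{}"]) auto
next
  case (Suc n)
  note F = \<open>F \<in> sets M\<close> and Y = \<open>{e \<in> space M. \<alpha> e \<in> Y} \<in> sets M\<close>
  note deg = Suc.prems(5) and cover = Suc.prems(6)
  have FM: "F \<subseteq> space M" using F sets.sets_into_space by blast
  define B where "B = {e \<in> F. \<beta> e \<in> \<beta> ` {e \<in> F. \<alpha> e \<in> Y \<inter> X n}}"
  define W where "W = {y \<in> Y. 2 ^ Suc n \<le> card (\<beta> ` {e \<in> B. \<alpha> e = y})}"
  have B: "B \<in> sets M"
  proof -
    have "{e \<in> F. \<alpha> e \<in> Y \<inter> X n} = F \<inter> {e \<in> space M. \<alpha> e \<in> Y} \<inter> {e \<in> space M. \<alpha> e \<in> X n}"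
      using FM by auto
    then have "{e \<in> F. \<alpha> e \<in> Y \<inter> X n} \<in> sets M" using F Y Suc.prems(1)[of n] by auto
    from borel_saturationsD(2)[OF \<beta> this] have "F \<inter> {e \<in> space M. \<beta> e \<in> \<beta> ` {e \<in> F. \<alpha> e \<in> Y \<inter> X n}} \<in> sets M"
      using F by blast
    moreover have "F \<inter> {e \<in> space M. \<beta> e \<in> \<beta> ` {e \<in> F. \<alpha> e \<in> Y \<inter> X n}} = B"
      unfolding B_def using FM by blast
    ultimately show ?thesis by simp
  qed
  have W: "{e \<in> space M. \<alpha> e \<in> W} \<in> sets M"
  proof -
    have "{e \<in> space M. \<alpha> e \<in> W} = {e \<in> space M. \<alpha> e \<in> Y} \<inter> {e \<in> space M. 2 ^ Suc n \<le> card (\<beta> ` {e'\<in>B. \<alpha> e' = \<alpha> e})}"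
      by (auto simp: W_def)
    then show ?thesis using Y at_least_sets[OF \<alpha> \<beta> B, of "2 ^ Suc n"] by auto
  qed
  have fin\<alpha>: "finite {e \<in> D. \<alpha> e = a}" if "D \<subseteq> F" for D a
    by (rule finite_subset[OF _ borel_saturationsD(1)[OF \<alpha>, of a]]) (use that FM in auto)
  define FW where "FW = {e \<in> B. \<alpha> e \<in> W}"
  have BF: "B \<subseteq> F" and BM: "B \<subseteq> space M" using FM by (auto simp: B_def)
  have FW: "FW \<in> sets M"
  proof -
    have "FW = B \<inter> {e \<in> space M. \<alpha> e \<in> W}" using BM by (auto simp: FW_def)
    then show ?thesis using B W by auto
  qed
  have \<alpha>FW: "\<alpha> ` FW = W"
  proof
    show "W \<subseteq> \<alpha> ` FW"
    proof
      fix w assume w: "w \<in> W"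
      then have "0 < card (\<beta> ` {e \<in> B. \<alpha> e = w})" by (auto simp: W_def intro: less_le_trans[of 0 "2 ^ Suc n"])
      then have "{e \<in> B. \<alpha> e = w} \<noteq> {}" by (metis card.empty image_empty less_irrefl)
      then show "w \<in> \<alpha> ` FW" using w by (auto simp: FW_def)
    qed
  qed (auto simp: FW_def)
  have "\<exists>N \<in> sets M. N \<subseteq> FW \<and> \<alpha> ` N = \<alpha> ` FW \<and> inj_on \<alpha> N \<and> inj_on \<beta> N"
  proof (rule finite_component_matching[OF \<alpha> \<beta> FW])
    fix e assume e: "e \<in> FW"
    show "finite ((edge_adjacency \<alpha> \<beta> FW)\<^sup>* `` {e})"
    proof (rule finite_edge_components_near[where E = "space M" and Z = "X n"])
      show "\<exists>e0\<in>space M. \<alpha> e0 \<in> X n \<and> \<beta> e0 = \<beta> e" if "e \<in> FW" for e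
        using that FM by (auto simp: FW_def B_def)
    qed (use e FW sets.sets_into_space borel_saturationsD(1)[OF \<alpha>] borel_saturationsD(1)[OF \<beta>]
        Suc.prems(2)[of n] in auto)
  next
    fix S assume S: "finite S" "S \<subseteq> \<alpha> ` FW"
    have "card S \<le> card (\<Union>w\<in>S. \<beta> ` {e \<in> B. \<alpha> e = w})"
    proof (rule card_le_card_UN_if_multiplicity_le[where d = 2])
      fix w assume "w \<in> S"
      then have "2 ^ Suc n \<le> card (\<beta> ` {e \<in> B. \<alpha> e = w})" using S \<alpha>FW by (auto simp: W_def)
      moreover have "(2 :: nat) \<le> 2 ^ Suc n" by simp
      ultimately show "2 \<le> card (\<beta> ` {e \<in> B. \<alpha> e = w})" by linarith
      show "finite (\<beta> ` {e \<in> B. \<alpha> e = w})" using fin\<alpha>[OF BF] by auto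
    next
      fix b
      have "{w \<in> S. b \<in> \<beta> ` {e \<in> B. \<alpha> e = w}} \<subseteq> \<alpha> ` {e \<in> space M. \<beta> e = b}" using BM by auto
      then have "card {w \<in> S. b \<in> \<beta> ` {e \<in> B. \<alpha> e = w}} \<le> card (\<alpha> ` {e \<in> space M. \<beta> e = b})"
        using borel_saturationsD(1)[OF \<beta>] by (intro card_mono) auto
      also have "\<dots> \<le> card {e \<in> space M. \<beta> e = b}"
        using borel_saturationsD(1)[OF \<beta>] by (rule card_image_le)
      also have "\<dots> \<le> 2" by (rule two)
      finally show "card {w \<in> S. b \<in> \<beta> ` {e \<in> B. \<alpha> e = w}} \<le> 2" .
    qed (use S in auto)
    also have "(\<Union>w\<in>S. \<beta> ` {e \<in> B. \<alpha> e = w}) = \<beta> ` {e \<in> FW. \<alpha> e \<in> S}"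
      using S \<alpha>FW by (auto simp: FW_def)
    finally show "card S \<le> card (\<beta> ` {e \<in> FW. \<alpha> e \<in> S})" .
  qed
  then obtain N where N: "N \<in> sets M" "N \<subseteq> FW" "\<alpha> ` N = W" "inj_on \<alpha> N" "inj_on \<beta> N"
    using \<alpha>FW by auto
  have "\<exists>N \<in> sets M. N \<subseteq> F - B \<and> \<alpha> ` N = Y - W \<and> inj_on \<alpha> N \<and> inj_on \<beta> N"
  proof (rule Suc.IH)
    show "F - B \<in> sets M" using F B by auto
    have "{e \<in> space M. \<alpha> e \<in> Y - W} = {e \<in> space M. \<alpha> e \<in> Y} - {e \<in> space M. \<alpha> e \<in> W}" by auto
    then show "{e \<in> space M. \<alpha> e \<in> Y - W} \<in> sets M" using Y W by auto
  next
    fix y assume y: "y \<in> Y - W"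
    then have lt: "card (\<beta> ` {e \<in> B. \<alpha> e = y}) < 2 ^ Suc n" by (auto simp: W_def)
    have "2 ^ Suc (Suc n) \<le> card (\<beta> ` {e \<in> F. \<alpha> e = y})" using y deg by auto
    also have "\<beta> ` {e \<in> F. \<alpha> e = y} = \<beta> ` {e \<in> B. \<alpha> e = y} \<union> \<beta> ` {e \<in> F - B. \<alpha> e = y}"
      using BF by auto
    also have "card \<dots> \<le> card (\<beta> ` {e \<in> B. \<alpha> e = y}) + card (\<beta> ` {e \<in> F - B. \<alpha> e = y})"
      by (rule card_Un_le)
    finally show "2 ^ Suc n \<le> card (\<beta> ` {e \<in> F - B. \<alpha> e = y})" using lt by simp
  next
    have "Y \<inter> X n \<subseteq> W"
    proof
      fix y assume y: "y \<in> Y \<inter> X n"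
      then have "{e \<in> F. \<alpha> e = y} = {e \<in> B. \<alpha> e = y}" by (auto simp: B_def)
      moreover have "2 ^ Suc n \<le> card (\<beta> ` {e \<in> F. \<alpha> e = y})"
        using deg[of y] y by (auto intro: order_trans[of "2 ^ Suc n" "2 ^ Suc (Suc n)"])
      ultimately show "y \<in> W" using y unfolding W_def by auto
    qed
    then show "Y - W \<subseteq> (\<Union>i<n. X i)" using cover by (auto simp: lessThan_Suc)
  qed (use Suc.prems in auto)
  then obtain N' where N': "N' \<in> sets M" "N' \<subseteq> F - B" "\<alpha> ` N' = Y - W" "inj_on \<alpha> N'" "inj_on \<beta> N'"
    by blast
  have "N \<subseteq> B" using N(2) by (auto simp: FW_def)
  have "\<beta> ` N \<inter> \<beta> ` N' = {}"
  proof -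
    have "e' \<in> B" if "e \<in> B" "e' \<in> F" "\<beta> e = \<beta> e'" for e e' using that by (simp add: B_def)
    then show ?thesis using \<open>N \<subseteq> B\<close> N'(2) by blast
  qed
  then have "inj_on \<beta> (N \<union> N')" using N(5) N'(5) by (auto simp: inj_on_Un)
  moreover have "inj_on \<alpha> (N \<union> N')" using N(3,4) N'(3,4) by (auto simp: inj_on_Un)
  moreover have "\<alpha> ` (N \<union> N') = Y" using N(3) N'(3) by (auto simp: image_Un W_def)
  ultimately show ?case using N(1,2) N'(1,2) BF by (intro bexI[of _ "N \<union> N'"]) (auto simp: FW_def)
qed

end

section \<open>Borel decompositions into large connected cells\<close>

text \<open>
  The bipartite graph in the form in which it is used below: \<open>\<alpha>\<close> and \<open>\<beta>\<close> give the endpoints of an edge. As at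
  most two edges meet at a \<open>\<beta>\<close>-vertex, the \<open>\<beta>\<close>-vertices are the edges of a multigraph on the
  \<open>\<alpha>\<close>-vertices, with loops allowed, and the space \<open>M\<close> consists of its half-edges.
\<close>

locale half_edges = finite_cuts M L for M :: "'e measure" and L +
  fixes \<alpha> :: "'e \<Rightarrow> 'a" and \<beta> :: "'e \<Rightarrow> 'b"
  assumes sat_\<alpha>: "borel_saturations M \<alpha>" and sat_\<beta>: "borel_saturations M \<beta>"
    and two: "card {e \<in> space M. \<beta> e = b} \<le> 2"
begin

definition A :: "'a set" where "A = \<alpha> ` space M"

text \<open>
  This relation is reflexive on \<open>A\<close>, so its powers are increasing and \<open>adj ^^ k\<close> means distance at most \<open>k\<close>.
\<close>

definition adj :: "('a \<times> 'a) set" where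
  "adj = {(\<alpha> e, \<alpha> e') |e e'. e \<in> space M \<and> e' \<in> space M \<and> \<beta> e = \<beta> e'}"

definition borel_vertices :: "'a set \<Rightarrow> bool" where
  "borel_vertices S \<longleftrightarrow> {e \<in> space M. \<alpha> e \<in> S} \<in> sets M"

definition nbrs :: "'a set \<Rightarrow> 'b set" where
  "nbrs S = \<beta> ` {e \<in> space M. \<alpha> e \<in> S}"

lemma borel_vertices_Diff: "borel_vertices S \<Longrightarrow> borel_vertices T \<Longrightarrow> borel_vertices (S - T)"
  unfolding borel_vertices_def
  by (simp add: set_diff_eq sets.sets_Collect_conj sets.sets_Collect_neg)

lemma borel_vertices_Int: "borel_vertices S \<Longrightarrow> borel_vertices T \<Longrightarrow> borel_vertices (S \<inter> T)"
  unfolding borel_vertices_def by (simp add: sets.sets_Collect_conj)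

lemma borel_vertices_Un: "borel_vertices S \<Longrightarrow> borel_vertices T \<Longrightarrow> borel_vertices (S \<union> T)"
  unfolding borel_vertices_def by (simp add: sets.sets_Collect_disj)

lemma borel_vertices_UN:
  assumes "countable I" and "\<And>i. i \<in> I \<Longrightarrow> borel_vertices (S i)"
  shows "borel_vertices (\<Union>i\<in>I. S i)"
proof -
  have "{e \<in> space M. \<alpha> e \<in> (\<Union>i\<in>I. S i)} = (\<Union>i\<in>I. {e \<in> space M. \<alpha> e \<in> S i})" by auto
  moreover have "(\<Union>i\<in>I. {e \<in> space M. \<alpha> e \<in> S i}) \<in> sets M"
    using assms unfolding borel_vertices_def by (intro sets.countable_UN'') auto
  ultimately show ?thesis by (simp add: borel_vertices_def)
qed

lemma borel_vertices_empty: "borel_vertices {}"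
  by (simp add: borel_vertices_def)

lemma borel_vertices_image: "U \<in> sets M \<Longrightarrow> borel_vertices (\<alpha> ` U)"
  unfolding borel_vertices_def by (rule borel_saturationsD(2)[OF sat_\<alpha>])

lemma borel_vertices_A: "borel_vertices A"
  unfolding A_def by (rule borel_vertices_image) simp

lemma L_space: "L n \<subseteq> space M"
  using cut_sets sets.sets_into_space by blast

lemma finite_fibre: "finite {e \<in> space M. \<alpha> e = a}" "finite {e \<in> space M. \<beta> e = b}"
  using borel_saturationsD(1)[OF sat_\<alpha>] borel_saturationsD(1)[OF sat_\<beta>] by auto

lemma finite_nbrs:
  assumes "finite S" shows "finite (nbrs S)"
proof -
  have "nbrs S = \<beta> ` (\<Union>a\<in>S. {e \<in> space M. \<alpha> e = a})" by (auto simp: nbrs_def)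
  then show ?thesis using assms finite_fibre by auto
qed

lemma adjI: "\<lbrakk>e \<in> space M; e' \<in> space M; \<beta> e = \<beta> e'\<rbrakk> \<Longrightarrow> (\<alpha> e, \<alpha> e') \<in> adj"
  by (auto simp: adj_def)

lemma adj_sym: "(a, a') \<in> adj \<Longrightarrow> (a', a) \<in> adj"
  by (force simp: adj_def)

lemma adj_refl: "a \<in> A \<Longrightarrow> (a, a) \<in> adj"
  by (auto simp: adj_def A_def)

lemma adj_in_A: "(a, a') \<in> adj \<Longrightarrow> a \<in> A \<and> a' \<in> A"
  by (auto simp: adj_def A_def)

lemma adj_Image: "adj `` S = \<alpha> ` {e' \<in> space M. \<beta> e' \<in> nbrs S}"
proof (intro equalityI subsetI)
  fix a assume "a \<in> adj `` S"
  then obtain e e' where "e \<in> space M" "e' \<in> space M" "\<beta> e = \<beta> e'" "\<alpha> e \<in> S" "a = \<alpha> e'"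
    by (auto simp: adj_def)
  then have "\<beta> e' \<in> nbrs S" unfolding nbrs_def by (intro image_eqI[of _ _ e]) auto
  then show "a \<in> \<alpha> ` {e' \<in> space M. \<beta> e' \<in> nbrs S}" using \<open>e' \<in> space M\<close> \<open>a = \<alpha> e'\<close> by blast
next
  fix a assume "a \<in> \<alpha> ` {e' \<in> space M. \<beta> e' \<in> nbrs S}"
  then obtain e e' where "e \<in> space M" "e' \<in> space M" "\<beta> e = \<beta> e'" "\<alpha> e \<in> S" "a = \<alpha> e'"
    by (auto simp: nbrs_def)
  then show "a \<in> adj `` S" using adjI by blast
qed

lemma pow_sym: "(a, a') \<in> adj ^^ k \<Longrightarrow> (a', a) \<in> adj ^^ k"
proof (induction k arbitrary: a')
  case (Suc k)
  then obtain x where x: "(a, x) \<in> adj ^^ k" "(x, a') \<in> adj" by auto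
  then have "(x, a) \<in> adj ^^ k" "(a', x) \<in> adj" using Suc.IH adj_sym by auto
  then show ?case by (rule relpow_Suc_I2[rotated])
qed simp

lemma pow_in_A: "(a, a') \<in> adj ^^ k \<Longrightarrow> a \<in> A \<Longrightarrow> a' \<in> A"
proof (induction k arbitrary: a')
  case (Suc k)
  then obtain x where "(x, a') \<in> adj" by auto
  then show ?case using adj_in_A by blast
qed simp

lemma pow_mono:
  assumes "(a, a') \<in> adj ^^ k" and "k \<le> l" and "a \<in> A"
  shows "(a, a') \<in> adj ^^ l"
  using assms(2)
proof (induction l rule: dec_induct)
  case base
  then show ?case using assms(1) .
next
  case (step l)
  then have "(a', a') \<in> adj" using adj_refl pow_in_A assms(3) by blast
  with step.IH show ?case by (rule relpow_Suc_I)
qed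

lemma pow_trans: "(a, b) \<in> adj ^^ k \<Longrightarrow> (b, c) \<in> adj ^^ l \<Longrightarrow> (a, c) \<in> adj ^^ (k + l)"
  unfolding relpow_add by (rule relcompI)

lemma adj_Image_finite:
  assumes "finite S" shows "finite (adj `` S)"
proof -
  have "{e' \<in> space M. \<beta> e' \<in> nbrs S} = (\<Union>b\<in>nbrs S. {e' \<in> space M. \<beta> e' = b})" by auto
  also have "finite \<dots>" using finite_nbrs[OF assms] finite_fibre(2) by (rule finite_UN_I)
  finally show ?thesis unfolding adj_Image by (rule finite_imageI)
qed

lemma pow_Suc_Image: "(adj ^^ Suc k) `` S = adj `` ((adj ^^ k) `` S)"
  by (simp add: relcomp_Image)

lemma pow_Image_finite: "finite S \<Longrightarrow> finite ((adj ^^ k) `` S)"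
proof (induction k)
  case (Suc k)
  then show ?case by (simp only: pow_Suc_Image adj_Image_finite)
qed simp

lemma borel_vertices_adj:
  assumes "borel_vertices S" shows "borel_vertices (adj `` S)"
proof -
  have "{e' \<in> space M. \<beta> e' \<in> nbrs S} \<in> sets M"
    using borel_saturationsD(2)[OF sat_\<beta> assms[unfolded borel_vertices_def]] by (simp add: nbrs_def)
  then show ?thesis unfolding adj_Image by (rule borel_vertices_image)
qed

lemma borel_vertices_pow: "borel_vertices S \<Longrightarrow> borel_vertices ((adj ^^ k) `` S)"
proof (induction k)
  case (Suc k)
  then show ?case by (simp only: pow_Suc_Image borel_vertices_adj)
qed simp

lemma separate_vertices:
  assumes "a \<in> A" and "a \<noteq> a'"
  shows "\<exists>m. a \<in> \<alpha> ` L m \<and> a' \<notin> \<alpha> ` L m"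
proof -
  let ?C = "{e \<in> space M. \<alpha> e = a} \<union> {e \<in> space M. \<alpha> e = a'}"
  obtain m where m: "L m \<inter> ?C = {e \<in> space M. \<alpha> e = a}"
    using cut_finite[of ?C "{e \<in> space M. \<alpha> e = a}"] finite_fibre by auto
  obtain e where "e \<in> space M" "\<alpha> e = a" using assms(1) by (auto simp: A_def)
  then have "e \<in> L m" using m by blast
  moreover have "a' \<notin> \<alpha> ` L m"
  proof
    assume "a' \<in> \<alpha> ` L m"
    then obtain e' where "e' \<in> L m" "\<alpha> e' = a'" by blast
    then have "e' \<in> L m \<inter> ?C" using L_space by auto
    then show False using m \<open>\<alpha> e' = a'\<close> assms(2) by auto
  qed
  ultimately show ?thesis using \<open>\<alpha> e = a\<close> by blast
qed

text \<open>
  For \<open>a\<close> in \<open>A\<close>, some \<open>L n\<close> contains the edges at \<open>a\<close> but no other edge at a vertex of the finite ball of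
  radius \<open>q\<close> around \<open>a\<close>; the least such \<open>n\<close> is a colour.
\<close>

lemma exists_distance_coloring:
  obtains c :: "'a \<Rightarrow> nat" where "\<And>n. borel_vertices {a \<in> A. c a = n}"
    and "\<And>a a'. \<lbrakk>a \<in> A; a \<noteq> a'; (a, a') \<in> adj ^^ q\<rbrakk> \<Longrightarrow> c a \<noteq> c a'"
proof -
  \<comment> \<open>Vertices touched by \<open>L n\<close> that have another such vertex within distance \<open>q\<close>.\<close>
  define Bad where "Bad n = (\<Union>m. (\<alpha> ` L n \<inter> \<alpha> ` L m) \<inter> (adj ^^ q) `` (\<alpha> ` L n - \<alpha> ` L m))" for n
  define Y where "Y n = \<alpha> ` L n - Bad n" for n
  have bY: "borel_vertices (Y n)" for n
    unfolding Y_def Bad_def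
    by (intro borel_vertices_Diff borel_vertices_UN countableI_type borel_vertices_Int
        borel_vertices_pow borel_vertices_image cut_sets)
  have proper: "a = a'" if Y: "a \<in> Y n" "a' \<in> Y n" "(a, a') \<in> adj ^^ q" for a a' n
  proof (rule ccontr)
    assume "a \<noteq> a'"
    moreover have "a \<in> A" using Y(1) L_space by (auto simp: Y_def A_def)
    ultimately obtain m where "a \<in> \<alpha> ` L m" "a' \<notin> \<alpha> ` L m" using separate_vertices by blast
    then have "a \<in> Bad n" using Y pow_sym[OF Y(3)] unfolding Bad_def Y_def by blast
    then show False using Y(1) by (simp add: Y_def)
  qed
  have cover: "\<exists>n. a \<in> Y n" if a: "a \<in> A" for a
  proof -
    let ?C = "{e \<in> space M. \<alpha> e \<in> insert a ((adj ^^ q) `` {a})}"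
    have "?C = (\<Union>x\<in>insert a ((adj ^^ q) `` {a}). {e \<in> space M. \<alpha> e = x})" by auto
    also have "finite \<dots>" using finite_fibre pow_Image_finite[of "{a}" q] by auto
    finally obtain n where n: "L n \<inter> ?C = {e \<in> space M. \<alpha> e = a}"
      using cut_finite[of ?C "{e \<in> space M. \<alpha> e = a}"] by auto
    have 1: "a \<in> \<alpha> ` L n" using n a by (auto simp: A_def)
    have 2: "a' = a" if a': "a' \<in> \<alpha> ` L n" "(a', a) \<in> adj ^^ q" for a'
    proof -
      obtain e where e: "e \<in> L n" "\<alpha> e = a'" using a'(1) by blast
      then have "e \<in> L n \<inter> ?C" using L_space pow_sym[OF a'(2)] by auto
      then show "a' = a" using n e(2) by auto
    qed
    have "a \<notin> Bad n"
    proof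
      assume "a \<in> Bad n"
      then obtain m a' where "a \<in> \<alpha> ` L m" "(a', a) \<in> adj ^^ q" "a' \<in> \<alpha> ` L n - \<alpha> ` L m"
        unfolding Bad_def by (elim UN_E IntE ImageE)
      moreover from this have "a' = a" using 2 by (elim DiffE)
      ultimately show False by (elim DiffE) simp
    qed
    then have "a \<in> Y n" using 1 by (simp add: Y_def)
    then show ?thesis ..
  qed
  define c where "c a = (LEAST n. a \<in> Y n)" for a
  have c: "a \<in> Y (c a)" if "a \<in> A" for a unfolding c_def using cover[OF that] by (rule LeastI_ex)
  have cls: "{a \<in> A. c a = n} = (A \<inter> Y n) - (\<Union>m\<in>{..<n}. Y m)" for n
  proof (intro equalityI subsetI)
    fix a assume "a \<in> {a \<in> A. c a = n}"
    then have a: "a \<in> A" "c a = n" by auto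
    have "a \<notin> Y m" if "m < n" for m
      using not_less_Least[of m "\<lambda>n. a \<in> Y n"] that a(2) by (simp add: c_def)
    then show "a \<in> (A \<inter> Y n) - (\<Union>m\<in>{..<n}. Y m)" using a c by auto
  next
    fix a assume a: "a \<in> (A \<inter> Y n) - (\<Union>m\<in>{..<n}. Y m)"
    have "c a = n"
      unfolding c_def
    proof (rule Least_equality)
      fix m assume "a \<in> Y m"
      then show "n \<le> m" using a by (cases "m < n") auto
    qed (use a in simp)
    then show "a \<in> {a \<in> A. c a = n}" using a by simp
  qed
  have "borel_vertices {a \<in> A. c a = n}" for n
    unfolding cls
    by (intro borel_vertices_Diff borel_vertices_Int borel_vertices_UN borel_vertices_A bY countable_finite finite_lessThan)
  moreover have "c a \<noteq> c a'" if "a \<in> A" "a \<noteq> a'" "(a, a') \<in> adj ^^ q" for a a'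
    using proper[of a "c a" a'] c[of a] c[of a'] that pow_in_A[OF that(3,1)] by metis
  ultimately show thesis by (rule that)
qed

text \<open>
  The colour classes of a distance colouring are independent, so the greedy algorithm can treat
  them one after the other.
\<close>

lemma exists_borel_net:
  obtains Z where "Z \<subseteq> A" and "borel_vertices Z"
    and "\<And>z z'. \<lbrakk>z \<in> Z; z' \<in> Z; (z, z') \<in> adj ^^ q\<rbrakk> \<Longrightarrow> z = z'"
    and "\<And>a. a \<in> A \<Longrightarrow> \<exists>z\<in>Z. (z, a) \<in> adj ^^ q"
proof -
  obtain c :: "'a \<Rightarrow> nat" where c: "\<And>n. borel_vertices {a \<in> A. c a = n}"
    "\<And>a a'. \<lbrakk>a \<in> A; a \<noteq> a'; (a, a') \<in> adj ^^ q\<rbrakk> \<Longrightarrow> c a \<noteq> c a'"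
    by (rule exists_distance_coloring[of q]) (rule that, assumption+)
  define U where "U = rec_nat {} (\<lambda>n V. V \<union> ({a \<in> A. c a = n} - (adj ^^ q) `` V))"
  have U0: "U 0 = {}" and US: "U (Suc n) = U n \<union> ({a \<in> A. c a = n} - (adj ^^ q) `` U n)" for n
    by (simp_all add: U_def)
  have UA: "U n \<subseteq> A" for n by (induction n) (auto simp: U0 US)
  have bU: "borel_vertices (U n)" for n
    by (induction n) (auto simp: U0 US c borel_vertices_empty intro!: borel_vertices_Un borel_vertices_Diff borel_vertices_pow)
  have mono: "U m \<subseteq> U n" if "m \<le> n" for m n using that by (rule lift_Suc_mono_le[rotated]) (auto simp: US)
  have indep: "z = z'" if "z \<in> U n" "z' \<in> U n" "(z, z') \<in> adj ^^ q" for z z' n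
    using that
  proof (induction n)
    case (Suc n)
    have "(z', z) \<in> adj ^^ q" using Suc.prems(3) pow_sym by blast
    consider "z \<in> U n" "z' \<in> U n" | "z \<in> U n" "z' \<notin> (adj ^^ q) `` U n"
      | "z' \<in> U n" "z \<notin> (adj ^^ q) `` U n" | "z \<in> A" "c z = n" "c z' = n"
      using Suc.prems(1,2) unfolding US by blast
    then show ?case
    proof cases
      case 1 then show ?thesis using Suc by blast
    next
      case 2 then show ?thesis using Suc.prems(3) by blast
    next
      case 3 then show ?thesis using \<open>(z', z) \<in> adj ^^ q\<close> by blast
    next
      case 4 then show ?thesis using c(2)[of z z'] Suc.prems(3) by auto
    qed
  qed (simp add: U0)
  let ?Z = "\<Union>n. U n"
  have "z = z'" if "z \<in> ?Z" "z' \<in> ?Z" "(z, z') \<in> adj ^^ q" for z z'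
  proof -
    obtain m n where "z \<in> U m" "z' \<in> U n" using \<open>z \<in> ?Z\<close> \<open>z' \<in> ?Z\<close> by blast
    then have "z \<in> U (max m n)" "z' \<in> U (max m n)" using mono by (meson max.cobounded1 max.cobounded2 subsetD)+
    then show ?thesis using indep that by blast
  qed
  moreover have "\<exists>z\<in>?Z. (z, a) \<in> adj ^^ q" if a: "a \<in> A" for a
  proof (cases "a \<in> (adj ^^ q) `` U (c a)")
    case False
    then have "a \<in> U (Suc (c a))" using a by (simp add: US)
    moreover have "(a, a) \<in> adj ^^ q" using pow_mono[of a a 0 q] a by auto
    ultimately show ?thesis by blast
  qed blast
  moreover have "?Z \<subseteq> A" "borel_vertices ?Z" using UA bU by (auto intro!: borel_vertices_UN)
  ultimately show thesis using that by blast
qed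

text \<open>
  A Voronoi decomposition. The centres form a maximal set of points with distances above \<open>2 * R\<close>, whence
  a ball of radius \<open>R\<close> around a centre belongs to its cell. Each vertex \<open>a\<close> goes to the centre \<open>p a\<close>
  that minimises first the distance \<open>d\<close> and then the colour. Colours are distinct among all
  centres within reach, so the minimum is unique, and a vertex next to \<open>a\<close> on a shortest path to
  \<open>p a\<close> makes the same choice; this is why cells are connected. The pair of distance and colour takes
  countably many values, which makes \<open>p\<close> Borel piece by piece.
\<close>

lemma exists_cells:
  obtains p :: "'a \<Rightarrow> 'a" and d :: "'a \<Rightarrow> nat"
  where "\<And>a. a \<in> A \<Longrightarrow> p a \<in> A \<and> (p a, a) \<in> adj ^^ (2 * R)"
    and "\<And>a x. \<lbrakk>a \<in> A; (p a, x) \<in> adj ^^ R\<rbrakk> \<Longrightarrow> p x = p a"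
    and "\<And>a. a \<in> A \<Longrightarrow> a = p a \<or> (\<exists>a'. (a, a') \<in> adj \<and> p a' = p a \<and> d a' < d a)"
    and "\<And>T. borel_vertices T \<Longrightarrow> borel_vertices {a \<in> A. p a \<in> T}"
    and "borel_saturations M (\<lambda>e. p (\<alpha> e))"
proof -
  define q where "q = 2 * R"
  obtain Z where Z: "Z \<subseteq> A" "borel_vertices Z" "\<And>z z'. \<lbrakk>z \<in> Z; z' \<in> Z; (z, z') \<in> adj ^^ q\<rbrakk> \<Longrightarrow> z = z'"
    "\<And>a. a \<in> A \<Longrightarrow> \<exists>z\<in>Z. (z, a) \<in> adj ^^ q"
    by (rule exists_borel_net[of q]) (rule that, assumption+)
  \<comment> \<open>Two centres within distance \<open>q\<close> of a vertex are within distance \<open>q + q\<close> of each other.\<close>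
  obtain c :: "'a \<Rightarrow> nat" where c: "\<And>n. borel_vertices {a \<in> A. c a = n}"
    "\<And>a a'. \<lbrakk>a \<in> A; a \<noteq> a'; (a, a') \<in> adj ^^ (q + q)\<rbrakk> \<Longrightarrow> c a \<noteq> c a'"
    by (rule exists_distance_coloring[of "q + q"]) (rule that, assumption+)
  define d where "d a = (LEAST k. \<exists>z\<in>Z. (z, a) \<in> adj ^^ k)" for a
  define n where "n a = (LEAST k. \<exists>z\<in>Z. c z = k \<and> (z, a) \<in> adj ^^ d a)" for a
  define p where "p a = (THE z. z \<in> Z \<and> c z = n a \<and> (z, a) \<in> adj ^^ d a)" for a
  have d_le: "d a \<le> k" if "z \<in> Z" "(z, a) \<in> adj ^^ k" for a z k
    unfolding d_def using that by (blast intro: Least_le)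
  have dZ: "\<exists>z\<in>Z. (z, a) \<in> adj ^^ d a" if "a \<in> A" for a
    unfolding d_def by (rule LeastI_ex) (use Z(4)[OF that] in blast)
  have dq: "d a \<le> q" if "a \<in> A" for a using Z(4)[OF that] d_le by blast
  have n_le: "n a \<le> c z" if "z \<in> Z" "(z, a) \<in> adj ^^ d a" for a z
    unfolding n_def using that by (blast intro: Least_le)
  have nZ: "\<exists>z\<in>Z. c z = n a \<and> (z, a) \<in> adj ^^ d a" if "a \<in> A" for a
    unfolding n_def by (rule LeastI_ex) (use dZ[OF that] in blast)
  have same: "z = z'" if z: "z \<in> Z" "z' \<in> Z" "c z = c z'" "(z, a) \<in> adj ^^ d a" "(z', a) \<in> adj ^^ d a" "a \<in> A"
    for z z' a
  proof -
    have "(z, z') \<in> adj ^^ (d a + d a)" using pow_trans z pow_sym by blast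
    then have "(z, z') \<in> adj ^^ (q + q)" using dq[OF z(6)] z(1) Z(1) by (auto intro: pow_mono)
    then show ?thesis using c(2) z Z(1) by blast
  qed
  have p_eqI: "p a = z" if "z \<in> Z" "c z = n a" "(z, a) \<in> adj ^^ d a" "a \<in> A" for a z
    unfolding p_def using that same by (intro the_equality) auto
  have p: "p a \<in> Z" "c (p a) = n a" "(p a, a) \<in> adj ^^ d a" if "a \<in> A" for a
    using nZ[OF that] p_eqI that by metis+
  have 1: "p a \<in> A" "(p a, a) \<in> adj ^^ q" if "a \<in> A" for a
    using p[OF that] Z(1) dq[OF that] by (auto intro: pow_mono)
  have 2: "p x = z" if z: "z \<in> Z" "(z, x) \<in> adj ^^ R" for z x
  proof -
    have x: "x \<in> A" using z Z(1) pow_in_A by blast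
    have "d x \<le> R" using d_le z by blast
    then have "(p x, x) \<in> adj ^^ R" using p(3)[OF x] p(1)[OF x] Z(1) by (auto intro: pow_mono)
    then have "(z, p x) \<in> adj ^^ (R + R)" using pow_trans[OF z(2)] pow_sym by blast
    then show ?thesis using Z(3)[OF z(1) p(1)[OF x]] by (simp add: q_def mult_2)
  qed
  have 3: "a = p a \<or> (\<exists>a'. (a, a') \<in> adj \<and> p a' = p a \<and> d a' < d a)" if a: "a \<in> A" for a
  proof (cases "d a")
    case 0
    then show ?thesis using p(3)[OF a] by simp
  next
    case (Suc k)
    then obtain a' where a': "(p a, a') \<in> adj ^^ k" "(a', a) \<in> adj" using p(3)[OF a] by auto
    have aA: "a' \<in> A" using adj_in_A a' by blast
    have "d a' \<le> k" using d_le p(1)[OF a] a' by blast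
    moreover have near: "(z, a) \<in> adj ^^ Suc j" if "(z, a') \<in> adj ^^ j" for z j using that a'(2) by auto
    then have "d a \<le> Suc (d a')" using d_le p(1,3)[OF aA] by blast
    ultimately have k: "d a' = k" using Suc by simp
    have "n a \<le> c (p a')" using n_le[OF p(1)[OF aA]] near[OF p(3)[OF aA]] k Suc by simp
    moreover have "n a' \<le> c (p a)" using n_le[OF p(1)[OF a], of a'] a'(1) k by simp
    ultimately have "c (p a) = n a'" using p(2)[OF a] p(2)[OF aA] by simp
    then have "p a' = p a" using p_eqI[OF p(1)[OF a] _ _ aA] a'(1) k by simp
    then show ?thesis using a'(2) adj_sym k Suc by auto
  qed
  have bd: "borel_vertices {a \<in> A. d a = k}" for k
  proof -
    have "{a \<in> A. d a = k} = (A \<inter> (adj ^^ k) `` Z) - (\<Union>j\<in>{..<k}. (adj ^^ j) `` Z)"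
    proof (intro equalityI subsetI)
      fix a assume "a \<in> {a \<in> A. d a = k}"
      then show "a \<in> (A \<inter> (adj ^^ k) `` Z) - (\<Union>j\<in>{..<k}. (adj ^^ j) `` Z)"
        using dZ[of a] d_le[of _ a] by (force simp: not_less[symmetric])
    next
      fix a assume "a \<in> (A \<inter> (adj ^^ k) `` Z) - (\<Union>j\<in>{..<k}. (adj ^^ j) `` Z)"
      then show "a \<in> {a \<in> A. d a = k}"
        unfolding d_def by (auto intro!: Least_equality simp: not_less[symmetric])
    qed
    then show ?thesis using Z(2)
      by (auto intro!: borel_vertices_Diff borel_vertices_Int borel_vertices_UN borel_vertices_A borel_vertices_pow)
  qed
  define ZC where "ZC k = Z \<inter> {a \<in> A. c a = k}" for k
  have bc: "borel_vertices (ZC k)" for k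
    unfolding ZC_def using Z(2) c(1) by (rule borel_vertices_Int)
  have ZC: "z \<in> ZC k \<longleftrightarrow> z \<in> Z \<and> c z = k" for z k using Z(1) by (auto simp: ZC_def)
  define Q where "Q k j = {a \<in> A. d a = k \<and> n a = j}" for k j
  have bQ: "borel_vertices (Q k j)" for k j
  proof -
    have "Q k j = {a \<in> A. d a = k} \<inter> (adj ^^ k) `` ZC j
        - (\<Union>i\<in>{..<j}. (adj ^^ k) `` ZC i)"
    proof (intro equalityI subsetI)
      fix a assume a: "a \<in> Q k j"
      then have "a \<in> A" "d a = k" "n a = j" by (auto simp: Q_def)
      then show "a \<in> {a \<in> A. d a = k} \<inter> (adj ^^ k) `` ZC j
        - (\<Union>i\<in>{..<j}. (adj ^^ k) `` ZC i)"
        using p[of a] n_le[of _ a] by (force simp: not_less[symmetric] ZC)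
    next
      fix a assume a: "a \<in> {a \<in> A. d a = k} \<inter> (adj ^^ k) `` ZC j
        - (\<Union>i\<in>{..<j}. (adj ^^ k) `` ZC i)"
      then have aA: "a \<in> A" "d a = k" by auto
      obtain z where z: "z \<in> Z" "c z = j" "(z, a) \<in> adj ^^ d a" using a aA by (auto simp: ZC)
      have "n a \<le> j" using n_le z by blast
      moreover have "\<not> n a < j"
      proof
        assume "n a < j"
        moreover have "a \<in> (adj ^^ k) `` ZC (n a)" using p[OF aA(1)] aA(2) by (auto simp: ZC)
        ultimately show False using a by blast
      qed
      ultimately show "a \<in> Q k j" using aA by (simp add: Q_def)
    qed
    then show ?thesis
      by (simp only:) (intro borel_vertices_Diff borel_vertices_Int borel_vertices_UN
          borel_vertices_pow bd bc countable_finite finite_lessThan)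
  qed
  have pQ: "p a = z" if "a \<in> Q k j" "z \<in> Z" "c z = j" "(z, a) \<in> adj ^^ k" for a z k j
    using that by (intro p_eqI) (auto simp: Q_def)
  have inQ: "a \<in> Q (d a) (n a)" if "a \<in> A" for a using that by (simp add: Q_def)
  have b_pre: "borel_vertices {a \<in> A. p a \<in> T}" if "borel_vertices T" for T
  proof -
    have "{a \<in> A. p a \<in> T} = (\<Union>k. \<Union>j. Q k j \<inter> (adj ^^ k) `` (T \<inter> ZC j))"
    proof (intro equalityI subsetI)
      fix a assume "a \<in> {a \<in> A. p a \<in> T}"
      then show "a \<in> (\<Union>k. \<Union>j. Q k j \<inter> (adj ^^ k) `` (T \<inter> ZC j))"
        using p[of a] inQ[of a] by (force simp: ZC)
    next
      fix a assume "a \<in> (\<Union>k. \<Union>j. Q k j \<inter> (adj ^^ k) `` (T \<inter> ZC j))"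
      then show "a \<in> {a \<in> A. p a \<in> T}" using pQ by (force simp: Q_def ZC)
    qed
    then show ?thesis
      by (simp only:) (intro borel_vertices_UN borel_vertices_Int borel_vertices_pow bQ bc that countableI_type)
  qed
  have b_img: "borel_vertices (p ` S)" if "borel_vertices S" "S \<subseteq> A" for S
  proof -
    have "p ` S = (\<Union>k. \<Union>j. ZC j \<inter> (adj ^^ k) `` (S \<inter> Q k j))"
    proof (intro equalityI subsetI)
      fix z assume "z \<in> p ` S"
      then obtain a where a: "a \<in> S" "z = p a" by blast
      then show "z \<in> (\<Union>k. \<Union>j. ZC j \<inter> (adj ^^ k) `` (S \<inter> Q k j))"
        using p[of a] inQ[of a] that(2) pow_sym[of "p a" a] by (force simp: ZC)
    next
      fix z assume "z \<in> (\<Union>k. \<Union>j. ZC j \<inter> (adj ^^ k) `` (S \<inter> Q k j))"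
      then obtain k j a where "z \<in> Z" "c z = j" "a \<in> S" "a \<in> Q k j" "(a, z) \<in> adj ^^ k" by (auto simp: ZC)
      then show "z \<in> p ` S" using pQ pow_sym by blast
    qed
    then show ?thesis
      by (simp only:) (intro borel_vertices_UN borel_vertices_Int borel_vertices_pow bQ bc that countableI_type)
  qed
  have sat: "borel_saturations M (\<lambda>e. p (\<alpha> e))"
    unfolding borel_saturations_def
  proof (intro conjI allI ballI)
    fix z
    have "{e \<in> space M. p (\<alpha> e) = z} \<subseteq> (\<Union>a\<in>(adj ^^ q) `` {z}. {e \<in> space M. \<alpha> e = a})"
    proof
      fix e assume "e \<in> {e \<in> space M. p (\<alpha> e) = z}"
      moreover from this have "\<alpha> e \<in> A" by (auto simp: A_def)
      ultimately show "e \<in> (\<Union>a\<in>(adj ^^ q) `` {z}. {e \<in> space M. \<alpha> e = a})" using 1[of "\<alpha> e"] by auto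
    qed
    then show "finite {e \<in> space M. p (\<alpha> e) = z}"
      by (rule finite_subset) (use finite_fibre pow_Image_finite[of "{z}" q] in auto)
  next
    fix U assume U: "U \<in> sets M"
    then have UM: "U \<subseteq> space M" using sets.sets_into_space by blast
    have "borel_vertices {a \<in> A. p a \<in> p ` \<alpha> ` U}"
      using U UM by (intro b_pre b_img borel_vertices_image) (auto simp: A_def)
    moreover have "{e \<in> space M. \<alpha> e \<in> {a \<in> A. p a \<in> p ` \<alpha> ` U}} = {e \<in> space M. p (\<alpha> e) \<in> (\<lambda>e. p (\<alpha> e)) ` U}"
      by (auto simp: A_def image_image)
    ultimately show "{e \<in> space M. p (\<alpha> e) \<in> (\<lambda>e. p (\<alpha> e)) ` U} \<in> sets M"
      by (simp add: borel_vertices_def)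
  qed
  have "p a \<in> A \<and> (p a, a) \<in> adj ^^ (2 * R)" if "a \<in> A" for a
    using 1[OF that] by (simp add: q_def)
  moreover have "p x = p a" if "a \<in> A" "(p a, x) \<in> adj ^^ R" for a x
    using 2[OF p(1)[OF that(1)] that(2)] .
  ultimately show thesis using 3 b_pre sat by (rule that)
qed

end

section \<open>Matchings in expanding graphs\<close>

text \<open>
  \<open>R\<close> is the radius up to which a ball around a centre is contained in its cell.
\<close>

locale cells = half_edges M L \<alpha> \<beta>
  for M :: "'e measure" and L and \<alpha> :: "'e \<Rightarrow> 'a" and \<beta> :: "'e \<Rightarrow> 'b" +
  fixes p :: "'a \<Rightarrow> 'a" and d :: "'a \<Rightarrow> nat" and R :: nat
  assumes p_near: "a \<in> A \<Longrightarrow> p a \<in> A \<and> (p a, a) \<in> adj ^^ (2 * R)"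
    and p_ball: "\<lbrakk>a \<in> A; (p a, x) \<in> adj ^^ R\<rbrakk> \<Longrightarrow> p x = p a"
    and p_parent: "a \<in> A \<Longrightarrow> a = p a \<or> (\<exists>a'. (a, a') \<in> adj \<and> p a' = p a \<and> d a' < d a)"
begin

definition cell :: "'a \<Rightarrow> 'a set" where
  "cell z = {a \<in> A. p a = z}"

text \<open>
  A \<open>\<beta>\<close>-vertex with a single edge counts as internal to the cell of that edge.
\<close>

definition internal :: "'a \<Rightarrow> 'b set" where
  "internal z = {b \<in> \<beta> ` space M. \<forall>e \<in> space M. \<beta> e = b \<longrightarrow> p (\<alpha> e) = z}"

definition boundary :: "'e set" where
  "boundary = {e \<in> space M. \<exists>e'\<in>space M. \<beta> e' = \<beta> e \<and> p (\<alpha> e') \<noteq> p (\<alpha> e)}"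

lemma \<alpha>_in_A: "e \<in> space M \<Longrightarrow> \<alpha> e \<in> A"
  by (simp add: A_def)

lemma finite_cell: "finite (cell z)"
proof (rule finite_subset)
  show "cell z \<subseteq> (adj ^^ (2 * R)) `` {z}" using p_near by (auto simp: cell_def)
qed (rule pow_Image_finite, simp)

text \<open>
  On the side of the partition that lacks the centre, take a vertex of least rank: the next vertex on
  its way to the centre lies on the other side.
\<close>

lemma cell_crossing:
  assumes "S \<subseteq> cell z" and "S \<noteq> {}" and "S \<noteq> cell z"
  shows "\<exists>a\<in>S. \<exists>a'\<in>cell z - S. (a, a') \<in> adj"
proof -
  define T where "T = (if z \<in> S then cell z - S else S)"
  have T: "T \<subseteq> cell z" "T \<noteq> {}" "z \<notin> T" using assms by (auto simp: T_def)
  then obtain a where a: "a \<in> T" "\<And>x. x \<in> T \<Longrightarrow> d a \<le> d x"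
    using ex_has_least_nat[of "\<lambda>x. x \<in> T" _ d] by blast
  have "a \<in> A" "p a = z" "a \<noteq> z" using a(1) T by (auto simp: cell_def)
  then obtain a' where a': "(a, a') \<in> adj" "p a' = z" "d a' < d a" using p_parent[of a] by auto
  then have "a' \<in> cell z" using adj_in_A by (auto simp: cell_def)
  moreover have "a' \<notin> T" using a(2) a'(3) by (meson not_le)
  ultimately show ?thesis
    using a a' T(1) assms(1) adj_sym[OF a'(1)] by (cases "z \<in> S") (auto simp: T_def)
qed

text \<open>
  In a connected cell a proper subset touches at least as many internal edges as it has vertices.
  Removing from \<open>S\<close> a vertex with a neighbour in \<open>cell z - S\<close> also removes the edge between them from
  the internal edges touched by \<open>S\<close>, because that edge has no third endpoint.
\<close>

lemma card_le_internal_nbrs: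
  assumes "S \<subseteq> cell z" and "S \<noteq> cell z"
  shows "card S \<le> card (nbrs S \<inter> internal z)"
  using assms
proof (induction "card S" arbitrary: S)
  case (Suc n)
  then obtain a a' where a: "a \<in> S" "a' \<in> cell z - S" "(a, a') \<in> adj"
    using cell_crossing[of S z] by (metis card.empty nat.distinct(1))
  have fS: "finite S" using Suc.prems finite_cell finite_subset by blast
  obtain e e' where e: "e \<in> space M" "e' \<in> space M" "\<alpha> e = a" "\<alpha> e' = a'" "\<beta> e' = \<beta> e"
    using a(3) unfolding adj_def by auto
  have "e \<noteq> e'" using e a by auto
  then have "card {e, e'} = 2" by simp
  moreover have "{e, e'} \<subseteq> {x \<in> space M. \<beta> x = \<beta> e}" using e by auto
  ultimately have fib: "{x \<in> space M. \<beta> x = \<beta> e} = {e, e'}"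
    using two[of "\<beta> e"] finite_fibre(2) by (metis card_seteq)
  have "p a = z" "p a' = z" using a Suc.prems by (auto simp: cell_def)
  then have int: "\<beta> e \<in> internal z" using fib e unfolding internal_def by auto
  let ?S = "S - {a}"
  have "\<beta> e \<notin> nbrs ?S"
  proof
    assume "\<beta> e \<in> nbrs ?S"
    then obtain x where x: "x \<in> space M" "\<alpha> x \<in> ?S" "\<beta> x = \<beta> e" by (auto simp: nbrs_def)
    then have "x \<in> {e, e'}" unfolding fib[symmetric] by simp
    then show False using x(2) e a by auto
  qed
  moreover have fin: "finite (nbrs S)" using finite_nbrs[OF fS] .
  moreover have sub: "nbrs ?S \<subseteq> nbrs S" "\<beta> e \<in> nbrs S" using e a by (auto simp: nbrs_def)
  ultimately have "Suc (card (nbrs ?S \<inter> internal z)) = card (insert (\<beta> e) (nbrs ?S \<inter> internal z))"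
    by (subst card_insert_disjoint) (auto intro: finite_subset)
  also have "\<dots> \<le> card (nbrs S \<inter> internal z)"
    using sub int fin by (intro card_mono) auto
  finally have le: "Suc (card (nbrs ?S \<inter> internal z)) \<le> card (nbrs S \<inter> internal z)" .
  have "card ?S = n" using Suc.hyps(2) a(1) fS by simp
  then have "card ?S \<le> card (nbrs ?S \<inter> internal z)"
    using Suc.prems a by (intro Suc.hyps(1)) auto
  then show ?case using le \<open>card ?S = n\<close> Suc.hyps(2) by linarith
qed simp

lemma nbrs_cell: "nbrs (cell z) \<subseteq> internal z \<union> \<beta> ` {e \<in> boundary. p (\<alpha> e) = z}"
proof
  fix b assume "b \<in> nbrs (cell z)"
  then obtain e where e: "e \<in> space M" "p (\<alpha> e) = z" "b = \<beta> e" by (auto simp: nbrs_def cell_def)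
  show "b \<in> internal z \<union> \<beta> ` {e \<in> boundary. p (\<alpha> e) = z}"
  proof (cases "e \<in> boundary")
    case False
    then have "b \<in> internal z" using e unfolding internal_def boundary_def by auto
    then show ?thesis by blast
  qed (use e in auto)
qed

text \<open>
  If the balls around the centre stop growing at a radius below \<open>R\<close>, the cell is a whole component and
  all its edges are internal; otherwise they gain a vertex in every step up to \<open>R\<close>.
\<close>

lemma large_cell_or_expanding_internally:
  assumes z: "z \<in> A" "p z = z"
    and exp: "real (card (cell z)) \<le> real (card (nbrs (cell z)))"
  shows "Suc R \<le> card (cell z) \<or> card (cell z) \<le> card (nbrs (cell z) \<inter> internal z)"
proof (cases "\<exists>r<R. (adj ^^ Suc r) `` {z} \<subseteq> (adj ^^ r) `` {z}")
  case True
  then obtain r where r: "r < R" "(adj ^^ Suc r) `` {z} \<subseteq> (adj ^^ r) `` {z}" by blast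
  let ?T = "(adj ^^ r) `` {z}"
  have closed: "adj `` ?T \<subseteq> ?T" using r(2) unfolding pow_Suc_Image .
  have "(adj ^^ k) `` {z} \<subseteq> ?T" for k
  proof (induction k)
    case 0
    have "(z, z) \<in> adj ^^ r" using pow_mono[of z z 0 r] z by auto
    then show ?case by auto
  next
    case (Suc k)
    then show ?case unfolding pow_Suc_Image using closed by blast
  qed
  then have "cell z \<subseteq> ?T" using p_near by (fastforce simp: cell_def)
  moreover have "?T \<subseteq> cell z"
  proof
    fix x assume "x \<in> ?T"
    then have x: "(z, x) \<in> adj ^^ r" by simp
    then have "(p z, x) \<in> adj ^^ R" using r(1) z by (auto intro: pow_mono)
    then show "x \<in> cell z" using p_ball[OF z(1)] z x pow_in_A by (auto simp: cell_def)
  qed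
  ultimately have T: "cell z = ?T" by blast
  have "nbrs (cell z) \<subseteq> internal z"
  proof
    fix b assume "b \<in> nbrs (cell z)"
    then obtain e where e: "e \<in> space M" "\<alpha> e \<in> cell z" "b = \<beta> e" by (auto simp: nbrs_def)
    have "p (\<alpha> e') = z" if "e' \<in> space M" "\<beta> e' = \<beta> e" for e'
    proof -
      have "(\<alpha> e, \<alpha> e') \<in> adj" using adjI e(1) that by simp
      then have "\<alpha> e' \<in> cell z" using e(2) closed unfolding T by blast
      then show ?thesis by (simp add: cell_def)
    qed
    then show "b \<in> internal z" using e unfolding internal_def by auto
  qed
  then have "nbrs (cell z) \<inter> internal z = nbrs (cell z)" by blast
  then show ?thesis using exp by simp
next
  case False
  have "Suc r \<le> card ((adj ^^ r) `` {z})" if "r \<le> R" for r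
    using that
  proof (induction r)
    case (Suc r)
    have "(adj ^^ r) `` {z} \<subseteq> (adj ^^ Suc r) `` {z}" using z by (auto intro: pow_mono simp del: relpow.simps)
    moreover have "\<not> (adj ^^ Suc r) `` {z} \<subseteq> (adj ^^ r) `` {z}" using False Suc.prems by auto
    ultimately have "(adj ^^ r) `` {z} \<subset> (adj ^^ Suc r) `` {z}" by blast
    then have "card ((adj ^^ r) `` {z}) < card ((adj ^^ Suc r) `` {z})"
      by (intro psubset_card_mono pow_Image_finite) auto
    then show ?case using Suc by linarith
  qed simp
  then have "Suc R \<le> card ((adj ^^ R) `` {z})" by blast
  also have "\<dots> \<le> card (cell z)"
  proof (intro card_mono finite_cell subsetI)
    fix x assume "x \<in> (adj ^^ R) `` {z}"
    then show "x \<in> cell z" using p_ball[OF z(1)] z pow_in_A by (auto simp: cell_def)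
  qed
  finally show ?thesis by blast
qed

lemma centre_fixed: "a \<in> A \<Longrightarrow> p (p a) = p a"
  using p_ball[of a "p a"] pow_mono[of "p a" "p a" 0 R] p_near by auto

text \<open>
  A common-neighbour step between centres passes through three cells, each of radius at most \<open>2 * R\<close>: twice
  from a centre out to a cell boundary, across it, and back to a centre.
\<close>

lemma two_step_near:
  assumes "(z, z') \<in> two_step (space M) (\<lambda>e. p (\<alpha> e)) \<beta>"
  shows "(z, z') \<in> adj ^^ (8 * R + 2)"
proof -
  obtain e1 e2 e3 e4 where e: "e1 \<in> space M" "e2 \<in> space M" "e3 \<in> space M" "e4 \<in> space M"
    "p (\<alpha> e1) = z" "\<beta> e1 = \<beta> e2" "p (\<alpha> e2) = p (\<alpha> e3)" "\<beta> e3 = \<beta> e4" "p (\<alpha> e4) = z'"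
    using assms unfolding two_step_def by blast
  have near: "(p (\<alpha> e), \<alpha> e) \<in> adj ^^ (2 * R)" "(\<alpha> e, p (\<alpha> e)) \<in> adj ^^ (2 * R)" if "e \<in> space M" for e
    using p_near[OF \<alpha>_in_A[OF that]] pow_sym by blast+
  have one: "(\<alpha> e1, \<alpha> e2) \<in> adj ^^ 1" "(\<alpha> e3, \<alpha> e4) \<in> adj ^^ 1" using e adjI by auto
  have "(z, p (\<alpha> e2)) \<in> adj ^^ (2 * R + 1 + 2 * R)"
    using pow_trans[OF pow_trans[OF near(1)[OF e(1)] one(1)] near(2)[OF e(2)]] e(5) by simp
  moreover have "(p (\<alpha> e2), z') \<in> adj ^^ (2 * R + 1 + 2 * R)"
    using pow_trans[OF pow_trans[OF near(1)[OF e(3)] one(2)] near(2)[OF e(4)]] e(7,9) by simp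
  ultimately have "(z, z') \<in> adj ^^ ((2 * R + 1 + 2 * R) + (2 * R + 1 + 2 * R))" by (rule pow_trans)
  moreover have "(2 * R + 1 + 2 * R) + (2 * R + 1 + 2 * R) = 8 * R + 2" by simp
  ultimately show ?thesis by simp
qed

text \<open>
  Two edges lie in different cells iff the saturation of some \<open>L m\<close> separates them.
\<close>

lemma boundary_sets:
  assumes "borel_saturations M (\<lambda>e. p (\<alpha> e))"
  shows "boundary \<in> sets M"
proof -
  define V where "V m = {e \<in> space M. p (\<alpha> e) \<in> (\<lambda>e. p (\<alpha> e)) ` L m}" for m
  have V: "V m \<in> sets M" for m
    unfolding V_def using borel_saturationsD(2)[OF assms cut_sets] .
  have fin: "finite {e \<in> space M. p (\<alpha> e) = z}" for z using borel_saturationsD(1)[OF assms] .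
  have "boundary = (\<Union>m. V m \<inter> {e \<in> space M. \<beta> e \<in> \<beta> ` (space M - V m)})"
  proof (intro equalityI subsetI)
    fix e assume "e \<in> boundary"
    then obtain e' where e: "e \<in> space M" "e' \<in> space M" "\<beta> e' = \<beta> e" "p (\<alpha> e') \<noteq> p (\<alpha> e)"
      by (auto simp: boundary_def)
    let ?C = "{x \<in> space M. p (\<alpha> x) = p (\<alpha> e)} \<union> {x \<in> space M. p (\<alpha> x) = p (\<alpha> e')}"
    obtain m where m: "L m \<inter> ?C = {x \<in> space M. p (\<alpha> x) = p (\<alpha> e)}"
      using cut_finite[of ?C "{x \<in> space M. p (\<alpha> x) = p (\<alpha> e)}"] fin by auto
    have "e \<in> L m" using m e(1) by blast
    then have "e \<in> V m" using e by (auto simp: V_def)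
    moreover have "e' \<notin> V m"
    proof
      assume "e' \<in> V m"
      then obtain x where x: "x \<in> L m" "p (\<alpha> x) = p (\<alpha> e')" by (auto simp: V_def)
      then have "x \<in> L m \<inter> ?C" using L_space by auto
      then show False using m x(2) e(4) by auto
    qed
    ultimately have "e \<in> V m \<inter> {e \<in> space M. \<beta> e \<in> \<beta> ` (space M - V m)}"
      using e by (auto intro!: rev_image_eqI[of e'])
    then show "e \<in> (\<Union>m. V m \<inter> {e \<in> space M. \<beta> e \<in> \<beta> ` (space M - V m)})" by blast
  next
    fix e assume "e \<in> (\<Union>m. V m \<inter> {e \<in> space M. \<beta> e \<in> \<beta> ` (space M - V m)})"
    then obtain m e' where e: "e \<in> V m" "e \<in> space M" "e' \<in> space M" "e' \<notin> V m" "\<beta> e = \<beta> e'" by auto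
    then have "p (\<alpha> e') \<noteq> p (\<alpha> e)" by (auto simp: V_def)
    then show "e \<in> boundary" using e by (auto simp: boundary_def intro!: bexI[of _ e'])
  qed
  also have "\<dots> \<in> sets M"
    by (intro sets.countable_UN'' countableI_type sets.Int borel_saturationsD(2)[OF sat_\<beta>] sets.Diff sets.top V)
  finally show ?thesis .
qed

text \<open>
  Let a matching use internal edges and the edges in \<open>N\<close>. The
  components of this graph stay inside cells, and Hall's condition can be checked cell by cell. It holds
  for proper subsets of a cell by connectedness. For a whole cell connectedness falls short by at most
  one, and an edge in \<open>N\<close>, or the assumption on cells without one, makes up for it.
\<close>

lemma matching_from_owned_boundary:
  assumes sat: "borel_saturations M (\<lambda>e. p (\<alpha> e))"
    and N: "N \<in> sets M" "N \<subseteq> boundary" "inj_on \<beta> N"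
    and owned: "\<And>z. z \<in> p ` A \<Longrightarrow> z \<notin> (\<lambda>e. p (\<alpha> e)) ` N \<Longrightarrow> card (cell z) \<le> card (nbrs (cell z) \<inter> internal z)"
  shows "\<exists>N' \<in> sets M. \<alpha> ` N' = A \<and> inj_on \<alpha> N' \<and> inj_on \<beta> N'"
proof -
  define F where "F = (space M - boundary) \<union> N"
  have F: "F \<in> sets M" unfolding F_def using boundary_sets[OF sat] N(1) by auto
  have FM: "F \<subseteq> space M" using F sets.sets_into_space by blast
  have b_eq: "p (\<alpha> e) = p (\<alpha> e')" if "e \<in> space M" "e' \<in> space M" "\<beta> e = \<beta> e'" "e \<notin> boundary" for e e'
  proof (rule ccontr)
    assume "p (\<alpha> e) \<noteq> p (\<alpha> e')"
    then have "e \<in> boundary" unfolding boundary_def using that(1-3) by (intro CollectI conjI bexI[of _ e']) auto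
    then show False using that(4) by contradiction
  qed
  have same: "p (\<alpha> e) = p (\<alpha> e')" if adj: "(e, e') \<in> edge_adjacency \<alpha> \<beta> F" for e e'
  proof -
    have e: "e \<in> F" "e' \<in> F" "\<alpha> e = \<alpha> e' \<or> \<beta> e = \<beta> e'" using adj by (auto simp: edge_adjacency_def)
    show ?thesis
    proof (cases "\<alpha> e = \<alpha> e'")
      case False
      then have b: "\<beta> e = \<beta> e'" using e(3) by blast
      consider "e \<notin> boundary" | "e' \<notin> boundary" | "e \<in> N" "e' \<in> N" using e(1,2) by (auto simp: F_def)
      then show ?thesis
      proof cases
        case 1 then show ?thesis using b_eq[of e e'] b e FM by (metis subsetD)
      next
        case 2 then show ?thesis using b_eq[of e' e] b e FM by (metis subsetD)
      next
        case 3 then show ?thesis using b N(3) by (auto dest: inj_onD)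
      qed
    qed simp
  qed
  \<comment> \<open>The \<open>\<beta>\<close>-vertices that \<open>S \<inter> cell z\<close> may use; those of different cells are disjoint.\<close>
  define G where "G S z = (nbrs (S \<inter> cell z) \<inter> internal z) \<union> \<beta> ` {e \<in> N. \<alpha> e \<in> S \<inter> cell z}" for S z
  have NM: "N \<subseteq> space M" using N(1) sets.sets_into_space by blast
  have finG: "finite (G S z)" for S z
  proof -
    have f: "finite (nbrs (S \<inter> cell z))" by (intro finite_nbrs finite_Int disjI2 finite_cell)
    have "G S z \<subseteq> nbrs (S \<inter> cell z)" using NM by (auto simp: G_def nbrs_def)
    then show ?thesis using f finite_subset by blast
  qed
  have N_int: "\<beta> e \<notin> internal z" if "e \<in> N" for e z
  proof
    assume int: "\<beta> e \<in> internal z"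
    obtain e' where "e \<in> space M" "e' \<in> space M" "\<beta> e' = \<beta> e" "p (\<alpha> e') \<noteq> p (\<alpha> e)"
      using subsetD[OF N(2) \<open>e \<in> N\<close>] unfolding boundary_def by blast
    then show False using int by (auto simp: internal_def)
  qed
  have G_card: "card (S \<inter> cell z) \<le> card (G S z)" if z: "z \<in> p ` A" for S z
  proof -
    have fn: "finite (nbrs (S \<inter> cell z))" by (intro finite_nbrs finite_Int disjI2 finite_cell)
    have le: "card (nbrs (S \<inter> cell z) \<inter> internal z) \<le> card (G S z)"
      by (intro card_mono finG) (auto simp: G_def)
    show ?thesis
    proof (cases "S \<inter> cell z = cell z")
      case False
      then have "card (S \<inter> cell z) \<le> card (nbrs (S \<inter> cell z) \<inter> internal z)"
        by (intro card_le_internal_nbrs) auto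
      then show ?thesis using le by linarith
    next
      case True
      show ?thesis
      proof (cases "z \<in> (\<lambda>e. p (\<alpha> e)) ` N")
        case True': True
        then obtain e where e: "e \<in> N" "p (\<alpha> e) = z" by blast
        then have ea: "\<alpha> e \<in> cell z" using NM \<alpha>_in_A by (auto simp: cell_def)
        let ?S = "cell z - {\<alpha> e}"
        have "card (cell z) = Suc (card ?S)"
          using ea finite_cell by (metis card.remove)
        also have "card ?S \<le> card (nbrs ?S \<inter> internal z)"
          using ea by (intro card_le_internal_nbrs) auto
        also have "\<dots> \<le> card (nbrs (cell z) \<inter> internal z)"
          using True fn by (intro card_mono) (auto simp: nbrs_def)
        finally have "card (cell z) \<le> Suc (card (nbrs (cell z) \<inter> internal z))" by simp
        also have "\<dots> = card (insert (\<beta> e) (nbrs (cell z) \<inter> internal z))"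
          using N_int[OF e(1)] fn True by simp
        also have "\<dots> \<le> card (G S z)"
        proof (intro card_mono finG)
          show "insert (\<beta> e) (nbrs (cell z) \<inter> internal z) \<subseteq> G S z"
            unfolding G_def True using e(1) ea by blast
        qed
        finally show ?thesis using True by simp
      next
        case False
        then show ?thesis using owned[OF z False] le True by simp
      qed
    qed
  qed
  have G_disj: "G S z \<inter> G S z' = {}" if "z \<noteq> z'" for S z z'
  proof -
    have 1: "internal z \<inter> internal z' = {}" using that by (auto simp: internal_def)
    have 2: "\<beta> ` {e \<in> N. \<alpha> e \<in> S \<inter> cell z} \<inter> \<beta> ` {e \<in> N. \<alpha> e \<in> S \<inter> cell z'} = {}"
    proof (rule ccontr)
      assume "\<not> ?thesis"
      then obtain e e' where "e \<in> N" "e' \<in> N" "\<alpha> e \<in> cell z" "\<alpha> e' \<in> cell z'" "\<beta> e = \<beta> e'" by auto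
      then have "e = e'" using N(3) by (auto dest: inj_onD)
      then show False using \<open>\<alpha> e \<in> cell z\<close> \<open>\<alpha> e' \<in> cell z'\<close> that by (auto simp: cell_def)
    qed
    show ?thesis unfolding G_def using 1 2 N_int by blast
  qed
  have hall: "card S \<le> card (\<beta> ` {e \<in> F. \<alpha> e \<in> S})" if S: "finite S" "S \<subseteq> A" for S
  proof -
    have "card S \<le> card (\<Union>z\<in>p ` S. S \<inter> cell z)"
      using S by (intro card_mono) (auto simp: cell_def)
    also have "\<dots> \<le> (\<Sum>z\<in>p ` S. card (S \<inter> cell z))"
      using S(1) by (intro card_UN_le) auto
    also have "\<dots> \<le> (\<Sum>z\<in>p ` S. card (G S z))"
      using S(2) by (intro sum_mono G_card) auto
    also have "\<dots> = card (\<Union>z\<in>p ` S. G S z)"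
      using S(1) finG G_disj by (intro card_UN_disjoint[symmetric]) auto
    also have "\<dots> \<le> card (\<beta> ` {e \<in> F. \<alpha> e \<in> S})"
    proof (intro card_mono UN_least)
      have "{e \<in> F. \<alpha> e \<in> S} \<subseteq> (\<Union>a\<in>S. {e \<in> space M. \<alpha> e = a})" using FM by auto
      then have "finite {e \<in> F. \<alpha> e \<in> S}" by (rule finite_subset) (use S(1) finite_fibre in auto)
      then show "finite (\<beta> ` {e \<in> F. \<alpha> e \<in> S})" by simp
    next
      fix z
      have "nbrs (S \<inter> cell z) \<inter> internal z \<subseteq> \<beta> ` {e \<in> F. \<alpha> e \<in> S}"
      proof
        fix b assume b: "b \<in> nbrs (S \<inter> cell z) \<inter> internal z"
        then obtain e where e: "e \<in> space M" "\<alpha> e \<in> S" "\<beta> e = b" by (auto simp: nbrs_def)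
        then have "e \<notin> boundary" using b by (auto simp: internal_def boundary_def)
        then show "b \<in> \<beta> ` {e \<in> F. \<alpha> e \<in> S}" using e by (auto simp: F_def)
      qed
      moreover have "\<beta> ` {e \<in> N. \<alpha> e \<in> S \<inter> cell z} \<subseteq> \<beta> ` {e \<in> F. \<alpha> e \<in> S}" by (auto simp: F_def)
      ultimately show "G S z \<subseteq> \<beta> ` {e \<in> F. \<alpha> e \<in> S}" unfolding G_def by (rule Un_least)
    qed
    finally show ?thesis .
  qed
  have \<alpha>F: "\<alpha> ` F = A"
  proof
    show "\<alpha> ` F \<subseteq> A" using FM \<alpha>_in_A by auto
    show "A \<subseteq> \<alpha> ` F"
    proof
      fix a assume "a \<in> A"
      then have "card {a} \<le> card (\<beta> ` {e \<in> F. \<alpha> e \<in> {a}})" by (intro hall) auto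
      then have "{e \<in> F. \<alpha> e \<in> {a}} \<noteq> {}" by (metis card.empty card_0_eq finite.emptyI finite.insertI image_empty insert_not_empty le_zero_eq)
      then show "a \<in> \<alpha> ` F" by auto
    qed
  qed
  have "\<exists>N' \<in> sets M. N' \<subseteq> F \<and> \<alpha> ` N' = \<alpha> ` F \<and> inj_on \<alpha> N' \<and> inj_on \<beta> N'"
  proof (rule finite_component_matching[OF sat_\<alpha> sat_\<beta> F])
    fix e assume e: "e \<in> F"
    have comp: "p (\<alpha> e') = p (\<alpha> e) \<and> e' \<in> F" if "(e, e') \<in> (edge_adjacency \<alpha> \<beta> F)\<^sup>*" for e'
      using that
    proof (induction)
      case (step x y)
      then show ?case using same[of x y] by (auto simp: edge_adjacency_def)
    qed (use e in auto)
    have "(edge_adjacency \<alpha> \<beta> F)\<^sup>* `` {e} \<subseteq> {e' \<in> space M. p (\<alpha> e') = p (\<alpha> e)}"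
    proof
      fix e' assume "e' \<in> (edge_adjacency \<alpha> \<beta> F)\<^sup>* `` {e}"
      then have "p (\<alpha> e') = p (\<alpha> e) \<and> e' \<in> F" by (intro comp) (rule Image_singleton_iff[THEN iffD1])
      then show "e' \<in> {e' \<in> space M. p (\<alpha> e') = p (\<alpha> e)}" using FM by blast
    qed
    then show "finite ((edge_adjacency \<alpha> \<beta> F)\<^sup>* `` {e})"
      by (rule finite_subset) (rule borel_saturationsD(1)[OF sat])
  next
    show "card S \<le> card (\<beta> ` {e \<in> F. \<alpha> e \<in> S})" if "finite S" "S \<subseteq> \<alpha> ` F" for S
      using hall[OF that(1)] that(2) unfolding \<alpha>F .
  qed
  then show ?thesis unfolding \<alpha>F by blast
qed

end

context half_edges
begin

text \<open>
  A cell with at least \<open>R\<close> vertices and fewer internal edges than vertices has more than \<open>(c - 1) * R\<close>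
  boundary edges. For large \<open>R\<close> this exceeds the degree that is needed to let all such cells, viewed as
  vertices of the contracted graph, choose distinct boundary edges.
\<close>

theorem expanding_matching:
  fixes c :: real
  assumes c: "c > 1"
    and exp: "\<And>S. \<lbrakk>finite S; S \<subseteq> A\<rbrakk> \<Longrightarrow> c * real (card S) \<le> real (card (nbrs S))"
    and asi: "\<And>k. \<exists>X :: nat \<Rightarrow> 'a set. (\<forall>i<n. borel_vertices (X i) \<and>
        (\<forall>z\<in>X i. finite ((adj ^^ k \<inter> X i \<times> X i)\<^sup>* `` {z}))) \<and> A \<subseteq> (\<Union>i<n. X i)"
  shows "\<exists>N \<in> sets M. \<alpha> ` N = A \<and> inj_on \<alpha> N \<and> inj_on \<beta> N"
proof -
  obtain R :: nat where R: "2 ^ Suc n / (c - 1) < real R" using reals_Archimedean2 by blast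
  obtain p d where pd: "\<And>a. a \<in> A \<Longrightarrow> p a \<in> A \<and> (p a, a) \<in> adj ^^ (2 * R)"
    "\<And>a x. \<lbrakk>a \<in> A; (p a, x) \<in> adj ^^ R\<rbrakk> \<Longrightarrow> p x = p a"
    "\<And>a. a \<in> A \<Longrightarrow> a = p a \<or> (\<exists>a'. (a, a') \<in> adj \<and> p a' = p a \<and> (d a' :: nat) < d a)"
    and pre: "\<And>T. borel_vertices T \<Longrightarrow> borel_vertices {a \<in> A. p a \<in> T}"
    and sat: "borel_saturations M (\<lambda>e. p (\<alpha> e))"
    by (rule exists_cells[of R]) (rule that, assumption+)
  interpret cells M L \<alpha> \<beta> p d R
    by unfold_locales (fact pd)+
  obtain X :: "nat \<Rightarrow> 'a set" where X: "\<forall>i<n. borel_vertices (X i) \<and>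
        (\<forall>z\<in>X i. finite ((adj ^^ (8 * R + 2) \<inter> X i \<times> X i)\<^sup>* `` {z}))" "A \<subseteq> (\<Union>i<n. X i)"
    using asi[of "8 * R + 2"] by (elim exE conjE) (rule that)
  let ?\<alpha> = "\<lambda>e. p (\<alpha> e)"
  have bM: "boundary \<in> sets M" by (rule boundary_sets[OF sat])
  \<comment> \<open>Selecting cells by boundary degree rather than by lack of inner edges keeps \<open>Y\<close> visibly Borel.\<close>
  define Y where "Y = {z \<in> p ` A. 2 ^ Suc n \<le> card (\<beta> ` {e \<in> boundary. p (\<alpha> e) = z})}"
  have "\<exists>N \<in> sets M. N \<subseteq> boundary \<and> ?\<alpha> ` N = Y \<and> inj_on ?\<alpha> N \<and> inj_on \<beta> N"
  proof (rule matching_of_high_degree_vertices[where n = n and X = X, OF sat sat_\<beta> two _ _ bM])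
    fix i assume i: "i < n"
    have "{e \<in> space M. p (\<alpha> e) \<in> X i} = {e \<in> space M. \<alpha> e \<in> {a \<in> A. p a \<in> X i}}"
      using \<alpha>_in_A by auto
    also have "\<dots> \<in> sets M" using pre X(1) i unfolding borel_vertices_def by blast
    finally show "{e \<in> space M. p (\<alpha> e) \<in> X i} \<in> sets M" .
    fix z assume z: "z \<in> X i"
    have "two_step (space M) ?\<alpha> \<beta> \<inter> X i \<times> X i \<subseteq> adj ^^ (8 * R + 2) \<inter> X i \<times> X i"
      using two_step_near by auto
    then have "(two_step (space M) ?\<alpha> \<beta> \<inter> X i \<times> X i)\<^sup>* `` {z} \<subseteq> (adj ^^ (8 * R + 2) \<inter> X i \<times> X i)\<^sup>* `` {z}"
      by (intro Image_mono rtrancl_mono) auto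
    then show "finite ((two_step (space M) ?\<alpha> \<beta> \<inter> X i \<times> X i)\<^sup>* `` {z})"
      by (rule finite_subset) (use X(1) i z in auto)
  next
    have "{e \<in> space M. p (\<alpha> e) \<in> Y} = {e \<in> space M. 2 ^ Suc n \<le> card (\<beta> ` {e' \<in> boundary. p (\<alpha> e') = p (\<alpha> e)})}"
      using \<alpha>_in_A by (auto simp: Y_def)
    then show "{e \<in> space M. p (\<alpha> e) \<in> Y} \<in> sets M"
      using at_least_sets[OF sat sat_\<beta> bM, of "2 ^ Suc n"] by simp
  next
    have "p ` A \<subseteq> A" using p_near by auto
    then show "Y \<subseteq> (\<Union>i<n. X i)" using X(2) by (auto simp: Y_def)
  qed (simp add: Y_def)
  then obtain N where N: "N \<in> sets M" "N \<subseteq> boundary" "?\<alpha> ` N = Y" "inj_on \<beta> N"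
    by (elim bexE conjE) (rule that)
  show ?thesis
  proof (rule matching_from_owned_boundary[OF sat N(1,2,4)])
    fix z assume z: "z \<in> p ` A" "z \<notin> ?\<alpha> ` N"
    have few: "card (\<beta> ` {e \<in> boundary. p (\<alpha> e) = z}) < 2 ^ Suc n"
      using z N(3) by (auto simp: Y_def)
    have zA: "z \<in> A" "p z = z" using z(1) p_near centre_fixed by auto
    have ex: "c * real (card (cell z)) \<le> real (card (nbrs (cell z)))"
      by (intro exp finite_cell) (auto simp: cell_def)
    have "real (card (cell z)) \<le> c * real (card (cell z))" using c by (simp add: mult_le_cancel_right1)
    then have "real (card (cell z)) \<le> real (card (nbrs (cell z)))" using ex by linarith
    from large_cell_or_expanding_internally[OF zA this]
    show "card (cell z) \<le> card (nbrs (cell z) \<inter> internal z)"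
    proof
      assume "Suc R \<le> card (cell z)"
      then have "(c - 1) * real R \<le> (c - 1) * real (card (cell z))" using c by (intro mult_left_mono) auto
      moreover have "2 ^ Suc n < (c - 1) * real R" using R c by (simp add: field_simps)
      moreover have "real (card (nbrs (cell z))) \<le> real (card (nbrs (cell z) \<inter> internal z))
          + real (card (\<beta> ` {e \<in> boundary. p (\<alpha> e) = z}))"
      proof -
        have fb: "finite (\<beta> ` {e \<in> boundary. p (\<alpha> e) = z})"
          by (rule finite_imageI, rule finite_subset[OF _ borel_saturationsD(1)[OF sat, of z]])
            (auto simp: boundary_def)
        have "card (nbrs (cell z)) \<le> card ((nbrs (cell z) \<inter> internal z) \<union> \<beta> ` {e \<in> boundary. p (\<alpha> e) = z})"
          using nbrs_cell[of z] fb finite_nbrs[OF finite_cell] by (intro card_mono) auto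
        also have "\<dots> \<le> card (nbrs (cell z) \<inter> internal z) + card (\<beta> ` {e \<in> boundary. p (\<alpha> e) = z})"
          by (rule card_Un_le)
        finally show ?thesis by (simp only: of_nat_add[symmetric] of_nat_le_iff)
      qed
      moreover have "real (card (\<beta> ` {e \<in> boundary. p (\<alpha> e) = z})) < 2 ^ Suc n"
        using less_imp_of_nat_less[OF few, where 'a = real] by (simp only: of_nat_power of_nat_numeral)
      ultimately have "real (card (cell z)) < real (card (nbrs (cell z) \<inter> internal z))"
        using ex by (simp add: algebra_simps)
      then show ?thesis by simp
    qed
  qed
qed

end

section \<open>Borel graphs\<close>

text \<open>
  Unions of finitely many cylinders in the Baire space cut out every subset of a finite set; they
  are indexed by lists of finite sequences.
\<close>

lemma exists_finite_cuts:
  assumes "standard_borel M"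
  shows "\<exists>L. finite_cuts M L"
proof (cases "space M = {}")
  case True
  then have "finite_cuts M (\<lambda>_. {})" by unfold_locales auto
  then show ?thesis by blast
next
  case False
  obtain \<eta> \<psi> where \<eta>: "\<eta> \<in> borel_measurable M" and \<psi>: "\<And>e. e \<in> space M \<Longrightarrow> \<psi> (\<eta> e :: nat \<Rightarrow> nat) = e"
    using standard_borel_retract_of_baire_space[OF assms False] by blast
  define L where "L n = {e \<in> space M. \<exists>u \<in> set (from_nat n :: nat list list). \<forall>i\<in>{..<length u}. \<eta> e i = u ! i}" for n
  have [measurable]: "(\<lambda>e. \<eta> e i) \<in> measurable M (count_space UNIV)" for i
    using measurable_compose[OF \<eta> measurable_coordinate] .
  have "finite_cuts M L"
  proof
    fix n
    have "{e \<in> space M. \<forall>i\<in>{..<length u}. \<eta> e i = u ! i} \<in> sets M" for u by measurable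
    then show "L n \<in> sets M" unfolding L_def by (intro sets.sets_Collect_finite_Ex) auto
  next
    fix C D assume C: "finite C" "C \<subseteq> space M" "D \<subseteq> C"
    have "\<exists>i. \<eta> x i \<noteq> \<eta> y i" if "x \<in> C" "y \<in> C" "x \<noteq> y" for x y
      using that C(2) \<psi> by (metis ext subsetD)
    then obtain i where i: "\<And>x y. \<lbrakk>x \<in> C; y \<in> C; x \<noteq> y\<rbrakk> \<Longrightarrow> \<eta> x (i x y) \<noteq> \<eta> y (i x y)" by metis
    have "finite (case_prod i ` (C \<times> C))" using C(1) by blast
    then obtain N where "\<forall>j \<in> case_prod i ` (C \<times> C). j < N" unfolding finite_nat_set_iff_bounded by blast
    then have N: "\<And>x y. \<lbrakk>x \<in> C; y \<in> C\<rbrakk> \<Longrightarrow> i x y < N" by auto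
    have "finite D" using C finite_subset by blast
    then obtain xs where xs: "set xs = D" using finite_list by blast
    let ?us = "map (\<lambda>e. map (\<eta> e) [0..<N]) xs"
    have "e \<in> L (to_nat ?us) \<longleftrightarrow> e \<in> D" if e: "e \<in> C" for e
    proof
      assume "e \<in> L (to_nat ?us)"
      then obtain x where x: "x \<in> D" "\<forall>i<N. \<eta> e i = \<eta> x i" by (auto simp: L_def xs)
      then show "e \<in> D" using i[OF e, of x] N[OF e, of x] C(3) by blast
    next
      assume "e \<in> D"
      then show "e \<in> L (to_nat ?us)" using C by (auto simp: L_def xs intro!: bexI[of _ e])
    qed
    then have "L (to_nat ?us) \<inter> C = D" using C(3) by blast
    then show "\<exists>n. L n \<inter> C = D" by blast
  qed
  then show ?thesis by blast
qed

lemma pairs_meeting_sets: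
  assumes C: "C \<in> sets V"
  shows "{S \<in> unordered_pairs (space V). S \<inter> C \<noteq> {}} \<in> sets (pairs_space V)"
proof -
  have CV: "C \<subseteq> space V" using C sets.sets_into_space by blast
  let ?S = "{S \<in> unordered_pairs (space V). S \<inter> C \<noteq> {}}"
  have "{(x, y). (x, y) \<in> space (ordered_pairs_space V) \<and> {x, y} \<in> ?S}
      = {(x, y). x \<noteq> y} \<inter> (C \<times> space V \<union> space V \<times> C)"
    using CV by (auto simp: space_ordered_pairs_space unordered_pairs_def)
  also have "\<dots> \<in> sets (ordered_pairs_space V)"
    unfolding ordered_pairs_space_def sets_restrict_space using C by (intro imageI) auto
  finally show ?thesis unfolding sets_pairs_space by auto
qed

text \<open>
  The endpoint map to one side of the bipartition pulls a Borel set back to the set of edges that meet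
  a Borel subset of that side.
\<close>

lemma endpoint_measurable:
  assumes G: "borel_graph G" and C: "C \<in> sets (verts G)"
    and f: "\<And>e. e \<in> space (edges G) \<Longrightarrow> ends G e \<inter> C = {f e}"
  shows "f \<in> measurable (edges G) (verts G)"
proof (rule measurableI)
  fix e assume "e \<in> space (edges G)"
  then have "f e \<in> C" using f by blast
  then show "f e \<in> space (verts G)" using C sets.sets_into_space by blast
next
  fix U assume U: "U \<in> sets (verts G)"
  have ends: "ends G \<in> measurable (edges G) (pairs_space (verts G))" using G by (simp add: borel_graph_def)
  have up: "ends G e \<in> unordered_pairs (space (verts G))" if "e \<in> space (edges G)" for e
    using measurable_space[OF ends that] by (simp add: space_pairs_space)
  have "f -` U \<inter> space (edges G)
      = ends G -` {S \<in> unordered_pairs (space (verts G)). S \<inter> (U \<inter> C) \<noteq> {}} \<inter> space (edges G)"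
  proof (intro equalityI subsetI)
    fix e assume "e \<in> f -` U \<inter> space (edges G)"
    then have e: "f e \<in> U" "e \<in> space (edges G)" by auto
    then have "f e \<in> ends G e \<inter> (U \<inter> C)" using f[OF e(2)] by blast
    then show "e \<in> ends G -` {S \<in> unordered_pairs (space (verts G)). S \<inter> (U \<inter> C) \<noteq> {}} \<inter> space (edges G)"
      using up[OF e(2)] e(2) by auto
  next
    fix e assume "e \<in> ends G -` {S \<in> unordered_pairs (space (verts G)). S \<inter> (U \<inter> C) \<noteq> {}} \<inter> space (edges G)"
    then obtain x where x: "e \<in> space (edges G)" "x \<in> ends G e \<inter> C" "x \<in> U" by auto
    then show "e \<in> f -` U \<inter> space (edges G)" using f[OF x(1)] by auto
  qed
  also have "\<dots> \<in> sets (edges G)"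
    using U C by (intro measurable_sets[OF ends] pairs_meeting_sets) auto
  finally show "f -` U \<inter> space (edges G) \<in> sets (edges G)" .
qed

lemma borel_saturations_if_finite_to_one:
  assumes M: "standard_borel M" "standard_borel N" and f: "f \<in> measurable M N"
    and fin: "\<And>y. finite {x \<in> space M. f x = y}"
  shows "borel_saturations M f"
  unfolding borel_saturations_def
proof (intro conjI allI ballI fin)
  fix U assume "U \<in> sets M"
  then have "f ` U \<in> sets N" by (rule finite_to_one_image_measurable[OF M f fin])
  then have "f -` (f ` U) \<inter> space M \<in> sets M" by (rule measurable_sets[OF f])
  moreover have "f -` (f ` U) \<inter> space M = {e \<in> space M. f e \<in> f ` U}" by blast
  ultimately show "{e \<in> space M. f e \<in> f ` U} \<in> sets M" by simp
qed

lemma relpow_in_graph_power: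
  assumes "(x, y) \<in> R ^^ k" and "x \<noteq> y"
  shows "(x, y) \<in> graph_power R k"
proof -
  let ?D = "{enat n |n. (x, y) \<in> R ^^ n}"
  have in_D: "enat k \<in> ?D" using assms(1) by blast
  then have "Inf ?D \<in> ?D" by (rule wellorder_InfI)
  then obtain n where n: "Inf ?D = enat n" "(x, y) \<in> R ^^ n" by auto
  then have "n \<noteq> 0" using assms(2) by (intro notI) simp
  then have "0 < graph_dist R x y" unfolding graph_dist_def n(1) by (simp add: zero_enat_def)
  moreover have "graph_dist R x y \<le> enat k" unfolding graph_dist_def using in_D by (rule Inf_lower)
  ultimately show ?thesis by (simp add: graph_power_def)
qed

theorem theorem1p16:
  fixes G :: "('v, 'e) multigraph" and A B :: "'v set"
  assumes "borel_graph G"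
    and "locally_finite G"
    and "borel_bipartition G A B"
    and "combinatorial_expansion G A"
    and "asi G < \<infinity>"
    and "\<forall>y \<in> B. deg G y \<le> 2"
  shows "\<exists>M. borel_matching G M \<and> covers G M A"
proof -
  let ?V = "verts G" and ?E = "edges G" and ?R = "underlying_simple_graph G"
  have std: "standard_borel ?V" "standard_borel ?E" using assms(1) by (auto simp: borel_graph_def)
  have AB: "A \<in> sets ?V" "B \<in> sets ?V" "A \<union> B = space ?V" "A \<inter> B = {}"
    and "\<forall>e \<in> space ?E. \<exists>a \<in> A. \<exists>b \<in> B. ends G e = {a, b}"
    using assms(3) by (auto simp: borel_bipartition_def bipartition_def)
  then obtain \<alpha> \<beta> where \<alpha>\<beta>: "\<And>e. e \<in> space ?E \<Longrightarrow> \<alpha> e \<in> A \<and> \<beta> e \<in> B \<and> ends G e = {\<alpha> e, \<beta> e}"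
    by metis
  have endA: "ends G e \<inter> A = {\<alpha> e}" and endB: "ends G e \<inter> B = {\<beta> e}" if "e \<in> space ?E" for e
    using \<alpha>\<beta>[OF that] AB(4) by auto
  have m\<alpha>: "\<alpha> \<in> measurable ?E ?V" and m\<beta>: "\<beta> \<in> measurable ?E ?V"
    by (rule endpoint_measurable[OF assms(1) AB(1) endA], assumption,
        rule endpoint_measurable[OF assms(1) AB(2) endB], assumption)
  have sub\<alpha>: "{e \<in> space ?E. \<alpha> e = y} \<subseteq> incident_edges G y"
    and sub\<beta>: "{e \<in> space ?E. \<beta> e = y} \<subseteq> incident_edges G y" for y
    using \<alpha>\<beta> by (auto simp: incident_edges_def)
  have fin_inc: "finite (incident_edges G y)" if "y \<in> space ?V" for y
    using assms(2) that by (simp add: locally_finite_def)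
  have fin\<alpha>: "finite {e \<in> space ?E. \<alpha> e = y}" for y
  proof (cases "y \<in> space ?V")
    case False
    then have "{e \<in> space ?E. \<alpha> e = y} = {}" using \<alpha>\<beta> AB(3) by blast
    then show ?thesis by (simp only: finite.emptyI)
  qed (rule finite_subset[OF sub\<alpha> fin_inc])
  have fin\<beta>: "finite {e \<in> space ?E. \<beta> e = y}" for y
  proof (cases "y \<in> space ?V")
    case False
    then have "{e \<in> space ?E. \<beta> e = y} = {}" using \<alpha>\<beta> AB(3) by blast
    then show ?thesis by (simp only: finite.emptyI)
  qed (rule finite_subset[OF sub\<beta> fin_inc])
  obtain L where L: "finite_cuts ?E L" using exists_finite_cuts[OF std(2)] by blast
  interpret H: half_edges ?E L \<alpha> \<beta>
  proof (intro half_edges.intro half_edges_axioms.intro L)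
    show "borel_saturations ?E \<alpha>" "borel_saturations ?E \<beta>"
      by (rule borel_saturations_if_finite_to_one[OF std(2,1)], fact, fact)+
    fix b
    show "card {e \<in> space ?E. \<beta> e = b} \<le> 2"
    proof (cases "b \<in> B")
      case True
      then have "card {e \<in> space ?E. \<beta> e = b} \<le> deg G b"
        unfolding deg_def using AB(3) by (intro card_mono fin_inc sub\<beta>) auto
      then show ?thesis using assms(6) True by fastforce
    next
      case False
      then have "{e \<in> space ?E. \<beta> e = b} = {}" using \<alpha>\<beta> by blast
      then show ?thesis by (metis card.empty zero_le)
    qed
  qed
  obtain c where c: "c > 1"
    "\<And>S. \<lbrakk>S \<subseteq> A; finite S\<rbrakk> \<Longrightarrow> c * real (card S) \<le> real (card (\<Union>x\<in>S. neighbors G x))"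
    using assms(4) unfolding combinatorial_expansion_def by blast
  have nb: "neighbors G x = \<beta> ` {e \<in> space ?E. \<alpha> e = x}" if x: "x \<in> A" for x
  proof (intro equalityI subsetI)
    fix y assume "y \<in> neighbors G x"
    then obtain e where e: "e \<in> space ?E" "ends G e = {x, y}"
      by (auto simp: neighbors_def underlying_simple_graph_def)
    have "\<alpha> e = x" using endA[OF e(1)] e(2) x by auto
    moreover have "\<beta> e = y" using \<alpha>\<beta>[OF e(1)] e(2) \<open>\<alpha> e = x\<close> AB(4) x by (auto simp: doubleton_eq_iff)
    ultimately show "y \<in> \<beta> ` {e \<in> space ?E. \<alpha> e = x}" using e(1) by blast
  next
    fix y assume "y \<in> \<beta> ` {e \<in> space ?E. \<alpha> e = x}"
    then show "y \<in> neighbors G x"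
      using \<alpha>\<beta> by (auto simp: neighbors_def underlying_simple_graph_def)
  qed
  have HA: "H.A = A"
  proof
    show "H.A \<subseteq> A" using \<alpha>\<beta> by (auto simp: H.A_def)
    show "A \<subseteq> H.A"
    proof
      fix x assume x: "x \<in> A"
      have "c * real (card {x}) \<le> real (card (\<Union>x\<in>{x}. neighbors G x))" using x by (intro c(2)) auto
      then have "card (neighbors G x) \<noteq> 0" using c(1) by auto
      then have "neighbors G x \<noteq> {}" by (metis card.empty)
      then show "x \<in> H.A" unfolding nb[OF x] by (auto simp: H.A_def)
    qed
  qed
  have exp: "c * real (card S) \<le> real (card (H.nbrs S))" if "finite S" "S \<subseteq> H.A" for S
  proof -
    have "(\<Union>x\<in>S. neighbors G x) = (\<Union>x\<in>S. \<beta> ` {e \<in> space ?E. \<alpha> e = x})"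
      using nb that(2) unfolding HA by (intro SUP_cong) auto
    also have "\<dots> = H.nbrs S" unfolding H.nbrs_def by blast
    finally have "(\<Union>x\<in>S. neighbors G x) = H.nbrs S" .
    then show ?thesis using c(2)[of S] that unfolding HA by simp
  qed
  obtain s where s: "asi_at_most ?V ?R s"
  proof -
    have "{enat s |s. asi_at_most ?V ?R s} \<noteq> {}"
      using assms(5) unfolding asi_def asi_simple_def by (metis Inf_empty less_irrefl top_enat_def)
    then show thesis using that by blast
  qed
  \<comment> \<open>One step between \<open>A\<close>-vertices is two steps in \<open>G\<close>.\<close>
  have adj2: "H.adj ^^ k \<subseteq> ?R ^^ (2 * k)" for k
  proof (induction k)
    case (Suc k)
    have "(\<alpha> e, \<alpha> e') \<in> ?R O ?R" if "e \<in> space ?E" "e' \<in> space ?E" "\<beta> e = \<beta> e'" for e e'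
    proof
      show "(\<alpha> e, \<beta> e) \<in> ?R" using \<alpha>\<beta> that by (auto simp: underlying_simple_graph_def)
      show "(\<beta> e, \<alpha> e') \<in> ?R" using \<alpha>\<beta>[OF that(2)] that
        by (auto simp: underlying_simple_graph_def insert_commute)
    qed
    then have "H.adj \<subseteq> ?R O ?R" unfolding H.adj_def by blast
    then have "H.adj ^^ Suc k \<subseteq> ?R ^^ (2 * k) O (?R O ?R)"
      unfolding relpow.simps using Suc.IH by (rule relcomp_mono[rotated])
    also have "\<dots> = ?R ^^ (2 * Suc k)" by (simp add: O_assoc)
    finally show ?case .
  qed simp
  have "\<exists>N \<in> sets ?E. \<alpha> ` N = H.A \<and> inj_on \<alpha> N \<and> inj_on \<beta> N"
  proof (rule H.expanding_matching[OF c(1) exp, where n = "Suc s"])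
    fix k
    obtain X where X: "\<And>i. i \<le> s \<Longrightarrow> X i \<in> sets ?V \<and> graph_finite (graph_power ?R (2 * k)) (X i)"
      "(\<Union>i\<le>s. X i) = space ?V"
      using s unfolding asi_at_most_def by blast
    have "H.borel_vertices (X i)" if "i < Suc s" for i
    proof -
      have "\<alpha> -` X i \<inter> space ?E \<in> sets ?E" using X(1)[of i] that by (intro measurable_sets[OF m\<alpha>]) auto
      moreover have "\<alpha> -` X i \<inter> space ?E = {e \<in> space ?E. \<alpha> e \<in> X i}" by blast
      ultimately show ?thesis by (simp add: H.borel_vertices_def)
    qed
    moreover have "finite ((H.adj ^^ k \<inter> X i \<times> X i)\<^sup>* `` {z})" if i: "i < Suc s" and z: "z \<in> X i" for i z
    proof -
      let ?P = "graph_power ?R (2 * k) \<inter> X i \<times> X i"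
      have "H.adj ^^ k \<inter> X i \<times> X i \<subseteq> ?P\<^sup>="
        using adj2[of k] relpow_in_graph_power[of _ _ "2 * k" ?R] by auto
      then have "(H.adj ^^ k \<inter> X i \<times> X i)\<^sup>* \<subseteq> ?P\<^sup>*" by (metis rtrancl_mono rtrancl_reflcl)
      then have "(H.adj ^^ k \<inter> X i \<times> X i)\<^sup>* `` {z} \<subseteq> component_in (graph_power ?R (2 * k)) (X i) z"
        unfolding component_in_def by blast
      moreover have "finite (component_in (graph_power ?R (2 * k)) (X i) z)"
        using X(1)[of i] i z by (auto simp: graph_finite_def)
      ultimately show ?thesis by (rule finite_subset)
    qed
    moreover have "H.A \<subseteq> (\<Union>i<Suc s. X i)"
      using X(2) AB(3) unfolding HA lessThan_Suc_atMost by blast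
    ultimately show "\<exists>X. (\<forall>i<Suc s. H.borel_vertices (X i) \<and>
        (\<forall>z\<in>X i. finite ((H.adj ^^ k \<inter> X i \<times> X i)\<^sup>* `` {z}))) \<and> H.A \<subseteq> (\<Union>i<Suc s. X i)"
      by (intro exI[of _ X]) blast
  qed
  then obtain N where N: "N \<in> sets ?E" "\<alpha> ` N = A" "inj_on \<alpha> N" "inj_on \<beta> N" unfolding HA by blast
  have NE: "N \<subseteq> space ?E" using N(1) sets.sets_into_space by blast
  have "disjnt (ends G e) (ends G f)" if "e \<in> N" "f \<in> N" "e \<noteq> f" for e f
  proof -
    have "\<alpha> e \<noteq> \<alpha> f" "\<beta> e \<noteq> \<beta> f" using that N(3,4) by (auto dest: inj_onD)
    moreover have "e \<in> space ?E" "f \<in> space ?E" using that NE by auto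
    ultimately show ?thesis using \<alpha>\<beta>[of e] \<alpha>\<beta>[of f] AB(4) by (auto simp: disjnt_def)
  qed
  then have "borel_matching G N" using N(1) NE by (auto simp: borel_matching_def matching_def pairwise_def)
  moreover have "covers G N A"
    unfolding covers_def
  proof
    fix x assume "x \<in> A"
    then obtain e where "e \<in> N" "\<alpha> e = x" using N(2) by auto
    then show "\<exists>e\<in>N. x \<in> ends G e" using \<alpha>\<beta> NE by blast
  qed
  ultimately show ?thesis by blast
qed

end
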